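(* Let $\mathcal{B}$ be a Serre subcategory of an abelian category $\mathcal{A}$, let $\mathcal{C}=\mathcal{A}/\mathcal{B}$, and let $\mathcal{E}\subset\mathcal{A}$ be the full subcategory of $\mathcal{B}$-closed objects. Consider a full subcategory $\mathcal{G}\subset\mathcal{E}$ closed under extensions in $\mathcal{C}$. Then, for any $G_1,G_2\in\mathcal{G}$, $$\operatorname{Ext}^1_{\mathcal{C}}(G_1,G_2)=\varinjlim_{(\mathcal{A}/^{\mathcal{B}}G_1)^{\mathrm{op}}}\operatorname{Ext}^1_{\mathcal{A}}(-,G_2).$$
   Context: The full subcategory of $\mathcal{B}$-closed objects is $\mathcal{E}=\{A\in\mathcal{A}\mid\operatorname{Hom}(B,A)=0=\operatorname{Ext}^1(B,A)\ \text{for all } B\in\mathcal{B}\}$. The quotient functor $q\colon\mathcal{A}\to\mathcal{C}$ is fully faithful on $\mathcal{E}$, so $\mathcal{E}$ and $\mathcal{G}$ are regarded as full subcategories of $\mathcal{C}$. For $E\in\mathcal{E}$, $\mathcal{A}/^{\mathcal{B}}E$ is the category whose objects are pairs $(A,i)$ with $A\in\mathcal{A}$ and $i\colon A\to E$ a monomorphism in $\mathcal{A}$ with cokernel in $\mathcal{B}$; a morphism $(A',i')\to(A,i)$ is $\varphi\in\operatorname{Hom}_{\mathcal{A}}(A',A)$ with $i\circ\varphi=i'$. The functor $\operatorname{Ext}^1_{\mathcal{A}}(-,G_2)\colon(\mathcal{A}/^{\mathcal{B}}G_1)^{\mathrm{op}}\to\mathrm{Ab}$ sends $(A,i)$ to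 $\operatorname{Ext}^1_{\mathcal{A}}(A,G_2)$ and a morphism to the pull-back of extensions along it. *)

theory Defs
  imports "HOL-Algebra.Group"
begin

section \<open>Categories and abelian categories\<close>

text \<open>
  A category is a record with explicit carriers for objects and arrows; composition is written in
  the usual order (first the right factor, then the left one). All operations are relevant only on
  the carriers, and composition only on composable pairs.
\<close>

record ('o, 'm) cat =
  Obj :: "'o set"
  Arr :: "'m set"
  Dom :: "'m \<Rightarrow> 'o"
  Cod :: "'m \<Rightarrow> 'o"
  Ident :: "'o \<Rightarrow> 'm"
  Comp :: "'m \<Rightarrow> 'm \<Rightarrow> 'm"  (infixl "\<cdot>\<index>" 70)

definition Hom :: "('o, 'm, 'x) cat_scheme \<Rightarrow> 'o \<Rightarrow> 'o \<Rightarrow> 'm set" where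
  "Hom C X Y = {f \<in> Arr C. Dom C f = X \<and> Cod C f = Y}"

locale category =
  fixes C :: "('o, 'm, 'x) cat_scheme" (structure)
  assumes Dom_in_Obj: "f \<in> Arr C \<Longrightarrow> Dom C f \<in> Obj C"
    and Cod_in_Obj: "f \<in> Arr C \<Longrightarrow> Cod C f \<in> Obj C"
    and Ident_in_Hom: "X \<in> Obj C \<Longrightarrow> Ident C X \<in> Hom C X X"
    and Comp_in_Hom: "\<lbrakk>f \<in> Hom C X Y; g \<in> Hom C Y Z\<rbrakk> \<Longrightarrow> g \<cdot> f \<in> Hom C X Z"
    and Comp_Ident_right: "f \<in> Hom C X Y \<Longrightarrow> f \<cdot> Ident C X = f"
    and Comp_Ident_left: "f \<in> Hom C X Y \<Longrightarrow> Ident C Y \<cdot> f = f"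
    and Comp_assoc: "\<lbrakk>f \<in> Hom C W X; g \<in> Hom C X Y; h \<in> Hom C Y Z\<rbrakk>
      \<Longrightarrow> (h \<cdot> g) \<cdot> f = h \<cdot> (g \<cdot> f)"

definition op_cat :: "('o, 'm, 'x) cat_scheme \<Rightarrow> ('o, 'm) cat" where
  "op_cat C = \<lparr>Obj = Obj C, Arr = Arr C, Dom = Cod C, Cod = Dom C, Ident = Ident C,
     Comp = (\<lambda>g f. Comp C f g)\<rparr>"

definition is_iso :: "('o, 'm, 'x) cat_scheme \<Rightarrow> 'm \<Rightarrow> bool" where
  "is_iso C f \<longleftrightarrow> f \<in> Arr C \<and>
     (\<exists>g \<in> Hom C (Cod C f) (Dom C f).
        Comp C g f = Ident C (Dom C f) \<and> Comp C f g = Ident C (Cod C f))"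

definition isomorphic :: "('o, 'm, 'x) cat_scheme \<Rightarrow> 'o \<Rightarrow> 'o \<Rightarrow> bool" where
  "isomorphic C X Y \<longleftrightarrow> (\<exists>f \<in> Hom C X Y. is_iso C f)"

definition is_mono :: "('o, 'm, 'x) cat_scheme \<Rightarrow> 'm \<Rightarrow> bool" where
  "is_mono C f \<longleftrightarrow> f \<in> Arr C \<and>
     (\<forall>W. \<forall>g \<in> Hom C W (Dom C f). \<forall>h \<in> Hom C W (Dom C f).
        Comp C f g = Comp C f h \<longrightarrow> g = h)"

definition is_epi :: "('o, 'm, 'x) cat_scheme \<Rightarrow> 'm \<Rightarrow> bool" where
  "is_epi C f \<longleftrightarrow> f \<in> Arr C \<and>
     (\<forall>W. \<forall>g \<in> Hom C (Cod C f) W. \<forall>h \<in> Hom C (Cod C f) W.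
        Comp C g f = Comp C h f \<longrightarrow> g = h)"

record ('o, 'm) preadd_cat = "('o, 'm) cat" +
  Add :: "'m \<Rightarrow> 'm \<Rightarrow> 'm"
  Zer :: "'o \<Rightarrow> 'o \<Rightarrow> 'm"

definition hom_group :: "('o, 'm, 'x) preadd_cat_scheme \<Rightarrow> 'o \<Rightarrow> 'o \<Rightarrow> 'm monoid" where
  "hom_group C X Y = \<lparr>carrier = Hom C X Y, mult = Add C, one = Zer C X Y\<rparr>"

locale preadditive_category = category C
  for C :: "('o, 'm, 'x) preadd_cat_scheme" (structure) +
  assumes comm_group_hom: "\<lbrakk>X \<in> Obj C; Y \<in> Obj C\<rbrakk> \<Longrightarrow> comm_group (hom_group C X Y)"
    and Comp_Add_right: "\<lbrakk>f \<in> Hom C X Y; f' \<in> Hom C X Y; g \<in> Hom C Y Z\<rbrakk>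
      \<Longrightarrow> g \<cdot> (Add C f f') = Add C (g \<cdot> f) (g \<cdot> f')"
    and Comp_Add_left: "\<lbrakk>f \<in> Hom C X Y; g \<in> Hom C Y Z; g' \<in> Hom C Y Z\<rbrakk>
      \<Longrightarrow> (Add C g g') \<cdot> f = Add C (g \<cdot> f) (g' \<cdot> f)"

definition is_zero_object :: "('o, 'm, 'x) cat_scheme \<Rightarrow> 'o \<Rightarrow> bool" where
  "is_zero_object C Z \<longleftrightarrow> Z \<in> Obj C \<and>
     (\<forall>X \<in> Obj C. (\<exists>!f. f \<in> Hom C X Z) \<and> (\<exists>!f. f \<in> Hom C Z X))"

definition is_biproduct ::
  "('o, 'm, 'x) preadd_cat_scheme \<Rightarrow> 'o \<Rightarrow> 'o \<Rightarrow> 'o \<Rightarrow> 'm \<Rightarrow> 'm \<Rightarrow> 'm \<Rightarrow> 'm \<Rightarrow> bool" where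
  "is_biproduct C X Y P i1 i2 p1 p2 \<longleftrightarrow>
     i1 \<in> Hom C X P \<and> i2 \<in> Hom C Y P \<and> p1 \<in> Hom C P X \<and> p2 \<in> Hom C P Y \<and>
     Comp C p1 i1 = Ident C X \<and> Comp C p2 i2 = Ident C Y \<and>
     Comp C p1 i2 = Zer C Y X \<and> Comp C p2 i1 = Zer C X Y \<and>
     Add C (Comp C i1 p1) (Comp C i2 p2) = Ident C P"

definition is_kernel :: "('o, 'm, 'x) preadd_cat_scheme \<Rightarrow> 'm \<Rightarrow> 'm \<Rightarrow> bool" where
  "is_kernel C k f \<longleftrightarrow> k \<in> Arr C \<and> f \<in> Arr C \<and> Cod C k = Dom C f \<and>
     Comp C f k = Zer C (Dom C k) (Cod C f) \<and>
     (\<forall>h \<in> Arr C. Cod C h = Dom C f \<and> Comp C f h = Zer C (Dom C h) (Cod C f) \<longrightarrow>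
        (\<exists>!u. u \<in> Hom C (Dom C h) (Dom C k) \<and> Comp C k u = h))"

definition is_cokernel :: "('o, 'm, 'x) preadd_cat_scheme \<Rightarrow> 'm \<Rightarrow> 'm \<Rightarrow> bool" where
  "is_cokernel C c f \<longleftrightarrow> c \<in> Arr C \<and> f \<in> Arr C \<and> Dom C c = Cod C f \<and>
     Comp C c f = Zer C (Dom C f) (Cod C c) \<and>
     (\<forall>h \<in> Arr C. Dom C h = Cod C f \<and> Comp C h f = Zer C (Dom C f) (Cod C h) \<longrightarrow>
        (\<exists>!u. u \<in> Hom C (Cod C c) (Cod C h) \<and> Comp C u c = h))"

locale abelian_category = preadditive_category C
  for C :: "('o, 'm, 'x) preadd_cat_scheme" (structure) +
  assumes zero_object: "\<exists>Z. is_zero_object C Z"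
    and biproducts: "\<lbrakk>X \<in> Obj C; Y \<in> Obj C\<rbrakk> \<Longrightarrow> \<exists>P i1 i2 p1 p2. is_biproduct C X Y P i1 i2 p1 p2"
    and kernels: "f \<in> Arr C \<Longrightarrow> \<exists>k. is_kernel C k f"
    and cokernels: "f \<in> Arr C \<Longrightarrow> \<exists>c. is_cokernel C c f"
    and monos_normal: "is_mono C f \<Longrightarrow> \<exists>g. is_kernel C f g"
    and epis_normal: "is_epi C f \<Longrightarrow> \<exists>g. is_cokernel C f g"

definition short_exact :: "('o, 'm, 'x) preadd_cat_scheme \<Rightarrow> 'm \<Rightarrow> 'm \<Rightarrow> bool" where
  "short_exact C k p \<longleftrightarrow> is_kernel C k p \<and> is_cokernel C p k"

section \<open>Yoneda Ext groups\<close>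

text \<open>
  An extension \<open>0 \<rightarrow> X \<rightarrow> Y \<rightarrow> Z \<rightarrow> 0\<close> is represented by its pair of arrows \<open>X \<rightarrow> Y\<close>, \<open>Y \<rightarrow> Z\<close>.
\<close>

definition extensions :: "('o, 'm, 'x) preadd_cat_scheme \<Rightarrow> 'o \<Rightarrow> 'o \<Rightarrow> ('m \<times> 'm) set" where
  "extensions C Z X = {(k, p). short_exact C k p \<and> Dom C k = X \<and> Cod C p = Z}"

definition ext_mor ::
  "('o, 'm, 'x) preadd_cat_scheme \<Rightarrow> 'm \<Rightarrow> 'm \<Rightarrow> 'm \<Rightarrow> 'm \<times> 'm \<Rightarrow> 'm \<times> 'm \<Rightarrow> bool" where
  "ext_mor C \<alpha> \<beta> \<gamma> e e' \<longleftrightarrow>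
     \<alpha> \<in> Hom C (Dom C (fst e)) (Dom C (fst e')) \<and>
     \<beta> \<in> Hom C (Cod C (fst e)) (Cod C (fst e')) \<and>
     \<gamma> \<in> Hom C (Cod C (snd e)) (Cod C (snd e')) \<and>
     Comp C \<beta> (fst e) = Comp C (fst e') \<alpha> \<and>
     Comp C (snd e') \<beta> = Comp C \<gamma> (snd e)"

definition ext_equiv ::
  "('o, 'm, 'x) preadd_cat_scheme \<Rightarrow> 'o \<Rightarrow> 'o \<Rightarrow> (('m \<times> 'm) \<times> ('m \<times> 'm)) set" where
  "ext_equiv C Z X = {(e, e'). e \<in> extensions C Z X \<and> e' \<in> extensions C Z X \<and>
     (\<exists>\<beta>. is_iso C \<beta> \<and> ext_mor C (Ident C X) \<beta> (Ident C Z) e e')}"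

text \<open>
  As in Mac Lane's Homology, the pull-back \<open>e \<phi>\<close> of an extension \<open>e\<close> of \<open>Z\<close> by \<open>X\<close> along
  \<open>\<phi> : Z' \<rightarrow> Z\<close> is the extension of \<open>Z'\<close> by \<open>X\<close> that admits a morphism \<open>(1, \<beta>, \<phi>)\<close> to \<open>e\<close> (the
  square formed by \<open>\<beta>\<close> and \<open>\<phi>\<close> is then cartesian), and the push-out \<open>\<alpha> e\<close> along \<open>\<alpha> : X \<rightarrow> X'\<close> is
  the extension of \<open>Z\<close> by \<open>X'\<close> that admits a morphism \<open>(\<alpha>, \<beta>, 1)\<close> from \<open>e\<close>. Both are determined
  up to equivalence.
\<close>

definition is_ext_pullback ::
  "('o, 'm, 'x) preadd_cat_scheme \<Rightarrow> 'm \<Rightarrow> 'm \<times> 'm \<Rightarrow> 'm \<times> 'm \<Rightarrow> bool" where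
  "is_ext_pullback C \<phi> e e' \<longleftrightarrow>
     e' \<in> extensions C (Dom C \<phi>) (Dom C (fst e)) \<and>
     (\<exists>\<beta>. ext_mor C (Ident C (Dom C (fst e))) \<beta> \<phi> e' e)"

definition is_ext_pushout ::
  "('o, 'm, 'x) preadd_cat_scheme \<Rightarrow> 'm \<Rightarrow> 'm \<times> 'm \<Rightarrow> 'm \<times> 'm \<Rightarrow> bool" where
  "is_ext_pushout C \<alpha> e e' \<longleftrightarrow>
     e' \<in> extensions C (Cod C (snd e)) (Cod C \<alpha>) \<and>
     (\<exists>\<beta>. ext_mor C \<alpha> \<beta> (Ident C (Cod C (snd e))) e e')"

text \<open>
  The Baer sum \<open>\<nabla> (e \<oplus> e') \<Delta>\<close> of two extensions of \<open>Z\<close> by \<open>X\<close>. In terms of biproduct injections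
  and projections, the diagonal is \<open>j1 + j2 : Z \<rightarrow> Z \<oplus> Z\<close> and the codiagonal is
  \<open>r1 + r2 : X \<oplus> X \<rightarrow> X\<close>; \<open>d\<close> is the direct sum of the two extensions.
\<close>

definition is_baer_sum ::
  "('o, 'm, 'x) preadd_cat_scheme \<Rightarrow> 'o \<Rightarrow> 'o \<Rightarrow> 'm \<times> 'm \<Rightarrow> 'm \<times> 'm \<Rightarrow> 'm \<times> 'm \<Rightarrow> bool" where
  "is_baer_sum C Z X e e' s \<longleftrightarrow>
     (\<exists>XX i1 i2 r1 r2 YY m1 m2 n1 n2 ZZ j1 j2 t1 t2 d d'.
        is_biproduct C X X XX i1 i2 r1 r2 \<and>
        is_biproduct C (Cod C (fst e)) (Cod C (fst e')) YY m1 m2 n1 n2 \<and>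
        is_biproduct C Z Z ZZ j1 j2 t1 t2 \<and>
        d = (Add C (Comp C (Comp C m1 (fst e)) r1) (Comp C (Comp C m2 (fst e')) r2),
             Add C (Comp C (Comp C j1 (snd e)) n1) (Comp C (Comp C j2 (snd e')) n2)) \<and>
        is_ext_pullback C (Add C j1 j2) d d' \<and>
        is_ext_pushout C (Add C r1 r2) d' s)"

text \<open>\<open>Ext1 C Z X\<close> is \<open>Ext\<^sup>1(Z, X)\<close>; its neutral element is the class of the split extensions.\<close>

definition Ext1 ::
  "('o, 'm, 'x) preadd_cat_scheme \<Rightarrow> 'o \<Rightarrow> 'o \<Rightarrow> ('m \<times> 'm) set monoid" where
  "Ext1 C Z X =
     \<lparr>carrier = extensions C Z X // ext_equiv C Z X,
      mult = (\<lambda>c c'. {s. \<exists>e \<in> c. \<exists>e' \<in> c'. is_baer_sum C Z X e e' s}),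
      one = {(k, p) \<in> extensions C Z X. \<exists>\<sigma> \<in> Hom C Z (Dom C p). Comp C p \<sigma> = Ident C Z}\<rparr>"

text \<open>For \<open>\<phi> : Z' \<rightarrow> Z\<close>, the map \<open>Ext\<^sup>1(Z, X) \<rightarrow> Ext\<^sup>1(Z', X)\<close> given by pull-back along \<open>\<phi>\<close>.\<close>

definition Ext1_pull :: "('o, 'm, 'x) preadd_cat_scheme \<Rightarrow> 'm \<Rightarrow> ('m \<times> 'm) set \<Rightarrow> ('m \<times> 'm) set" where
  "Ext1_pull C \<phi> c = {e'. \<exists>e \<in> c. is_ext_pullback C \<phi> e e'}"

section \<open>Serre quotients\<close>

definition serre_subcategory :: "('o, 'm, 'x) preadd_cat_scheme \<Rightarrow> 'o set \<Rightarrow> bool" where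
  "serre_subcategory A B \<longleftrightarrow> B \<subseteq> Obj A \<and> B \<noteq> {} \<and>
     (\<forall>k p. short_exact A k p \<longrightarrow> (Cod A k \<in> B \<longleftrightarrow> Dom A k \<in> B \<and> Cod A p \<in> B))"

definition closed_objects :: "('o, 'm, 'x) preadd_cat_scheme \<Rightarrow> 'o set \<Rightarrow> 'o set" where
  "closed_objects A B = {X \<in> Obj A. \<forall>T \<in> B.
     Hom A T X = {Zer A T X} \<and> carrier (Ext1 A T X) = {one (Ext1 A T X)}}"

definition serre_isos :: "('o, 'm, 'x) preadd_cat_scheme \<Rightarrow> 'o set \<Rightarrow> 'm set" where
  "serre_isos A B = {s \<in> Arr A. (\<exists>k. is_kernel A k s \<and> Dom A k \<in> B) \<and>
                               (\<exists>c. is_cokernel A c s \<and> Cod A c \<in> B)}"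

text \<open>
  The quotient category is the localization of \<open>A\<close> at the arrows with kernel and cokernel in \<open>B\<close>,
  constructed by the calculus of fractions. The roof \<open>X \<leftarrow> W \<rightarrow> Y\<close> with left leg \<open>s\<close> and right leg
  \<open>f\<close>, standing for \<open>f s\<inverse>\<close>, is the pair \<open>(s, f)\<close>. An arrow of the quotient is an equivalence class
  of roofs; all roofs in a class have the same source and target.
\<close>

definition roofs :: "('o, 'm, 'x) preadd_cat_scheme \<Rightarrow> 'o set \<Rightarrow> ('m \<times> 'm) set" where
  "roofs A B = {(s, f). s \<in> serre_isos A B \<and> f \<in> Arr A \<and> Dom A f = Dom A s}"

definition roof_rel ::
  "('o, 'm, 'x) preadd_cat_scheme \<Rightarrow> 'o set \<Rightarrow> (('m \<times> 'm) \<times> ('m \<times> 'm)) set" where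
  "roof_rel A B = {((s, f), (t, g)). (s, f) \<in> roofs A B \<and> (t, g) \<in> roofs A B \<and>
     Cod A s = Cod A t \<and> Cod A f = Cod A g \<and>
     (\<exists>W. \<exists>u \<in> Hom A W (Dom A s). \<exists>v \<in> Hom A W (Dom A t).
        Comp A s u = Comp A t v \<and> Comp A s u \<in> serre_isos A B \<and> Comp A f u = Comp A g v)}"

definition roof_class ::
  "('o, 'm, 'x) preadd_cat_scheme \<Rightarrow> 'o set \<Rightarrow> 'm \<times> 'm \<Rightarrow> ('m \<times> 'm) set" where
  "roof_class A B r = roof_rel A B `` {r}"

text \<open>
  In a composite of \<open>X \<leftarrow> W1 \<rightarrow> Y\<close> and \<open>Y \<leftarrow> W2 \<rightarrow> Z\<close> the arrows \<open>u : W \<rightarrow> W1\<close> and \<open>v : W \<rightarrow> W2\<close>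
  complete the roofs to a commutative diagram; two arrows are added by means of representatives with a
  common left leg. The unions below are unions of one and the same class.
\<close>

definition serre_quotient ::
  "('o, 'm, 'x) preadd_cat_scheme \<Rightarrow> 'o set \<Rightarrow> ('o, ('m \<times> 'm) set) preadd_cat" where
  "serre_quotient A B =
     \<lparr>Obj = Obj A,
      Arr = roofs A B // roof_rel A B,
      Dom = (\<lambda>\<phi>. Cod A (fst (SOME r. r \<in> \<phi>))),
      Cod = (\<lambda>\<phi>. Cod A (snd (SOME r. r \<in> \<phi>))),
      Ident = (\<lambda>X. roof_class A B (Ident A X, Ident A X)),
      Comp = (\<lambda>\<psi> \<phi>. \<Union> {roof_class A B (Comp A s u, Comp A g v) | s f t g u v W.
                (s, f) \<in> \<phi> \<and> (t, g) \<in> \<psi> \<and>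
                u \<in> Hom A W (Dom A s) \<and> v \<in> Hom A W (Dom A t) \<and>
                Comp A s u \<in> serre_isos A B \<and> Comp A f u = Comp A t v}),
      Add = (\<lambda>\<phi> \<psi>. \<Union> {roof_class A B (s, Add A f g) | s f g. (s, f) \<in> \<phi> \<and> (s, g) \<in> \<psi>}),
      Zer = (\<lambda>X Y. roof_class A B (Ident A X, Zer A X Y))\<rparr>"

text \<open>The quotient functor is the identity on objects; this is its effect on arrows.\<close>

definition quot_map ::
  "('o, 'm, 'x) preadd_cat_scheme \<Rightarrow> 'o set \<Rightarrow> 'm \<Rightarrow> ('m \<times> 'm) set" where
  "quot_map A B f = roof_class A B (Ident A (Dom A f), f)"

text \<open>
  Closure under extensions of the full subcategory of \<open>C\<close> on the objects \<open>G\<close>, understood up to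
  isomorphism in \<open>C\<close>.
\<close>

definition extension_closed :: "('o, 'm, 'x) preadd_cat_scheme \<Rightarrow> 'o set \<Rightarrow> bool" where
  "extension_closed C G \<longleftrightarrow>
     (\<forall>k p. short_exact C k p \<and> Dom C k \<in> G \<and> Cod C p \<in> G \<longrightarrow>
        (\<exists>H \<in> G. isomorphic C (Cod C k) H))"

text \<open>
  The category of monomorphisms into \<open>E\<close> with cokernel in \<open>B\<close>. An arrow is recorded together with
  its source and target: it is a triple \<open>((X', i'), \<phi>, (X, i))\<close>.
\<close>

definition sub_cat ::
  "('o, 'm, 'x) preadd_cat_scheme \<Rightarrow> 'o set \<Rightarrow> 'o
     \<Rightarrow> ('o \<times> 'm, ('o \<times> 'm) \<times> 'm \<times> ('o \<times> 'm)) cat" where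
  "sub_cat A B E =
     (let Ob = {(X, i). X \<in> Obj A \<and> i \<in> Hom A X E \<and> is_mono A i \<and>
                        (\<exists>c. is_cokernel A c i \<and> Cod A c \<in> B)}
      in \<lparr>Obj = Ob,
          Arr = {(a', \<phi>, a). a' \<in> Ob \<and> a \<in> Ob \<and>
                   \<phi> \<in> Hom A (fst a') (fst a) \<and> Comp A (snd a) \<phi> = snd a'},
          Dom = (\<lambda>(a', \<phi>, a). a'),
          Cod = (\<lambda>(a', \<phi>, a). a),
          Ident = (\<lambda>a. (a, Ident A (fst a), a)),
          Comp = (\<lambda>(_, \<psi>, a) (a'', \<phi>, _). (a'', Comp A \<psi> \<phi>, a))\<rparr>)"

text \<open>
  For \<open>(X, i)\<close> in \<^term>\<open>sub_cat A B E\<close>, the canonical map from \<open>Ext\<^sup>1(X, Y)\<close> in \<open>A\<close> to \<open>Ext\<^sup>1(E, Y)\<close>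
  in the quotient: apply the quotient functor \<open>q\<close> to an extension \<open>(k, p)\<close> of \<open>X\<close> by \<open>Y\<close> and
  identify \<open>X\<close> with \<open>E\<close> by means of the isomorphism \<open>q i\<close>.
\<close>

definition Ext1_to_quotient ::
  "('o, 'm, 'x) preadd_cat_scheme \<Rightarrow> 'o set \<Rightarrow> 'o \<Rightarrow> 'o \<Rightarrow> 'm
     \<Rightarrow> ('m \<times> 'm) set \<Rightarrow> (('m \<times> 'm) set \<times> ('m \<times> 'm) set) set" where
  "Ext1_to_quotient A B E Y i c =
     (\<Union>(k, p) \<in> c. ext_equiv (serre_quotient A B) E Y ``
        {(quot_map A B k, Comp (serre_quotient A B) (quot_map A B i) (quot_map A B p))})"

section \<open>Colimits of abelian groups\<close>

text \<open>
  A functor from \<open>J\<close> to abelian groups, \<open>F\<close> on objects and \<open>m\<close> on arrows.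
\<close>

definition ab_functor ::
  "('j, 'u, 'x) cat_scheme \<Rightarrow> ('j \<Rightarrow> 'a monoid) \<Rightarrow> ('u \<Rightarrow> 'a \<Rightarrow> 'a) \<Rightarrow> bool" where
  "ab_functor J F m \<longleftrightarrow> category J \<and>
     (\<forall>j \<in> Obj J. comm_group (F j)) \<and>
     (\<forall>u \<in> Arr J. m u \<in> hom (F (Dom J u)) (F (Cod J u))) \<and>
     (\<forall>j \<in> Obj J. \<forall>x \<in> carrier (F j). m (Ident J j) x = x) \<and>
     (\<forall>u \<in> Arr J. \<forall>v \<in> Arr J. Cod J u = Dom J v \<longrightarrow>
        (\<forall>x \<in> carrier (F (Dom J u)). m (Comp J v u) x = m v (m u x)))"

definition ab_cocone ::
  "('j, 'u, 'x) cat_scheme \<Rightarrow> ('j \<Rightarrow> 'a monoid) \<Rightarrow> ('u \<Rightarrow> 'a \<Rightarrow> 'a)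
     \<Rightarrow> 'b monoid \<Rightarrow> ('j \<Rightarrow> 'a \<Rightarrow> 'b) \<Rightarrow> bool" where
  "ab_cocone J F m L \<iota> \<longleftrightarrow> comm_group L \<and>
     (\<forall>j \<in> Obj J. \<iota> j \<in> hom (F j) L) \<and>
     (\<forall>u \<in> Arr J. \<forall>x \<in> carrier (F (Dom J u)). \<iota> (Cod J u) (m u x) = \<iota> (Dom J u) x)"

text \<open>
  \<open>L\<close> with the maps \<open>\<iota>\<close> is a colimit of the functor \<open>(F, m)\<close>. A definition cannot quantify over
  types, so the type of the elements of the test groups \<open>T\<close> is a parameter, to be left arbitrary
  where the notion is used.
\<close>

definition is_ab_colimit ::
  "'t itself \<Rightarrow> ('j, 'u, 'x) cat_scheme \<Rightarrow> ('j \<Rightarrow> 'a monoid) \<Rightarrow> ('u \<Rightarrow> 'a \<Rightarrow> 'a)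
     \<Rightarrow> 'b monoid \<Rightarrow> ('j \<Rightarrow> 'a \<Rightarrow> 'b) \<Rightarrow> bool" where
  "is_ab_colimit tt J F m L \<iota> \<longleftrightarrow>
     ab_functor J F m \<and> ab_cocone J F m L \<iota> \<and>
     (\<forall>(T :: 't monoid) \<tau>. ab_cocone J F m T \<tau> \<longrightarrow>
        (\<exists>h \<in> hom L T.
           (\<forall>j \<in> Obj J. \<forall>x \<in> carrier (F j). h (\<iota> j x) = \<tau> j x) \<and>
           (\<forall>h' \<in> hom L T. (\<forall>j \<in> Obj J. \<forall>x \<in> carrier (F j). h' (\<iota> j x) = \<tau> j x) \<longrightarrow>
              (\<forall>y \<in> carrier L. h' y = h y))))"

end

theory Submission
  imports Defs
begin

text \<open>
  The maps \<open>Ext\<^sup>1(X, G2) \<rightarrow> Ext\<^sup>1(G1, G2)\<close> into the quotient form a cocone over a directed system, so it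
  suffices that they are jointly surjective and that every class in the kernel of one of them dies
  under restriction. A class in the kernel has a section after localization; writing it as a fraction
  with denominator \<open>s\<close> gives a section over the image \<open>m\<close> of \<open>s\<close>, because the kernel of \<open>s\<close> has no
  nonzero map to \<open>G2\<close>. For surjectivity, the middle term of an extension in the quotient may be taken
  closed; then both of its arrows come from \<open>A\<close>, and corestricting the second one to its image gives an
  extension in \<open>A\<close>, since \<open>G2\<close> has no extensions by, and the middle term no maps from, objects of \<open>B\<close>.

  The group structure on \<open>Ext\<^sup>1(Z, X)\<close> reduces to that of the Hom groups: any three extensions are
  push-outs \<open>\<alpha>\<^sub>i d\<close> of a single \<open>d\<close>, and \<open>(\<alpha> + \<beta>) d\<close> is the Baer sum of \<open>\<alpha> d\<close> and \<open>\<beta> d\<close>.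
  Pull-backs and exact additive functors commute with push-outs, hence preserve Baer sums.
\<close>

text \<open>The index category contains only monomorphisms, whereas a denominator in the quotient is
  an arbitrary arrow with kernel and cokernel in \<open>B\<close>; hence denominators must be
  replaced by their images. The two halves of closedness meet two different obstacles: vanishing of
  Hom removes kernels lying in \<open>B\<close>, and vanishing of Ext^1 splits off cokernels lying
  in \<open>B\<close>. Together they make the quotient functor full on arrows with closed target,
  and extension-closedness of \<open>G\<close> is what puts the middle term of an extension among
  those targets. The Ext groups of the quotient are groups because the quotient is abelian, and that
  has to be built up from roofs. Duality halves the work: kernels and cokernels, pull-backs and
  push-outs of extensions, right and left fractions correspond under \<open>dual\<close>, so one of
  each pair is proved and the other is read off. Directedness of the index category comes from
  intersecting subobjects.\<close>

context category
begin

section \<open>Composition, monomorphisms and isomorphisms\<close>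

declare Dom_in_Obj [simp] Cod_in_Obj [simp]

lemma Hom_iff: "f \<in> Hom C X Y \<longleftrightarrow>
    f \<in> Arr C \<and> Dom C f = X \<and> Cod C f = Y \<and> X \<in> Obj C \<and> Y \<in> Obj C"
  using Dom_in_Obj Cod_in_Obj by (auto simp: Hom_def)

lemma Comp_typing [simp]:
  assumes "f \<in> Arr C" "g \<in> Arr C" "Cod C f = Dom C g"
  shows "g \<cdot> f \<in> Arr C" "Dom C (g \<cdot> f) = Dom C f" "Cod C (g \<cdot> f) = Cod C g"
  using Comp_in_Hom[of f "Dom C f" "Cod C f" g "Cod C g"] assms by (auto simp: Hom_def)

lemma Ident_typing [simp]:
  assumes "X \<in> Obj C"
  shows "Ident C X \<in> Arr C" "Dom C (Ident C X) = X" "Cod C (Ident C X) = X"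
  using Ident_in_Hom[OF assms] by (auto simp: Hom_def)

lemma Ident_right [simp]: "\<lbrakk>f \<in> Arr C; Dom C f = X\<rbrakk> \<Longrightarrow> f \<cdot> Ident C X = f"
  and Ident_left [simp]: "\<lbrakk>f \<in> Arr C; Cod C f = X\<rbrakk> \<Longrightarrow> Ident C X \<cdot> f = f"
  by (auto simp: Hom_def intro: Comp_Ident_right Comp_Ident_left)

lemma assoc [simp]:
  "\<lbrakk>f \<in> Arr C; g \<in> Arr C; h \<in> Arr C; Cod C f = Dom C g; Cod C g = Dom C h\<rbrakk>
    \<Longrightarrow> (h \<cdot> g) \<cdot> f = h \<cdot> (g \<cdot> f)"
  by (rule Comp_assoc) (auto simp: Hom_def)

text \<open>The simp rule \<open>assoc\<close> brackets composites to the right, so an equation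
  between two composites no longer matches once a further factor \<open>x\<close> stands on its
  right. This is the form that still applies; \<open>Comp_eqD\<close> does the same when the
  right-hand side is a single arrow.\<close>

lemma Comp_eq_Comp:
  assumes "g \<cdot> f = k \<cdot> h" "f \<in> Arr C" "g \<in> Arr C" "k \<in> Arr C" "h \<in> Arr C" "x \<in> Arr C"
    "Cod C f = Dom C g" "Cod C h = Dom C k" "Cod C x = Dom C f"
  shows "g \<cdot> (f \<cdot> x) = k \<cdot> (h \<cdot> x)"
proof -
  have "Dom C f = Dom C h"
    using assms Comp_typing(2) by metis
  have "g \<cdot> (f \<cdot> x) = (g \<cdot> f) \<cdot> x" using assms(2-) by simp
  also have "\<dots> = (k \<cdot> h) \<cdot> x" using assms(1) by simp
  finally show ?thesis
    using assms(2-) \<open>Dom C f = Dom C h\<close> by simp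
qed

lemma Comp_eqD:
  assumes "g \<cdot> f = k" "f \<in> Arr C" "g \<in> Arr C" "x \<in> Arr C"
    "Cod C f = Dom C g" "Cod C x = Dom C f"
  shows "g \<cdot> (f \<cdot> x) = k \<cdot> x"
  using assms(2-) by (simp add: assms(1)[symmetric])

text \<open>Equality of the sources of \<open>g\<close> and \<open>h\<close> is read off from the
  equality of the composites, which yields the common Hom set of the definition.\<close>

lemma is_mono_cancel:
  assumes "is_mono C f" "g \<in> Arr C" "h \<in> Arr C" "Cod C g = Dom C f" "Cod C h = Dom C f"
    "f \<cdot> g = f \<cdot> h"
  shows "g = h"
proof -
  have "f \<in> Arr C" using assms by (simp add: is_mono_def)
  then have "Dom C g = Dom C h"
    using assms Comp_typing(2) by metis
  then show ?thesis using assms unfolding is_mono_def Hom_def by blast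
qed

lemma is_isoE:
  assumes "is_iso C f"
  obtains g where "f \<in> Arr C" "g \<in> Arr C" "Dom C g = Cod C f" "Cod C g = Dom C f"
    "g \<cdot> f = Ident C (Dom C f)" "f \<cdot> g = Ident C (Cod C f)"
  using assms unfolding is_iso_def Hom_def by blast

lemma is_isoI:
  assumes "f \<in> Arr C" "g \<in> Arr C" "Dom C g = Cod C f" "Cod C g = Dom C f"
    "g \<cdot> f = Ident C (Dom C f)" "f \<cdot> g = Ident C (Cod C f)"
  shows "is_iso C f"
  using assms unfolding is_iso_def Hom_def by blast

lemma is_mono_comp:
  assumes "is_mono C f" "is_mono C g" "Cod C f = Dom C g"
  shows "is_mono C (g \<cdot> f)"
proof -
  have [simp]: "f \<in> Arr C" "g \<in> Arr C" using assms by (auto simp: is_mono_def)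
  show ?thesis unfolding is_mono_def
  proof (intro conjI allI ballI impI)
    fix W h k assume hk: "h \<in> Hom C W (Dom C (g \<cdot> f))" "k \<in> Hom C W (Dom C (g \<cdot> f))"
      and eq: "g \<cdot> f \<cdot> h = g \<cdot> f \<cdot> k"
    then have *: "g \<cdot> (f \<cdot> h) = g \<cdot> (f \<cdot> k)" using assms by (simp add: Hom_def)
    have "f \<cdot> h = f \<cdot> k"
      by (rule is_mono_cancel[OF assms(2) _ _ _ _ *]) (use hk assms in \<open>auto simp: Hom_def\<close>)
    then show "h = k"
      by (rule is_mono_cancel[OF assms(1), rotated 4]) (use hk assms in \<open>auto simp: Hom_def\<close>)
  qed (use assms in simp)
qed

lemma is_mono_factor:
  assumes "is_mono C (g \<cdot> f)" "f \<in> Arr C" "g \<in> Arr C" "Cod C f = Dom C g"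
  shows "is_mono C f"
  unfolding is_mono_def
proof (intro conjI allI ballI impI)
  fix W h k assume hk: "h \<in> Hom C W (Dom C f)" "k \<in> Hom C W (Dom C f)" and eq: "f \<cdot> h = f \<cdot> k"
  show "h = k"
    by (rule is_mono_cancel[OF assms(1)]) (use hk assms eq in \<open>auto simp: Hom_def\<close>)
qed (use assms in simp)

end

section \<open>Arithmetic of Hom groups\<close>

definition Neg :: "('o, 'm, 'x) preadd_cat_scheme \<Rightarrow> 'm \<Rightarrow> 'm" where
  "Neg C f = m_inv (hom_group C (Dom C f) (Cod C f)) f"

context preadditive_category
begin

lemma Zer_typing [simp]:
  assumes "X \<in> Obj C" "Y \<in> Obj C"
  shows "Zer C X Y \<in> Arr C" "Dom C (Zer C X Y) = X" "Cod C (Zer C X Y) = Y"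
proof -
  interpret G: comm_group "hom_group C X Y" using assms by (rule comm_group_hom)
  show "Zer C X Y \<in> Arr C" "Dom C (Zer C X Y) = X" "Cod C (Zer C X Y) = Y"
    using G.one_closed by (auto simp: hom_group_def Hom_def)
qed

lemma Add_typing [simp]:
  assumes "f \<in> Arr C" "g \<in> Arr C" "Dom C f = Dom C g" "Cod C f = Cod C g"
  shows "Add C f g \<in> Arr C" "Dom C (Add C f g) = Dom C g" "Cod C (Add C f g) = Cod C g"
proof -
  interpret G: comm_group "hom_group C (Dom C g) (Cod C g)"
    using assms by (intro comm_group_hom Dom_in_Obj Cod_in_Obj)
  show "Add C f g \<in> Arr C" "Dom C (Add C f g) = Dom C g" "Cod C (Add C f g) = Cod C g"
    using G.m_closed[of f g] assms by (auto simp: hom_group_def Hom_def)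
qed

lemma Add_assoc:
  assumes "f \<in> Arr C" "g \<in> Arr C" "h \<in> Arr C" "Dom C f = Dom C g" "Cod C f = Cod C g"
     "Dom C g = Dom C h" "Cod C g = Cod C h"
   shows "Add C (Add C f g) h = Add C f (Add C g h)"
proof -
  interpret G: comm_group "hom_group C (Dom C g) (Cod C g)"
    using assms by (intro comm_group_hom Dom_in_Obj Cod_in_Obj)
  show ?thesis
    using G.m_assoc[of f g h] assms by (auto simp: hom_group_def Hom_def)
qed

lemma Add_commute:
  assumes "f \<in> Arr C" "g \<in> Arr C" "Dom C f = Dom C g" "Cod C f = Cod C g"
  shows "Add C f g = Add C g f"
proof -
  interpret G: comm_group "hom_group C (Dom C g) (Cod C g)"
    using assms by (intro comm_group_hom Dom_in_Obj Cod_in_Obj)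
  show ?thesis
    using G.m_comm[of f g] assms by (auto simp: hom_group_def Hom_def)
qed

lemma Add_Zer [simp]:
  assumes "f \<in> Arr C" "Dom C f = X" "Cod C f = Y"
  shows "Add C f (Zer C X Y) = f" "Add C (Zer C X Y) f = f"
proof -
  interpret G: comm_group "hom_group C X Y"
    using assms by (intro comm_group_hom) auto
  show "Add C f (Zer C X Y) = f" "Add C (Zer C X Y) f = f"
    using G.l_one[of f] G.r_one[of f] assms by (auto simp: hom_group_def Hom_def)
qed

lemma Neg_typing [simp]:
  assumes "f \<in> Arr C"
  shows "Neg C f \<in> Arr C" "Dom C (Neg C f) = Dom C f" "Cod C (Neg C f) = Cod C f"
proof -
  interpret G: comm_group "hom_group C (Dom C f) (Cod C f)"
    using assms by (intro comm_group_hom Dom_in_Obj Cod_in_Obj)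
  show "Neg C f \<in> Arr C" "Dom C (Neg C f) = Dom C f" "Cod C (Neg C f) = Cod C f"
    using G.inv_closed[of f] assms by (auto simp: hom_group_def Hom_def Neg_def)
qed

lemma Add_Neg [simp]:
  assumes "f \<in> Arr C"
  shows "Add C f (Neg C f) = Zer C (Dom C f) (Cod C f)"
    "Add C (Neg C f) f = Zer C (Dom C f) (Cod C f)"
proof -
  interpret G: comm_group "hom_group C (Dom C f) (Cod C f)"
    using assms by (intro comm_group_hom Dom_in_Obj Cod_in_Obj)
  show "Add C f (Neg C f) = Zer C (Dom C f) (Cod C f)"
    "Add C (Neg C f) f = Zer C (Dom C f) (Cod C f)"
    using G.l_inv[of f] G.r_inv[of f] assms by (auto simp: hom_group_def Hom_def Neg_def)
qed

lemma Add_eq_self: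
  assumes "f \<in> Arr C" "g \<in> Arr C" "Dom C f = Dom C g" "Cod C f = Cod C g" "Add C f g = g"
  shows "f = Zer C (Dom C f) (Cod C f)"
proof -
  interpret G: comm_group "hom_group C (Dom C g) (Cod C g)"
    using assms by (intro comm_group_hom Dom_in_Obj Cod_in_Obj)
  show ?thesis
    using G.l_cancel_one[of g f] G.r_cancel_one[of g f] assms by (auto simp: hom_group_def Hom_def)
qed

lemma Add_eq_Zer:
  assumes "f \<in> Arr C" "g \<in> Arr C" "Dom C f = Dom C g" "Cod C f = Cod C g"
    "Add C f (Neg C g) = Zer C (Dom C g) (Cod C g)"
  shows "f = g"
proof -
  have "f = Add C f (Add C (Neg C g) g)" using assms by simp
  also have "\<dots> = Add C (Add C f (Neg C g)) g" using assms(1-4) by (subst Add_assoc) simp_all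
  finally show ?thesis using assms by simp
qed

lemma distrib [simp]:
  assumes "f \<in> Arr C" "f' \<in> Arr C" "Dom C f = Dom C f'" "Cod C f = Cod C f'" "g \<in> Arr C"
  shows "Dom C g = Cod C f' \<Longrightarrow> g \<cdot> Add C f f' = Add C (g \<cdot> f) (g \<cdot> f')"
    "Cod C g = Dom C f' \<Longrightarrow> Add C f f' \<cdot> g = Add C (f \<cdot> g) (f' \<cdot> g)"
  using assms by (auto intro!: Comp_Add_right Comp_Add_left simp: Hom_def)

text \<open>By distributivity the composite is idempotent in its Hom group, and
  \<open>Add_eq_self\<close> turns idempotents into zero.\<close>

lemma Comp_Zer [simp]:
  assumes "f \<in> Arr C" "X \<in> Obj C"
  shows "Dom C f = Y \<Longrightarrow> f \<cdot> Zer C X Y = Zer C X (Cod C f)"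
    "Cod C f = Y \<Longrightarrow> Zer C Y X \<cdot> f = Zer C (Dom C f) X"
proof -
  assume Y: "Dom C f = Y"
  have [simp]: "Y \<in> Obj C" "Cod C f \<in> Obj C"
    using Y Dom_in_Obj[OF assms(1)] Cod_in_Obj[OF assms(1)] by auto
  have "Add C (f \<cdot> Zer C X Y) (f \<cdot> Zer C X Y) = f \<cdot> Add C (Zer C X Y) (Zer C X Y)"
    using assms Y by (subst distrib) auto
  also have "\<dots> = f \<cdot> Zer C X Y" using assms by (subst Add_Zer) auto
  finally show "f \<cdot> Zer C X Y = Zer C X (Cod C f)"
    using Add_eq_self[of "f \<cdot> Zer C X Y" "f \<cdot> Zer C X Y"] assms Y by simp
next
  assume Y: "Cod C f = Y"
  have [simp]: "Y \<in> Obj C" "Dom C f \<in> Obj C"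
    using Y Dom_in_Obj[OF assms(1)] Cod_in_Obj[OF assms(1)] by auto
  have "Add C (Zer C Y X \<cdot> f) (Zer C Y X \<cdot> f) = Add C (Zer C Y X) (Zer C Y X) \<cdot> f"
    using assms Y by (subst distrib) auto
  also have "\<dots> = Zer C Y X \<cdot> f" using assms by (subst Add_Zer) auto
  finally show "Zer C Y X \<cdot> f = Zer C (Dom C f) X"
    using Add_eq_self[of "Zer C Y X \<cdot> f" "Zer C Y X \<cdot> f"] assms Y by simp
qed

lemma Neg_unique:
  assumes "f \<in> Arr C" "g \<in> Arr C" "Dom C f = Dom C g" "Cod C f = Cod C g"
    "Add C f g = Zer C (Dom C g) (Cod C g)"
  shows "g = Neg C f"
proof -
  interpret G: comm_group "hom_group C (Dom C g) (Cod C g)"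
    using assms by (intro comm_group_hom Dom_in_Obj Cod_in_Obj)
  have "inv\<^bsub>hom_group C (Dom C g) (Cod C g)\<^esub> f = g"
    by (rule G.inv_equality) (use assms Add_commute[of f g] in \<open>auto simp: hom_group_def Hom_def\<close>)
  then show ?thesis using assms by (simp add: Neg_def)
qed

lemma Comp_Neg [simp]:
  assumes "f \<in> Arr C" "g \<in> Arr C"
  shows "Dom C g = Cod C f \<Longrightarrow> g \<cdot> Neg C f = Neg C (g \<cdot> f)"
    "Dom C f = Cod C g \<Longrightarrow> Neg C f \<cdot> g = Neg C (f \<cdot> g)"
proof -
  note [simp] = Dom_in_Obj Cod_in_Obj
  assume *: "Dom C g = Cod C f"
  have "Add C (g \<cdot> f) (g \<cdot> Neg C f) = g \<cdot> Add C f (Neg C f)"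
    using * assms by (subst distrib) auto
  then show "g \<cdot> Neg C f = Neg C (g \<cdot> f)"
    using assms * by (intro Neg_unique) simp_all
next
  note [simp] = Dom_in_Obj Cod_in_Obj
  assume *: "Dom C f = Cod C g"
  have "Add C (f \<cdot> g) (Neg C f \<cdot> g) = Add C f (Neg C f) \<cdot> g"
    using * assms by (subst distrib) auto
  then show "Neg C f \<cdot> g = Neg C (f \<cdot> g)"
    using assms * by (intro Neg_unique) simp_all
qed

end

section \<open>The opposite category\<close>

text \<open>Unlike \<open>op_cat\<close>, which returns a bare category, this keeps the additive
  structure, so that preadditive and abelian categories can be dualised.\<close>

definition dual :: "('o, 'm, 'x) preadd_cat_scheme \<Rightarrow> ('o, 'm) preadd_cat" where
  "dual C = \<lparr>Obj = Obj C, Arr = Arr C, Dom = Cod C, Cod = Dom C, Ident = Ident C,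
     Comp = (\<lambda>g f. Comp C f g), Add = Add C, Zer = (\<lambda>X Y. Zer C Y X)\<rparr>"

lemma dual_simps [simp]:
  "Obj (dual C) = Obj C" "Arr (dual C) = Arr C" "Dom (dual C) = Cod C" "Cod (dual C) = Dom C"
  "Ident (dual C) = Ident C" "Comp (dual C) g f = Comp C f g" "Add (dual C) = Add C"
  "Zer (dual C) X Y = Zer C Y X"
  by (simp_all add: dual_def)

lemma Hom_dual [simp]: "Hom (dual C) X Y = Hom C Y X"
  by (auto simp: Hom_def)

lemma hom_group_dual [simp]: "hom_group (dual C) X Y = hom_group C Y X"
  by (simp add: hom_group_def)

lemma Neg_dual [simp]: "Neg (dual C) f = Neg C f"
  by (simp add: Neg_def)

lemma is_mono_dual [simp]: "is_mono (dual C) f = is_epi C f"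
  by (simp add: is_mono_def is_epi_def)

lemma is_epi_dual [simp]: "is_epi (dual C) f = is_mono C f"
  by (simp add: is_mono_def is_epi_def)

lemma is_iso_dual [simp]: "is_iso (dual C) f = is_iso C f"
  by (auto simp: is_iso_def)

lemma is_kernel_dual [simp]: "is_kernel (dual C) k f = is_cokernel C k f"
  by (simp add: is_kernel_def is_cokernel_def)

lemma is_cokernel_dual [simp]: "is_cokernel (dual C) k f = is_kernel C k f"
  by (simp add: is_kernel_def is_cokernel_def)

lemma short_exact_dual [simp]: "short_exact (dual C) p k = short_exact C k p"
  by (auto simp: short_exact_def)

lemma is_zero_object_dual [simp]: "is_zero_object (dual C) Z = is_zero_object C Z"
  by (auto simp: is_zero_object_def)

lemma is_biproduct_dual [simp]:
  "is_biproduct (dual C) X Y P i1 i2 p1 p2 = is_biproduct C X Y P p1 p2 i1 i2"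
  by (auto simp: is_biproduct_def)

text \<open>Translates a statement about \<open>dual C\<close> into the dual statement about
  \<open>C\<close>; every \<open>unfolded unfold_dual\<close> below is an appeal to duality.\<close>

lemmas unfold_dual = dual_simps Hom_dual Neg_dual is_mono_dual is_epi_dual is_iso_dual
  is_kernel_dual is_cokernel_dual short_exact_dual is_zero_object_dual is_biproduct_dual

lemma (in preadditive_category) preadditive_category_dual: "preadditive_category (dual C)"
  by (intro preadditive_category.intro category.intro preadditive_category_axioms.intro)
    (auto simp: Hom_iff comm_group_hom)

lemma (in abelian_category) abelian_category_dual: "abelian_category (dual C)"
  by (intro abelian_category.intro abelian_category_axioms.intro preadditive_category_dual)
    (simp_all add: zero_object kernels cokernels monos_normal epis_normal, metis biproducts)

section \<open>Kernels and cokernels\<close>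

context preadditive_category
begin

lemma is_kernelE:
  assumes "is_kernel C k f"
  shows "k \<in> Arr C" "f \<in> Arr C" "Cod C k = Dom C f" "f \<cdot> k = Zer C (Dom C k) (Cod C f)"
  using assms by (auto simp: is_kernel_def)

lemma is_kernel_lift:
  assumes "is_kernel C k f" "h \<in> Arr C" "Cod C h = Dom C f" "f \<cdot> h = Zer C (Dom C h) (Cod C f)"
  obtains u where "u \<in> Arr C" "Dom C u = Dom C h" "Cod C u = Dom C k" "k \<cdot> u = h"
  using assms unfolding is_kernel_def Hom_def by blast

lemma is_monoI:
  assumes "f \<in> Arr C"
    and "\<And>g. \<lbrakk>g \<in> Arr C; Cod C g = Dom C f; f \<cdot> g = Zer C (Dom C g) (Cod C f)\<rbrakk>
      \<Longrightarrow> g = Zer C (Dom C g) (Dom C f)"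
  shows "is_mono C f"
  unfolding is_mono_def
proof (intro conjI allI ballI impI)
  fix W g h assume gh: "g \<in> Hom C W (Dom C f)" "h \<in> Hom C W (Dom C f)" "f \<cdot> g = f \<cdot> h"
  have "f \<cdot> Add C g (Neg C h) = Zer C W (Cod C f)"
    using gh assms(1) by (simp add: Hom_iff)
  then have "Add C g (Neg C h) = Zer C W (Dom C f)"
    using assms(2)[of "Add C g (Neg C h)"] gh by (simp add: Hom_iff)
  then show "g = h"
    using gh by (rule_tac Add_eq_Zer) (auto simp: Hom_iff)
qed (fact assms(1))

lemma is_mono_Zer:
  assumes "is_mono C f" "g \<in> Arr C" "Cod C g = Dom C f" "f \<cdot> g = Zer C (Dom C g) (Cod C f)"
  shows "g = Zer C (Dom C g) (Dom C f)"
proof -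
  have [simp]: "f \<in> Arr C" using assms by (simp add: is_mono_def)
  have [simp]: "Dom C g \<in> Obj C" "Dom C f \<in> Obj C"
    using Dom_in_Obj assms \<open>f \<in> Arr C\<close> by auto
  show ?thesis
    by (rule is_mono_cancel[OF assms(1)]) (use assms in auto)
qed

lemma is_kernelI:
  assumes "is_mono C k" "f \<in> Arr C" "Cod C k = Dom C f" "f \<cdot> k = Zer C (Dom C k) (Cod C f)"
    and "\<And>h. \<lbrakk>h \<in> Arr C; Cod C h = Dom C f; f \<cdot> h = Zer C (Dom C h) (Cod C f)\<rbrakk>
      \<Longrightarrow> \<exists>u\<in>Arr C. Dom C u = Dom C h \<and> Cod C u = Dom C k \<and> k \<cdot> u = h"
  shows "is_kernel C k f"
  unfolding is_kernel_def
proof (intro conjI ballI impI ex_ex1I)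
  fix h assume h: "h \<in> Arr C" "Cod C h = Dom C f \<and> f \<cdot> h = Zer C (Dom C h) (Cod C f)"
  show "\<exists>u. u \<in> Hom C (Dom C h) (Dom C k) \<and> k \<cdot> u = h"
    using assms(5)[of h] h by (auto simp: Hom_def)
  fix u v assume "u \<in> Hom C (Dom C h) (Dom C k) \<and> k \<cdot> u = h"
    "v \<in> Hom C (Dom C h) (Dom C k) \<and> k \<cdot> v = h"
  then show "u = v" by (rule_tac is_mono_cancel[OF assms(1)]) (auto simp: Hom_def)
qed (use assms in \<open>auto simp: is_mono_def\<close>)

lemma is_kernel_mono:
  assumes "is_kernel C k f" shows "is_mono C k"
  unfolding is_mono_def
proof (intro conjI allI ballI impI)
  note k = is_kernelE[OF assms]
  show "k \<in> Arr C" by (fact k(1))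
  fix W g h assume gh: "g \<in> Hom C W (Dom C k)" "h \<in> Hom C W (Dom C k)" "k \<cdot> g = k \<cdot> h"
  have z: "f \<cdot> (k \<cdot> g) = Zer C W (Cod C f)"
    using Comp_eqD[OF k(4,1,2), of g] gh k by (simp add: Hom_iff Cod_in_Obj)
  have *: "\<And>h. h \<in> Arr C \<Longrightarrow> Cod C h = Dom C f \<Longrightarrow> f \<cdot> h = Zer C (Dom C h) (Cod C f)
    \<Longrightarrow> \<exists>!u. u \<in> Hom C (Dom C h) (Dom C k) \<and> k \<cdot> u = h"
    using assms unfolding is_kernel_def by blast
  have "\<exists>!u. u \<in> Hom C (Dom C (k \<cdot> g)) (Dom C k) \<and> k \<cdot> u = k \<cdot> g"
    by (rule *) (use gh k z in \<open>auto simp: Hom_iff\<close>)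
  then show "g = h" using gh k by (auto simp: Hom_iff)
qed

text \<open>Composing with a mono does not change which arrows are annihilated. For an image
  factorization this trades the kernel of an arrow for that of its epi part.\<close>

lemma is_kernel_comp_mono:
  assumes "is_mono C m" "f \<in> Arr C" "Cod C f = Dom C m"
  shows "is_kernel C k (m \<cdot> f) \<longleftrightarrow> is_kernel C k f"
proof -
  have [simp]: "m \<in> Arr C" using assms by (simp add: is_mono_def)
  have eq: "m \<cdot> (f \<cdot> h) = Zer C (Dom C h) (Cod C m) \<longleftrightarrow> f \<cdot> h = Zer C (Dom C h) (Cod C f)"
    if "h \<in> Arr C" "Cod C h = Dom C f" for h
    using is_mono_Zer[OF assms(1), of "f \<cdot> h"] that assms by auto
  show ?thesis
  proof
    assume k: "is_kernel C k (m \<cdot> f)"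
    show "is_kernel C k f"
    proof (rule is_kernelI[OF is_kernel_mono[OF k]])
      fix h assume h: "h \<in> Arr C" "Cod C h = Dom C f" "f \<cdot> h = Zer C (Dom C h) (Cod C f)"
      then have "(m \<cdot> f) \<cdot> h = Zer C (Dom C h) (Cod C (m \<cdot> f))" using assms by simp
      then show "\<exists>u\<in>Arr C. Dom C u = Dom C h \<and> Cod C u = Dom C k \<and> k \<cdot> u = h"
        using is_kernel_lift[OF k, of h] h assms by (metis Comp_typing(2) \<open>m \<in> Arr C\<close>)
    qed (use is_kernelE[OF k] assms eq in auto)
  next
    assume k: "is_kernel C k f"
    show "is_kernel C k (m \<cdot> f)"
    proof (rule is_kernelI[OF is_kernel_mono[OF k]])
      fix h assume h: "h \<in> Arr C" "Cod C h = Dom C (m \<cdot> f)"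
        "(m \<cdot> f) \<cdot> h = Zer C (Dom C h) (Cod C (m \<cdot> f))"
      then have "f \<cdot> h = Zer C (Dom C h) (Cod C f)" using assms eq by simp
      then show "\<exists>u\<in>Arr C. Dom C u = Dom C h \<and> Cod C u = Dom C k \<and> k \<cdot> u = h"
        using is_kernel_lift[OF k, of h] h assms by (metis Comp_typing(2) \<open>m \<in> Arr C\<close>)
    qed (use is_kernelE[OF k] assms eq in auto)
  qed
qed

lemma is_kernel_iso_unique:
  assumes "is_kernel C k f" "is_kernel C l f"
  obtains u where "is_iso C u" "Dom C u = Dom C l" "Cod C u = Dom C k" "k \<cdot> u = l"
proof -
  note k = is_kernelE[OF assms(1)] is_kernelE[OF assms(2)]
  obtain u where u: "u \<in> Arr C" "Dom C u = Dom C l" "Cod C u = Dom C k" "k \<cdot> u = l"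
    using is_kernel_lift[OF assms(1), of l] k by auto
  obtain v where v: "v \<in> Arr C" "Dom C v = Dom C k" "Cod C v = Dom C l" "l \<cdot> v = k"
    using is_kernel_lift[OF assms(2), of k] k by auto
  have "u \<cdot> v = Ident C (Dom C k)"
    by (rule is_mono_cancel[OF is_kernel_mono[OF assms(1)]])
      (use k u v Comp_eqD[OF u(4), of v] in auto)
  moreover have "v \<cdot> u = Ident C (Dom C l)"
    by (rule is_mono_cancel[OF is_kernel_mono[OF assms(2)]])
      (use k u v Comp_eqD[OF v(4), of u] in auto)
  ultimately have "is_iso C u" using u v by (intro is_isoI[of u v]) auto
  then show ?thesis using u that by blast
qed

lemma is_iso_mono: "is_iso C f \<Longrightarrow> is_mono C f"
proof -
  assume f: "is_iso C f"
  then obtain g where g: "f \<in> Arr C" "g \<in> Arr C" "Dom C g = Cod C f" "Cod C g = Dom C f"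
    "g \<cdot> f = Ident C (Dom C f)" by (rule is_isoE)
  show ?thesis
  proof (rule is_monoI)
    fix h assume h: "h \<in> Arr C" "Cod C h = Dom C f" "f \<cdot> h = Zer C (Dom C h) (Cod C f)"
    have "g \<cdot> (f \<cdot> h) = h" using Comp_eqD[OF g(5), of h] g h by auto
    then show "h = Zer C (Dom C h) (Dom C f)" using g h by auto
  qed (fact g(1))
qed

lemma is_kernel_mono_zero:
  assumes "is_kernel C k f" "k = Zer C (Dom C k) (Dom C f)"
  shows "is_mono C f"
proof (rule is_monoI)
  note k = is_kernelE[OF assms(1)]
  fix h assume h: "h \<in> Arr C" "Cod C h = Dom C f" "f \<cdot> h = Zer C (Dom C h) (Cod C f)"
  obtain u where u: "u \<in> Arr C" "Dom C u = Dom C h" "Cod C u = Dom C k" "k \<cdot> u = h"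
    using is_kernel_lift[OF assms(1)] h by blast
  then have "h = Zer C (Dom C k) (Dom C f) \<cdot> u" using assms(2) by simp
  then show "h = Zer C (Dom C h) (Dom C f)" using u k by simp
qed (use is_kernelE[OF assms(1)] in auto)

text \<open>As an equation in a Hom group, the property passes along additive functors; this is how
  the quotient inherits its zero object.\<close>

lemma zero_object_iff:
  assumes [simp]: "Z \<in> Obj C"
  shows "is_zero_object C Z \<longleftrightarrow> Ident C Z = Zer C Z Z"
proof
  assume "is_zero_object C Z"
  then have "\<exists>!f. f \<in> Hom C Z Z" by (simp add: is_zero_object_def)
  moreover have "Ident C Z \<in> Hom C Z Z" "Zer C Z Z \<in> Hom C Z Z" by (auto simp: Hom_iff)
  ultimately show "Ident C Z = Zer C Z Z" by blast
next
  assume *: "Ident C Z = Zer C Z Z"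
  have "f = Zer C X Z" if "f \<in> Hom C X Z" for f X
  proof -
    have f: "f \<in> Arr C" "Dom C f = X" "Cod C f = Z" using that by (auto simp: Hom_iff)
    have "f = Ident C Z \<cdot> f" using f by simp
    also have "\<dots> = Zer C X Z" unfolding * using f by simp
    finally show ?thesis .
  qed
  moreover have "f = Zer C Z X" if "f \<in> Hom C Z X" for f X
  proof -
    have f: "f \<in> Arr C" "Dom C f = Z" "Cod C f = X" "X \<in> Obj C" using that by (auto simp: Hom_iff)
    have "f = f \<cdot> Ident C Z" using f by simp
    also have "\<dots> = Zer C Z X" unfolding * using f by simp
    finally show ?thesis .
  qed
  moreover have "Zer C X Z \<in> Hom C X Z" "Zer C Z X \<in> Hom C Z X" if "X \<in> Obj C" for X
    using that by (auto simp: Hom_iff)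
  ultimately show "is_zero_object C Z"
    unfolding is_zero_object_def by (auto intro!: ex1I)
qed

lemma is_kernel_comp_iso:
  assumes "is_iso C \<sigma>" "is_kernel C k f" "Cod C \<sigma> = Dom C k"
  shows "is_kernel C (k \<cdot> \<sigma>) f"
proof -
  obtain \<tau> where t: "\<sigma> \<in> Arr C" "\<tau> \<in> Arr C" "Dom C \<tau> = Cod C \<sigma>" "Cod C \<tau> = Dom C \<sigma>"
    "\<tau> \<cdot> \<sigma> = Ident C (Dom C \<sigma>)" "\<sigma> \<cdot> \<tau> = Ident C (Cod C \<sigma>)" using assms(1) by (rule is_isoE)
  note K = is_kernelE[OF assms(2)]
  show ?thesis
  proof (rule is_kernelI)
    show "is_mono C (k \<cdot> \<sigma>)"
      by (rule is_mono_comp[OF is_iso_mono[OF assms(1)] is_kernel_mono[OF assms(2)] assms(3)])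
    show "f \<cdot> (k \<cdot> \<sigma>) = Zer C (Dom C (k \<cdot> \<sigma>)) (Cod C f)"
      using Comp_eqD[OF K(4), of \<sigma>] K t assms by simp
    fix h assume h: "h \<in> Arr C" "Cod C h = Dom C f" "f \<cdot> h = Zer C (Dom C h) (Cod C f)"
    then obtain u where u: "u \<in> Arr C" "Dom C u = Dom C h" "Cod C u = Dom C k" "k \<cdot> u = h"
      using is_kernel_lift[OF assms(2)] by blast
    have "k \<cdot> \<sigma> \<cdot> (\<tau> \<cdot> u) = h"
      using Comp_eqD[OF t(6), of u] u t K assms by simp
    then show "\<exists>u\<in>Arr C. Dom C u = Dom C h \<and> Cod C u = Dom C (k \<cdot> \<sigma>) \<and> k \<cdot> \<sigma> \<cdot> u = h"
      using u t K assms by (intro bexI[of _ "\<tau> \<cdot> u"]) auto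
  qed (use K t assms in auto)
qed

text \<open>Serves to find kernels in the quotient: an arrow there becomes some \<open>q f\<close>
  only after composition with an isomorphism \<open>q s\<close>, and kernels of \<open>q f\<close>
  are known.\<close>

lemma is_kernel_iso_precomp:
  assumes "is_iso C \<sigma>" "f \<in> Arr C" "Cod C \<sigma> = Dom C f" "is_kernel C k (f \<cdot> \<sigma>)"
  shows "is_kernel C (\<sigma> \<cdot> k) f"
proof -
  obtain \<tau> where t: "\<sigma> \<in> Arr C" "\<tau> \<in> Arr C" "Dom C \<tau> = Cod C \<sigma>" "Cod C \<tau> = Dom C \<sigma>"
    "\<tau> \<cdot> \<sigma> = Ident C (Dom C \<sigma>)" "\<sigma> \<cdot> \<tau> = Ident C (Cod C \<sigma>)" using assms(1) by (rule is_isoE)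
  note K = is_kernelE[OF assms(4)]
  have Ck: "Cod C k = Dom C \<sigma>" using K t assms by simp
  show ?thesis
  proof (rule is_kernelI)
    show "is_mono C (\<sigma> \<cdot> k)"
      by (rule is_mono_comp[OF is_kernel_mono[OF assms(4)] is_iso_mono[OF assms(1)] Ck])
    show "f \<cdot> (\<sigma> \<cdot> k) = Zer C (Dom C (\<sigma> \<cdot> k)) (Cod C f)"
      using K t Ck assms by simp
    fix h assume h: "h \<in> Arr C" "Cod C h = Dom C f" "f \<cdot> h = Zer C (Dom C h) (Cod C f)"
    have e: "\<sigma> \<cdot> (\<tau> \<cdot> h) = h" using Comp_eqD[OF t(6), of h] h t assms by simp
    then have "f \<cdot> \<sigma> \<cdot> (\<tau> \<cdot> h) = Zer C (Dom C (\<tau> \<cdot> h)) (Cod C (f \<cdot> \<sigma>))"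
      using h t assms by simp
    then obtain u where u: "u \<in> Arr C" "Dom C u = Dom C h" "Cod C u = Dom C k" "k \<cdot> u = \<tau> \<cdot> h"
      using is_kernel_lift[OF assms(4), of "\<tau> \<cdot> h"] h t assms by auto
    then show "\<exists>u\<in>Arr C. Dom C u = Dom C h \<and> Cod C u = Dom C (\<sigma> \<cdot> k) \<and> \<sigma> \<cdot> k \<cdot> u = h"
      using e t K Ck by (intro bexI[of _ u]) auto
  qed (use K t Ck assms in auto)
qed

text \<open>The last four equations restate the four preceding ones with one more factor on the
  right, because composites are kept bracketed to the right.\<close>

lemma biproduct_simps:
  assumes "is_biproduct C X Y P i1 i2 p1 p2"
  shows "i1 \<in> Arr C" "Dom C i1 = X" "Cod C i1 = P" "i2 \<in> Arr C" "Dom C i2 = Y" "Cod C i2 = P"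
    "p1 \<in> Arr C" "Dom C p1 = P" "Cod C p1 = X" "p2 \<in> Arr C" "Dom C p2 = P" "Cod C p2 = Y"
    "X \<in> Obj C" "Y \<in> Obj C" "P \<in> Obj C"
    "p1 \<cdot> i1 = Ident C X" "p2 \<cdot> i2 = Ident C Y" "p1 \<cdot> i2 = Zer C Y X" "p2 \<cdot> i1 = Zer C X Y"
    "\<And>x. x \<in> Arr C \<Longrightarrow> Cod C x = X \<Longrightarrow> p1 \<cdot> (i1 \<cdot> x) = x"
    "\<And>x. x \<in> Arr C \<Longrightarrow> Cod C x = Y \<Longrightarrow> p2 \<cdot> (i2 \<cdot> x) = x"
    "\<And>x. x \<in> Arr C \<Longrightarrow> Cod C x = Y \<Longrightarrow> p1 \<cdot> (i2 \<cdot> x) = Zer C (Dom C x) X"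
    "\<And>x. x \<in> Arr C \<Longrightarrow> Cod C x = X \<Longrightarrow> p2 \<cdot> (i1 \<cdot> x) = Zer C (Dom C x) Y"
proof -
  show t: "i1 \<in> Arr C" "Dom C i1 = X" "Cod C i1 = P" "i2 \<in> Arr C" "Dom C i2 = Y" "Cod C i2 = P"
    "p1 \<in> Arr C" "Dom C p1 = P" "Cod C p1 = X" "p2 \<in> Arr C" "Dom C p2 = P" "Cod C p2 = Y"
    "X \<in> Obj C" "Y \<in> Obj C" "P \<in> Obj C"
    "p1 \<cdot> i1 = Ident C X" "p2 \<cdot> i2 = Ident C Y" "p1 \<cdot> i2 = Zer C Y X" "p2 \<cdot> i1 = Zer C X Y"
    using assms by (auto simp: is_biproduct_def Hom_iff)
  fix x assume x: "x \<in> Arr C"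
  { assume c: "Cod C x = X"
    show "p1 \<cdot> (i1 \<cdot> x) = x" "p2 \<cdot> (i1 \<cdot> x) = Zer C (Dom C x) Y"
      using t x c Comp_eqD[OF t(16), of x] Comp_eqD[OF t(19), of x] by simp_all }
  { assume c: "Cod C x = Y"
    show "p2 \<cdot> (i2 \<cdot> x) = x" "p1 \<cdot> (i2 \<cdot> x) = Zer C (Dom C x) X"
      using t x c Comp_eqD[OF t(17), of x] Comp_eqD[OF t(18), of x] by simp_all }
qed

lemma biproduct_sum:
  assumes "is_biproduct C X Y P i1 i2 p1 p2" "x \<in> Arr C" "Cod C x = P"
  shows "Add C (i1 \<cdot> (p1 \<cdot> x)) (i2 \<cdot> (p2 \<cdot> x)) = x"
proof -
  note b = biproduct_simps[OF assms(1)]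
  have "Add C (i1 \<cdot> p1) (i2 \<cdot> p2) \<cdot> x = x"
    using assms by (simp add: is_biproduct_def)
  then show ?thesis using b assms by simp
qed

lemma biproduct_eqI:
  assumes "is_biproduct C X Y P i1 i2 p1 p2" "x \<in> Arr C" "Cod C x = P" "y \<in> Arr C" "Cod C y = P"
    "p1 \<cdot> x = p1 \<cdot> y" "p2 \<cdot> x = p2 \<cdot> y"
  shows "x = y"
  using biproduct_sum[OF assms(1-3)] biproduct_sum[OF assms(1,4,5)] assms(6,7) by metis

lemma biproduct_commute:
  assumes "is_biproduct C X Y P i1 i2 p1 p2"
  shows "is_biproduct C Y X P i2 i1 p2 p1"
proof -
  note b = biproduct_simps[OF assms]
  have "Add C (i2 \<cdot> p2) (i1 \<cdot> p1) = Add C (i1 \<cdot> p1) (i2 \<cdot> p2)"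
    by (rule Add_commute) (use b in auto)
  then show ?thesis using assms unfolding is_biproduct_def by auto
qed

lemma biproduct_kernel:
  assumes "is_biproduct C X Y P i1 i2 p1 p2"
  shows "is_kernel C i1 p2"
proof (rule is_kernelI)
  note b = biproduct_simps[OF assms]
  show "is_mono C i1"
    by (rule is_mono_factor[of p1]) (use b is_iso_mono is_isoI[of "Ident C X" "Ident C X"] in auto)
  fix h assume h: "h \<in> Arr C" "Cod C h = Dom C p2" "p2 \<cdot> h = Zer C (Dom C h) (Cod C p2)"
  have "i1 \<cdot> (p1 \<cdot> h) = h"
    by (rule biproduct_eqI[OF assms]) (use h b in auto)
  then show "\<exists>u\<in>Arr C. Dom C u = Dom C h \<and> Cod C u = Dom C i1 \<and> i1 \<cdot> u = h"
    using h b by (intro bexI[of _ "p1 \<cdot> h"]) auto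
qed (use biproduct_simps[OF assms] in auto)

lemmas op_preadditive = preadditive_category_dual
lemmas op_category = preadditive_category.axioms(1)[OF preadditive_category_dual]

lemmas is_epi_cancel = category.is_mono_cancel[OF op_category, unfolded unfold_dual]
lemmas is_epi_comp = category.is_mono_comp[OF op_category, unfolded unfold_dual]
lemmas is_epi_factor = category.is_mono_factor[OF op_category, unfolded unfold_dual]
lemmas is_epiI = preadditive_category.is_monoI[OF op_preadditive, unfolded unfold_dual]
lemmas is_epi_Zer = preadditive_category.is_mono_Zer[OF op_preadditive, unfolded unfold_dual]
lemmas is_cokernelE = preadditive_category.is_kernelE[OF op_preadditive, unfolded unfold_dual]
lemmas is_cokernel_lift = preadditive_category.is_kernel_lift[OF op_preadditive, unfolded unfold_dual]
lemmas is_cokernel_epi = preadditive_category.is_kernel_mono[OF op_preadditive, unfolded unfold_dual]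
lemmas is_cokernel_comp_epi =
  preadditive_category.is_kernel_comp_mono[OF op_preadditive, unfolded unfold_dual]
lemmas is_iso_epi = preadditive_category.is_iso_mono[OF op_preadditive, unfolded unfold_dual]
lemmas is_cokernel_epi_zero =
  preadditive_category.is_kernel_mono_zero[OF op_preadditive, unfolded unfold_dual]

lemma biproduct_short_exact:
  assumes "is_biproduct C X Y P i1 i2 p1 p2"
  shows "short_exact C i1 p2"
  using biproduct_kernel[OF assms] biproduct_commute[OF assms]
    preadditive_category.biproduct_kernel[OF op_preadditive, unfolded unfold_dual]
  unfolding short_exact_def by blast

lemma short_exactE:
  assumes "short_exact C k p"
  shows "k \<in> Arr C" "p \<in> Arr C" "Cod C k = Dom C p" "p \<cdot> k = Zer C (Dom C k) (Cod C p)"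
    "is_mono C k" "is_epi C p" "is_kernel C k p" "is_cokernel C p k"
  using assms is_kernelE[of k p] is_kernel_mono[of k p] is_cokernel_epi[of p k]
  unfolding short_exact_def by auto

text \<open>The arrow \<open>1 - \<sigma> p\<close> is killed by \<open>p\<close>, hence equals
  \<open>k r\<close>. Composing with \<open>k\<close> gives \<open>k r k = k\<close>, and
  \<open>k\<close> is mono.\<close>

lemma short_exact_retraction:
  assumes "short_exact C k p" "\<sigma> \<in> Arr C" "Dom C \<sigma> = Cod C p" "Cod C \<sigma> = Dom C p"
    "p \<cdot> \<sigma> = Ident C (Cod C p)"
  obtains r where "r \<in> Arr C" "Dom C r = Dom C p" "Cod C r = Dom C k" "r \<cdot> k = Ident C (Dom C k)"
proof -
  note e = short_exactE[OF assms(1)]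
  let ?d = "Add C (Ident C (Dom C p)) (Neg C (\<sigma> \<cdot> p))"
  have "p \<cdot> ?d = Zer C (Dom C p) (Cod C p)"
    using e assms Comp_eqD[OF assms(5), of p] by simp
  then obtain r where r: "r \<in> Arr C" "Dom C r = Dom C p" "Cod C r = Dom C k" "k \<cdot> r = ?d"
    using is_kernel_lift[OF e(7), of ?d] e assms by auto
  have n: "Neg C (Zer C (Dom C k) (Dom C p)) = Zer C (Dom C k) (Dom C p)"
    using e by (intro Neg_unique[symmetric]) (simp_all flip: e(3))
  have "k \<cdot> (r \<cdot> k) = k \<cdot> Ident C (Dom C k)"
    using Comp_eqD[OF r(4), of k] r e assms n by simp
  then have "r \<cdot> k = Ident C (Dom C k)"
    by (rule is_mono_cancel[OF e(5), rotated -1]) (use r e in auto)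
  then show ?thesis using r that by blast
qed

end

section \<open>Abelian categories\<close>

context abelian_category
begin

text \<open>\<open>f\<close> is the kernel of some \<open>g\<close>; being epi, it forces
  \<open>g = 0\<close>, so the identity of the target lifts through \<open>f\<close>.\<close>

lemma mono_epi_is_iso:
  assumes "is_mono C f" "is_epi C f"
  shows "is_iso C f"
proof -
  obtain g where g: "is_kernel C f g" using monos_normal assms by blast
  note k = is_kernelE[OF g]
  have "g = Zer C (Cod C f) (Cod C g)"
    using is_epi_Zer[OF assms(2), of g] k by simp
  then have "g \<cdot> Ident C (Cod C f) = Zer C (Cod C f) (Cod C g)" using k by simp
  then obtain u where u: "u \<in> Arr C" "Dom C u = Cod C f" "Cod C u = Dom C f"
    "f \<cdot> u = Ident C (Cod C f)"
    using is_kernel_lift[OF g, of "Ident C (Cod C f)"] k by auto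
  have "u \<cdot> f = Ident C (Dom C f)"
    by (rule is_mono_cancel[OF assms(1)]) (use u k Comp_eqD[OF u(4), of f] in auto)
  then show ?thesis using u k by (intro is_isoI[of f u]) auto
qed

text \<open>Any \<open>g\<close> that has \<open>f\<close> as a kernel factors through the cokernel
  \<open>c\<close>. Whatever \<open>c\<close> kills is therefore killed by \<open>g\<close> and
  lifts through \<open>f\<close>.\<close>

lemma mono_is_kernel_cokernel:
  assumes "is_mono C f" "is_cokernel C c f"
  shows "is_kernel C f c"
proof (rule is_kernelI[OF assms(1)])
  note c = is_cokernelE[OF assms(2)]
  show "c \<in> Arr C" "Cod C f = Dom C c" "c \<cdot> f = Zer C (Dom C f) (Cod C c)" using c by auto
  obtain g where g: "is_kernel C f g" using monos_normal assms by blast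
  note k = is_kernelE[OF g]
  obtain g' where g': "g' \<in> Arr C" "Dom C g' = Cod C c" "Cod C g' = Cod C g" "g' \<cdot> c = g"
    using is_cokernel_lift[OF assms(2), of g] k by auto
  fix h assume h: "h \<in> Arr C" "Cod C h = Dom C c" "c \<cdot> h = Zer C (Dom C h) (Cod C c)"
  have "g \<cdot> h = Zer C (Dom C h) (Cod C g)"
    using Comp_eqD[OF g'(4), of h] g' c h by simp
  then show "\<exists>u\<in>Arr C. Dom C u = Dom C h \<and> Cod C u = Dom C f \<and> f \<cdot> u = h"
    using is_kernel_lift[OF g, of h] h k c by metis
qed

text \<open>\<open>m\<close> is the kernel of the cokernel of \<open>f\<close>. If
  \<open>g e = 0\<close>, then \<open>f\<close> factors through \<open>m n\<close> with
  \<open>n\<close> the kernel of \<open>g\<close>. The mono \<open>m n\<close> is a kernel of some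
  \<open>h\<close>; as \<open>h\<close> kills \<open>f\<close>, it factors through the cokernel of
  \<open>f\<close> and kills \<open>m\<close>. So \<open>m\<close> factors through
  \<open>m n\<close>, which gives \<open>n\<close> a right inverse, and
  \<open>g = 0\<close>.\<close>

lemma image_factorization:
  assumes f: "f \<in> Arr C"
  obtains m e where "is_mono C m" "is_epi C e" "m \<in> Arr C" "e \<in> Arr C" "Cod C e = Dom C m"
    "Dom C e = Dom C f" "Cod C m = Cod C f" "m \<cdot> e = f"
proof -
  obtain c where c: "is_cokernel C c f" using cokernels f by blast
  note cE = is_cokernelE[OF c]
  obtain m where m: "is_kernel C m c" using kernels cE by blast
  note mE = is_kernelE[OF m]
  obtain e where e: "e \<in> Arr C" "Dom C e = Dom C f" "Cod C e = Dom C m" "m \<cdot> e = f"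
    using is_kernel_lift[OF m, of f] cE by auto
  have "is_epi C e"
  proof (rule is_epiI[OF e(1)])
    fix g assume g: "g \<in> Arr C" "Dom C g = Cod C e" "g \<cdot> e = Zer C (Dom C e) (Cod C g)"
    obtain n where n: "is_kernel C n g" using kernels g by blast
    note nE = is_kernelE[OF n]
    obtain e' where e': "e' \<in> Arr C" "Dom C e' = Dom C e" "Cod C e' = Dom C n" "n \<cdot> e' = e"
      using is_kernel_lift[OF n, of e] e g by auto
    have "is_mono C (m \<cdot> n)"
      by (rule is_mono_comp) (use is_kernel_mono m n e g nE in auto)
    then obtain h where h: "is_kernel C (m \<cdot> n) h" using monos_normal by blast
    note hE = is_kernelE[OF h]
    have h': "Dom C h = Cod C m" using hE mE nE e g by simp
    have "h \<cdot> (m \<cdot> n \<cdot> e') = Zer C (Dom C f) (Cod C h)"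
      using Comp_eqD[OF hE(4), of e'] hE mE nE e e' g h' by simp
    moreover have "m \<cdot> n \<cdot> e' = f" using e e' mE nE g by simp
    ultimately have "h \<cdot> f = Zer C (Dom C f) (Cod C h)" by simp
    then obtain h1 where h1: "h1 \<in> Arr C" "Dom C h1 = Cod C c" "Cod C h1 = Cod C h" "h1 \<cdot> c = h"
      using is_cokernel_lift[OF c, of h] hE h' mE cE by auto
    have "h \<cdot> m = Zer C (Dom C m) (Cod C h)"
      using Comp_eqD[OF h1(4), of m] h1 cE mE by simp
    then obtain u where u: "u \<in> Arr C" "Dom C u = Dom C m" "Cod C u = Dom C n" "(m \<cdot> n) \<cdot> u = m"
      using is_kernel_lift[OF h, of m] mE h' nE e g by auto
    have "n \<cdot> u = Ident C (Dom C m)"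
      by (rule is_mono_cancel[OF is_kernel_mono[OF m]]) (use u mE nE e g in auto)
    then have "g = g \<cdot> (n \<cdot> u)" using g e by simp
    then show "g = Zer C (Cod C e) (Cod C g)"
      using Comp_eqD[OF nE(4), of u] g e nE u by simp
  qed
  then show ?thesis
    using that[of m e] is_kernel_mono[OF m] e mE cE by auto
qed

text \<open>\<open>q\<close> is the base change of \<open>p\<close> along \<phi>, and \<beta> is the
  projection to the source of \<open>p\<close>. Uniqueness is a clause of its own, joint
  cancellation of \<beta> and \<open>q\<close>, so that it applies to arrows that did not arise by
  lifting.\<close>

definition pullback :: "'m \<Rightarrow> 'm \<Rightarrow> 'm \<Rightarrow> 'm \<Rightarrow> bool" where
  "pullback p \<phi> \<beta> q \<longleftrightarrow> p \<in> Arr C \<and> \<phi> \<in> Arr C \<and> \<beta> \<in> Arr C \<and> q \<in> Arr C \<and>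
     Cod C p = Cod C \<phi> \<and> Dom C \<beta> = Dom C q \<and> Cod C \<beta> = Dom C p \<and> Cod C q = Dom C \<phi> \<and>
     p \<cdot> \<beta> = \<phi> \<cdot> q \<and>
     (\<forall>a\<in>Arr C. \<forall>b\<in>Arr C. Dom C a = Dom C b \<and> Cod C a = Dom C p \<and> Cod C b = Dom C \<phi> \<and>
        p \<cdot> a = \<phi> \<cdot> b \<longrightarrow>
        (\<exists>u\<in>Arr C. Dom C u = Dom C b \<and> Cod C u = Dom C q \<and> \<beta> \<cdot> u = a \<and> q \<cdot> u = b)) \<and>
     (\<forall>u\<in>Arr C. \<forall>v\<in>Arr C. Cod C u = Dom C q \<and> Cod C v = Dom C q \<and>
        \<beta> \<cdot> u = \<beta> \<cdot> v \<and> q \<cdot> u = q \<cdot> v \<longrightarrow> u = v)"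

lemma pullbackE:
  assumes "pullback p \<phi> \<beta> q"
  shows "p \<in> Arr C" "\<phi> \<in> Arr C" "\<beta> \<in> Arr C" "q \<in> Arr C" "Cod C p = Cod C \<phi>" "Dom C \<beta> = Dom C q"
    "Cod C \<beta> = Dom C p" "Cod C q = Dom C \<phi>" "p \<cdot> \<beta> = \<phi> \<cdot> q"
  using assms by (auto simp: pullback_def)

lemma pullback_lift:
  assumes "pullback p \<phi> \<beta> q" "a \<in> Arr C" "b \<in> Arr C" "Dom C a = Dom C b"
    "Cod C a = Dom C p" "Cod C b = Dom C \<phi>" "p \<cdot> a = \<phi> \<cdot> b"
  obtains u where "u \<in> Arr C" "Dom C u = Dom C b" "Cod C u = Dom C q" "\<beta> \<cdot> u = a" "q \<cdot> u = b"
  using assms unfolding pullback_def by blast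

lemma pullback_eqI:
  assumes "pullback p \<phi> \<beta> q" "u \<in> Arr C" "v \<in> Arr C" "Cod C u = Dom C q" "Cod C v = Dom C q"
     "\<beta> \<cdot> u = \<beta> \<cdot> v" "q \<cdot> u = q \<cdot> v"
   shows "u = v"
  using assms unfolding pullback_def by blast

text \<open>The pull-back is the kernel of the difference \<open>p p1 - \<phi> p2\<close> on the
  biproduct.\<close>

lemma pullback_exists:
  assumes [simp]: "p \<in> Arr C" "\<phi> \<in> Arr C" and cod: "Cod C p = Cod C \<phi>"
  obtains \<beta> q where "pullback p \<phi> \<beta> q" "is_epi C p \<Longrightarrow> is_epi C q"
proof -
  obtain P i1 i2 p1 p2 where P: "is_biproduct C (Dom C p) (Dom C \<phi>) P i1 i2 p1 p2"
    using biproducts[of "Dom C p" "Dom C \<phi>"] by auto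
  note [simp] = biproduct_simps[OF P] cod
  let ?d = "Add C (p \<cdot> p1) (Neg C (\<phi> \<cdot> p2))"
  obtain j where j: "is_kernel C j ?d" using kernels[of ?d] by auto
  have [simp]: "j \<in> Arr C" "Cod C j = P" using is_kernelE[OF j] by auto
  have n0: "Neg C (Zer C X (Cod C \<phi>)) = Zer C X (Cod C \<phi>)" if "X \<in> Obj C" for X
    using that by (intro Neg_unique[symmetric]) simp_all
  have dj: "Add C (p \<cdot> (p1 \<cdot> j)) (Neg C (\<phi> \<cdot> (p2 \<cdot> j))) = Zer C (Dom C j) (Cod C \<phi>)"
    using is_kernelE(4)[OF j] by simp
  have "p \<cdot> (p1 \<cdot> j) = \<phi> \<cdot> (p2 \<cdot> j)"
    by (rule Add_eq_Zer) (use dj in simp_all)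
  moreover have "\<exists>u\<in>Arr C. Dom C u = Dom C b \<and> Cod C u = Dom C j \<and> p1 \<cdot> j \<cdot> u = a \<and> p2 \<cdot> j \<cdot> u = b"
    if [simp]: "a \<in> Arr C" "b \<in> Arr C" "Dom C a = Dom C b" "Cod C a = Dom C p" "Cod C b = Dom C \<phi>"
      and eq: "p \<cdot> a = \<phi> \<cdot> b" for a b
  proof -
    let ?h = "Add C (i1 \<cdot> a) (i2 \<cdot> b)"
    have "?d \<cdot> ?h = Zer C (Dom C b) (Cod C \<phi>)" using eq n0 by simp
    then obtain u where u: "u \<in> Arr C" "Dom C u = Dom C b" "Cod C u = Dom C j" "j \<cdot> u = ?h"
      using is_kernel_lift[OF j, of ?h] by auto
    then show ?thesis by (intro bexI[of _ u]) auto
  qed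
  moreover have "u = v" if uv: "u \<in> Arr C" "v \<in> Arr C" "Cod C u = Dom C j" "Cod C v = Dom C j"
    "p1 \<cdot> j \<cdot> u = p1 \<cdot> j \<cdot> v" "p2 \<cdot> j \<cdot> u = p2 \<cdot> j \<cdot> v" for u v
  proof -
    have "j \<cdot> u = j \<cdot> v" by (rule biproduct_eqI[OF P]) (use uv in auto)
    then show ?thesis using is_mono_cancel[OF is_kernel_mono[OF j]] uv by auto
  qed
  ultimately have "pullback p \<phi> (p1 \<cdot> j) (p2 \<cdot> j)"
    unfolding pullback_def by auto
  \<comment> \<open>If \<open>p\<close> is epi, so is \<open>?d\<close>, which is therefore the
    cokernel of \<open>j\<close>. From \<open>g p2 j = 0\<close> follows \<open>g p2 = h ?d\<close>;
    on the first summand this reads \<open>h p = 0\<close>, so \<open>h = 0\<close> and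
    \<open>g p2 = 0\<close>, and composing with \<open>i2\<close> gives
    \<open>g = 0\<close>.\<close>
  moreover have "is_epi C (p2 \<cdot> j)" if p: "is_epi C p"
  proof (rule is_epiI)
    fix g assume g: "g \<in> Arr C" "Dom C g = Cod C (p2 \<cdot> j)"
      "g \<cdot> (p2 \<cdot> j) = Zer C (Dom C (p2 \<cdot> j)) (Cod C g)"
    have di: "?d \<cdot> i1 = p" using n0 by simp
    have "is_epi C ?d" by (rule is_epi_factor[of _ i1]) (use p di in simp_all)
    then have d: "is_cokernel C ?d j"
      using j abelian_category.mono_is_kernel_cokernel[OF abelian_category_dual, unfolded unfold_dual]
      by blast
    obtain h where h: "h \<in> Arr C" "Dom C h = Cod C \<phi>" "Cod C h = Cod C g" "h \<cdot> ?d = g \<cdot> p2"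
      using is_cokernel_lift[OF d, of "g \<cdot> p2"] g by auto
    have "h \<cdot> p = (h \<cdot> ?d) \<cdot> i1" using h di by (subst assoc) auto
    also have "\<dots> = Zer C (Dom C p) (Cod C h)" using h g by simp
    finally have hz: "h = Zer C (Cod C \<phi>) (Cod C g)" using is_epi_Zer[OF p, of h] h by simp
    have "g \<cdot> p2 = Zer C (Cod C \<phi>) (Cod C g) \<cdot> ?d" by (simp only: h(4)[symmetric] hz[symmetric])
    also have "\<dots> = Zer C P (Cod C g)" using g by simp
    finally have "g \<cdot> p2 = Zer C P (Cod C g)" .
    then have "g \<cdot> p2 \<cdot> i2 = Zer C (Dom C \<phi>) (Cod C g)" using g(1) by (simp del: assoc)
    then show "g = Zer C (Cod C (p2 \<cdot> j)) (Cod C g)" using g by simp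
  qed simp_all
  ultimately show ?thesis using that by blast
qed

text \<open>Composing with epimorphisms replaces the elements of a diagram chase.\<close>

lemma cokernel_zero_lift:
  assumes "is_cokernel C c s" "g \<in> Arr C" "Cod C g = Cod C s" "c \<cdot> g = Zer C (Dom C g) (Cod C c)"
  obtains \<epsilon> x where "is_epi C \<epsilon>" "\<epsilon> \<in> Arr C" "x \<in> Arr C" "Cod C \<epsilon> = Dom C g" "Dom C x = Dom C \<epsilon>"
    "Cod C x = Dom C s" "g \<cdot> \<epsilon> = s \<cdot> x"
proof -
  note c = is_cokernelE[OF assms(1)]
  obtain m e where me: "is_mono C m" "is_epi C e" "m \<in> Arr C" "e \<in> Arr C" "Cod C e = Dom C m"
    "Dom C e = Dom C s" "Cod C m = Cod C s" "m \<cdot> e = s"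
    by (rule image_factorization[OF c(2)])
  have "is_cokernel C c m"
    using is_cokernel_comp_epi[of e m c] assms(1) me by simp
  then have "is_kernel C m c" using me mono_is_kernel_cokernel by blast
  then obtain y where y: "y \<in> Arr C" "Dom C y = Dom C g" "Cod C y = Dom C m" "m \<cdot> y = g"
    using is_kernel_lift[of m c g] assms c by auto
  obtain x \<epsilon> where pb: "pullback e y x \<epsilon>" "is_epi C \<epsilon>"
    using pullback_exists[of e y] me y by auto
  note pb' = pullbackE[OF pb(1)]
  have "g \<cdot> \<epsilon> = m \<cdot> (y \<cdot> \<epsilon>)" using Comp_eqD[OF y(4), of \<epsilon>] y pb' me by simp
  also have "\<dots> = m \<cdot> (e \<cdot> x)" using pb' by simp
  also have "\<dots> = s \<cdot> x" using Comp_eqD[OF me(8), of x] me pb' by simp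
  finally show ?thesis using that[of \<epsilon> x] pb pb' y me by simp
qed

end

section \<open>Morphisms of extensions\<close>

text \<open>With the middle arrow hidden and \<open>1\<close> standing for identities,
  \<open>ext_arrow C \<alpha> 1 d e\<close> reads: \<open>e\<close> is the push-out
  \<open>\<alpha> d\<close>; \<open>ext_arrow C 1 \<phi> e' e\<close> reads: \<open>e'\<close> is
  the pull-back \<open>e \<phi>\<close>; and \<open>ext_arrow C 1 1 e e'\<close> is equivalence of
  extensions.\<close>

definition ext_arrow ::
  "('o, 'm, 'x) preadd_cat_scheme \<Rightarrow> 'm \<Rightarrow> 'm \<Rightarrow> 'm \<times> 'm \<Rightarrow> 'm \<times> 'm \<Rightarrow> bool" where
  "ext_arrow C \<alpha> \<gamma> e e' \<longleftrightarrow> (\<exists>\<beta>. ext_mor C \<alpha> \<beta> \<gamma> e e')"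

lemma extensions_dual [simp]: "prod.swap e \<in> extensions (dual C) X Z \<longleftrightarrow> e \<in> extensions C Z X"
  by (auto simp: extensions_def prod.swap_def split: prod.splits)

lemma (in preadditive_category) extensionsE:
  assumes "e \<in> extensions C Z X"
  shows "fst e \<in> Arr C" "snd e \<in> Arr C" "Cod C (fst e) = Dom C (snd e)" "Dom C (fst e) = X"
    "Cod C (snd e) = Z" "X \<in> Obj C" "Z \<in> Obj C" "snd e \<cdot> fst e = Zer C X Z"
    "is_mono C (fst e)" "is_epi C (snd e)"
    "is_kernel C (fst e) (snd e)" "is_cokernel C (snd e) (fst e)"
proof -
  have *: "short_exact C (fst e) (snd e)" "Dom C (fst e) = X" "Cod C (snd e) = Z"
    using assms by (auto simp: extensions_def)
  then show "fst e \<in> Arr C" "snd e \<in> Arr C" "Cod C (fst e) = Dom C (snd e)" "Dom C (fst e) = X"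
    "Cod C (snd e) = Z" "X \<in> Obj C" "Z \<in> Obj C" "snd e \<cdot> fst e = Zer C X Z"
    "is_mono C (fst e)" "is_epi C (snd e)"
    "is_kernel C (fst e) (snd e)" "is_cokernel C (snd e) (fst e)"
    using short_exactE[OF *(1)] by auto
qed

lemma (in preadditive_category) ext_mor_dual:
  assumes "e \<in> extensions C Z X" "e' \<in> extensions C Z' X'"
  shows "ext_mor (dual C) \<gamma> \<beta> \<alpha> (prod.swap e') (prod.swap e) = ext_mor C \<alpha> \<beta> \<gamma> e e'"
  using extensionsE[OF assms(1)] extensionsE[OF assms(2)] by (auto simp: ext_mor_def)

lemma (in preadditive_category) ext_arrow_dual:
  assumes "e \<in> extensions C Z X" "e' \<in> extensions C Z' X'"
  shows "ext_arrow (dual C) \<gamma> \<alpha> (prod.swap e') (prod.swap e) = ext_arrow C \<alpha> \<gamma> e e'"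
  using ext_mor_dual[OF assms] by (simp add: ext_arrow_def)

context preadditive_category
begin

lemma ext_arrowI:
  assumes "e \<in> extensions C Z X" "e' \<in> extensions C Z' X'"
    "\<alpha> \<in> Arr C" "Dom C \<alpha> = X" "Cod C \<alpha> = X'" "\<gamma> \<in> Arr C" "Dom C \<gamma> = Z" "Cod C \<gamma> = Z'"
    "\<beta> \<in> Arr C" "Dom C \<beta> = Dom C (snd e)" "Cod C \<beta> = Dom C (snd e')"
    "\<beta> \<cdot> fst e = fst e' \<cdot> \<alpha>" "snd e' \<cdot> \<beta> = \<gamma> \<cdot> snd e"
  shows "ext_arrow C \<alpha> \<gamma> e e'"
  unfolding ext_arrow_def ext_mor_def
  using assms extensionsE[OF assms(1)] extensionsE[OF assms(2)]
  by (intro exI[of _ \<beta>]) (auto simp: Hom_iff)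

lemma ext_arrowE:
  assumes "e \<in> extensions C Z X" "e' \<in> extensions C Z' X'" "ext_arrow C \<alpha> \<gamma> e e'"
  obtains \<beta> where
    "\<alpha> \<in> Arr C" "Dom C \<alpha> = X" "Cod C \<alpha> = X'" "\<gamma> \<in> Arr C" "Dom C \<gamma> = Z" "Cod C \<gamma> = Z'"
    "\<beta> \<in> Arr C" "Dom C \<beta> = Dom C (snd e)" "Cod C \<beta> = Dom C (snd e')"
    "\<beta> \<cdot> fst e = fst e' \<cdot> \<alpha>" "snd e' \<cdot> \<beta> = \<gamma> \<cdot> snd e"
  using assms extensionsE[OF assms(1)] extensionsE[OF assms(2)]
  by (auto simp: ext_arrow_def ext_mor_def Hom_iff)

lemma ext_arrow_typing:
  assumes "e \<in> extensions C Z X" "e' \<in> extensions C Z' X'" "ext_arrow C \<alpha> \<gamma> e e'"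
  shows "\<alpha> \<in> Arr C" "Dom C \<alpha> = X" "Cod C \<alpha> = X'" "\<gamma> \<in> Arr C" "Dom C \<gamma> = Z" "Cod C \<gamma> = Z'"
  using ext_arrowE[OF assms] by metis+

lemma ext_arrow_refl:
  assumes "e \<in> extensions C Z X"
  shows "ext_arrow C (Ident C X) (Ident C Z) e e"
  by (rule ext_arrowI[OF assms assms, where \<beta> = "Ident C (Dom C (snd e))"])
    (use extensionsE[OF assms] in auto)

lemma ext_arrow_comp:
  assumes e: "e \<in> extensions C Z X" and e': "e' \<in> extensions C Z' X'"
    and e'': "e'' \<in> extensions C Z'' X''"
    and 1: "ext_arrow C \<alpha> \<gamma> e e'" and 2: "ext_arrow C \<alpha>' \<gamma>' e' e''"
  shows "ext_arrow C (\<alpha>' \<cdot> \<alpha>) (\<gamma>' \<cdot> \<gamma>) e e''"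
proof -
  note E = extensionsE[OF e] extensionsE[OF e'] extensionsE[OF e'']
  obtain \<beta> where b: "\<alpha> \<in> Arr C" "Dom C \<alpha> = X" "Cod C \<alpha> = X'" "\<gamma> \<in> Arr C" "Dom C \<gamma> = Z" "Cod C \<gamma> = Z'"
    "\<beta> \<in> Arr C" "Dom C \<beta> = Dom C (snd e)" "Cod C \<beta> = Dom C (snd e')"
    "\<beta> \<cdot> fst e = fst e' \<cdot> \<alpha>" "snd e' \<cdot> \<beta> = \<gamma> \<cdot> snd e"
    using ext_arrowE[OF e e' 1] by metis
  obtain \<beta>' where b': "\<alpha>' \<in> Arr C" "Dom C \<alpha>' = X'" "Cod C \<alpha>' = X''"
    "\<gamma>' \<in> Arr C" "Dom C \<gamma>' = Z'" "Cod C \<gamma>' = Z''"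
    "\<beta>' \<in> Arr C" "Dom C \<beta>' = Dom C (snd e')" "Cod C \<beta>' = Dom C (snd e'')"
    "\<beta>' \<cdot> fst e' = fst e'' \<cdot> \<alpha>'" "snd e'' \<cdot> \<beta>' = \<gamma>' \<cdot> snd e'"
    using ext_arrowE[OF e' e'' 2] by metis
  show ?thesis
  proof (rule ext_arrowI[OF e e'', where \<beta> = "\<beta>' \<cdot> \<beta>"])
    show "\<beta>' \<cdot> \<beta> \<cdot> fst e = fst e'' \<cdot> (\<alpha>' \<cdot> \<alpha>)"
      using b b' E Comp_eq_Comp[OF b'(10), of \<alpha>] by simp
    show "snd e'' \<cdot> (\<beta>' \<cdot> \<beta>) = \<gamma>' \<cdot> \<gamma> \<cdot> snd e"
      using b b' E Comp_eq_Comp[OF b'(11), of \<beta>] by simp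
  qed (use b b' in auto)
qed

text \<open>The mono half of the short five lemma. If \<open>\<beta> g = 0\<close>, then
  \<open>snd d\<close> kills \<open>g\<close>, so \<open>g = fst d u\<close>; now
  \<open>fst d' u = 0\<close> forces \<open>u = 0\<close>. The epi half is this lemma in the
  opposite category.\<close>

lemma ext_mor_Ident_mono:
  assumes d: "d \<in> extensions C Y W" and d': "d' \<in> extensions C Y W"
    and a: "ext_mor C (Ident C W) \<beta> (Ident C Y) d d'"
  shows "is_mono C \<beta>"
proof -
  note E = extensionsE[OF d] and E' = extensionsE[OF d']
  have b: "\<beta> \<in> Arr C" "Dom C \<beta> = Dom C (snd d)" "Cod C \<beta> = Dom C (snd d')"
    "\<beta> \<cdot> fst d = fst d'" "snd d' \<cdot> \<beta> = snd d"
    using a E E' by (auto simp: ext_mor_def Hom_def)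
  show ?thesis
  proof (rule is_monoI[OF b(1)])
    fix g assume g: "g \<in> Arr C" "Cod C g = Dom C \<beta>" "\<beta> \<cdot> g = Zer C (Dom C g) (Cod C \<beta>)"
    have "snd d \<cdot> g = Zer C (Dom C g) Y"
      using Comp_eqD[OF b(5), of g] b E E' g by simp
    then obtain u where u: "u \<in> Arr C" "Dom C u = Dom C g" "Cod C u = W" "fst d \<cdot> u = g"
      using is_kernel_lift[OF E(11), of g] g b E by auto
    have "fst d' \<cdot> u = Zer C (Dom C u) (Cod C (fst d'))"
      using Comp_eqD[OF b(4), of u] u g b E E' by simp
    then have "u = Zer C (Dom C u) W"
      using is_mono_Zer[OF E'(9), of u] u E' by simp
    then have "g = fst d \<cdot> Zer C (Dom C u) W" using u by metis
    also have "\<dots> = Zer C (Dom C u) (Dom C \<beta>)" using u E b g by simp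
    finally show "g = Zer C (Dom C g) (Dom C \<beta>)" using u by simp
  qed
qed

end

context abelian_category
begin

lemmas epi_is_cokernel_kernel =
  abelian_category.mono_is_kernel_cokernel[OF abelian_category_dual, unfolded unfold_dual]

text \<open>Packs existence of a pull-back with its universal property against arbitrary morphisms
  of extensions; \<open>ext_pull_factor\<close> transfers the latter to every pull-back.\<close>

lemma ext_pull_universal:
  assumes e: "e \<in> extensions C Z X" and \<phi>: "\<phi> \<in> Arr C" "Dom C \<phi> = Z'" "Cod C \<phi> = Z"
  shows "\<exists>e'\<in>extensions C Z' X. ext_arrow C (Ident C X) \<phi> e' e \<and>
    (\<forall>Z0 X0 e0 \<alpha> \<gamma>. e0 \<in> extensions C Z0 X0 \<and> \<gamma> \<in> Hom C Z0 Z' \<and> ext_arrow C \<alpha> (\<phi> \<cdot> \<gamma>) e0 e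
      \<longrightarrow> ext_arrow C \<alpha> \<gamma> e0 e')"
proof -
  note E = extensionsE[OF e]
  obtain \<beta> q where pb: "pullback (snd e) \<phi> \<beta> q" and epi: "is_epi C q"
    using pullback_exists[of "snd e" \<phi>] E \<phi> by metis
  note pbE = pullbackE[OF pb]
  have [simp]: "Z' \<in> Obj C" using \<phi> by auto
  obtain k where k: "k \<in> Arr C" "Dom C k = X" "Cod C k = Dom C q" "\<beta> \<cdot> k = fst e"
      "q \<cdot> k = Zer C X Z'"
    using pullback_lift[OF pb, of "fst e" "Zer C X Z'"] E \<phi> by auto
  \<comment> \<open>If \<open>q\<close> kills \<open>h\<close>, then \<open>snd e\<close> kills
    \<open>\<beta> h\<close>, which therefore lifts to \<open>X\<close>; the lift followed by
    \<open>k\<close> agrees with \<open>h\<close> under both projections.\<close>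
  have ker: "is_kernel C k q"
  proof (rule is_kernelI)
    show "is_mono C k" by (rule is_mono_factor[of \<beta>]) (use k E pbE in auto)
    fix h assume h: "h \<in> Arr C" "Cod C h = Dom C q" "q \<cdot> h = Zer C (Dom C h) (Cod C q)"
    have "snd e \<cdot> (\<beta> \<cdot> h) = Zer C (Dom C h) Z"
      using Comp_eq_Comp[OF pbE(9), of h] pbE h \<phi> E by simp
    then obtain v where v: "v \<in> Arr C" "Dom C v = Dom C h" "Cod C v = X" "fst e \<cdot> v = \<beta> \<cdot> h"
      using is_kernel_lift[OF E(11), of "\<beta> \<cdot> h"] pbE h E by auto
    have "k \<cdot> v = h"
      by (rule pullback_eqI[OF pb])
        (use v h k pbE E \<phi> Comp_eqD[OF k(4), of v] Comp_eqD[OF k(5), of v] in auto)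
    then show "\<exists>u\<in>Arr C. Dom C u = Dom C h \<and> Cod C u = Dom C k \<and> k \<cdot> u = h"
      using v k by auto
  qed (use k pbE \<phi> in auto)
  then have e': "(k, q) \<in> extensions C Z' X"
    using epi_is_cokernel_kernel[OF epi ker] k pbE \<phi> by (simp add: extensions_def short_exact_def)
  moreover have "ext_arrow C (Ident C X) \<phi> (k, q) e"
    by (rule ext_arrowI[OF e' e, where \<beta> = \<beta>]) (use \<phi> E pbE k in auto)
  moreover have "ext_arrow C \<alpha> \<gamma> e0 (k, q)"
    if e0: "e0 \<in> extensions C Z0 X0" and \<gamma>: "\<gamma> \<in> Hom C Z0 Z'"
      and a: "ext_arrow C \<alpha> (\<phi> \<cdot> \<gamma>) e0 e" for Z0 X0 e0 \<alpha> \<gamma>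
  proof -
    note E0 = extensionsE[OF e0]
    obtain \<beta>0 where b: "\<alpha> \<in> Arr C" "Dom C \<alpha> = X0" "Cod C \<alpha> = X"
      "\<beta>0 \<in> Arr C" "Dom C \<beta>0 = Dom C (snd e0)" "Cod C \<beta>0 = Dom C (snd e)"
      "\<beta>0 \<cdot> fst e0 = fst e \<cdot> \<alpha>" "snd e \<cdot> \<beta>0 = \<phi> \<cdot> \<gamma> \<cdot> snd e0"
      using ext_arrowE[OF e0 e a] by metis
    have g: "\<gamma> \<in> Arr C" "Dom C \<gamma> = Z0" "Cod C \<gamma> = Z'" using \<gamma> by (auto simp: Hom_iff)
    obtain u where u: "u \<in> Arr C" "Dom C u = Dom C (snd e0)" "Cod C u = Dom C q"
      "\<beta> \<cdot> u = \<beta>0" "q \<cdot> u = \<gamma> \<cdot> snd e0"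
      using pullback_lift[OF pb, of \<beta>0 "\<gamma> \<cdot> snd e0"] b g \<phi> E0 by auto
    have "u \<cdot> fst e0 = k \<cdot> \<alpha>"
      by (rule pullback_eqI[OF pb])
        (use b u g E0 k pbE \<phi> Comp_eqD[OF k(4), of \<alpha>] Comp_eqD[OF k(5), of \<alpha>]
          Comp_eqD[OF u(4), of "fst e0"] Comp_eqD[OF u(5), of "fst e0"] in auto)
    then show ?thesis
      by (intro ext_arrowI[OF e0 e', where \<beta> = u]) (use b u g k pbE in auto)
  qed
  ultimately show ?thesis by blast
qed

lemma ext_mor_Ident_iso:
  assumes e: "e \<in> extensions C Z X" and e': "e' \<in> extensions C Z X"
    and a: "ext_mor C (Ident C X) \<beta> (Ident C Z) e e'"
  shows "is_iso C \<beta>"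
proof (rule mono_epi_is_iso)
  show "is_mono C \<beta>" using ext_mor_Ident_mono assms by blast
  have "is_mono (dual C) \<beta>"
    by (rule preadditive_category.ext_mor_Ident_mono[OF op_preadditive, of "prod.swap e'" X Z "prod.swap e"])
      (use assms ext_mor_dual[OF e e'] in auto)
  then show "is_epi C \<beta>" by simp
qed

text \<open>The short five lemma supplies the isomorphism demanded by \<open>ext_equiv\<close>, so
  equivalences can be handled as morphisms of extensions.\<close>

lemma ext_equiv_iff:
  assumes e: "e \<in> extensions C Z X" and e': "e' \<in> extensions C Z X"
  shows "(e, e') \<in> ext_equiv C Z X \<longleftrightarrow> ext_arrow C (Ident C X) (Ident C Z) e e'"
  using ext_mor_Ident_iso[OF assms] assms by (auto simp: ext_equiv_def ext_arrow_def)

lemma ext_arrow_Ident_sym: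
  assumes e: "e \<in> extensions C Z X" and e': "e' \<in> extensions C Z X"
    and a: "ext_arrow C (Ident C X) (Ident C Z) e e'"
  shows "ext_arrow C (Ident C X) (Ident C Z) e' e"
proof -
  note E = extensionsE[OF e] extensionsE[OF e']
  obtain \<beta> where b: "ext_mor C (Ident C X) \<beta> (Ident C Z) e e'"
    using a by (auto simp: ext_arrow_def)
  then have b': "\<beta> \<in> Arr C" "Dom C \<beta> = Dom C (snd e)" "Cod C \<beta> = Dom C (snd e')"
    "\<beta> \<cdot> fst e = fst e'" "snd e' \<cdot> \<beta> = snd e"
    using E by (auto simp: ext_mor_def Hom_def)
  obtain g where g: "g \<in> Arr C" "Dom C g = Cod C \<beta>" "Cod C g = Dom C \<beta>"
    "g \<cdot> \<beta> = Ident C (Dom C \<beta>)" "\<beta> \<cdot> g = Ident C (Cod C \<beta>)"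
    using ext_mor_Ident_iso[OF e e' b] by (rule is_isoE)
  show ?thesis
  proof (rule ext_arrowI[OF e' e, where \<beta> = g])
    show "g \<cdot> fst e' = fst e \<cdot> Ident C X"
      using Comp_eqD[OF g(4), of "fst e"] g b' E by simp
    show "snd e \<cdot> g = Ident C Z \<cdot> snd e'"
      using Comp_eqD[OF b'(5), of g] g b' E by simp
  qed (use g b' E in auto)
qed

lemma ext_arrow_Ident_comp:
  assumes "e \<in> extensions C Z X" "e' \<in> extensions C Z' X'" "ext_arrow C \<alpha> \<gamma> e e'"
  shows "e0 \<in> extensions C Z X \<Longrightarrow> ext_arrow C (Ident C X) (Ident C Z) e0 e \<Longrightarrow> ext_arrow C \<alpha> \<gamma> e0 e'"
    "e1 \<in> extensions C Z' X' \<Longrightarrow> ext_arrow C (Ident C X') (Ident C Z') e' e1 \<Longrightarrow> ext_arrow C \<alpha> \<gamma> e e1"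
  using ext_arrow_comp[of e0 Z X e Z X e' Z' X' "Ident C X" "Ident C Z" \<alpha> \<gamma>]
    ext_arrow_comp[of e Z X e' Z' X' e1 Z' X' \<alpha> \<gamma> "Ident C X'" "Ident C Z'"]
    assms ext_arrow_typing[OF assms] by simp_all

lemma ext_pull_exists:
  assumes e: "e \<in> extensions C Z X" and \<phi>: "\<phi> \<in> Arr C" "Dom C \<phi> = Z'" "Cod C \<phi> = Z"
  obtains e' where "e' \<in> extensions C Z' X" "ext_arrow C (Ident C X) \<phi> e' e"
  using ext_pull_universal[OF assms] by blast

text \<open>Any two pull-backs along \<phi> are equivalent: the universal property of the
  constructed one, applied to \<open>e1\<close> with the identity for \<gamma>, gives a morphism
  with identities at both ends, and such a morphism can be reversed.\<close>

lemma ext_pull_factor: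
  assumes e: "e \<in> extensions C Z X" and e1: "e1 \<in> extensions C Z' X"
    and a1: "ext_arrow C (Ident C X) \<phi> e1 e"
    and e0: "e0 \<in> extensions C Z0 X0" and a0: "ext_arrow C \<alpha> (\<phi> \<cdot> \<gamma>) e0 e"
    and \<gamma>: "\<gamma> \<in> Arr C" "Dom C \<gamma> = Z0" "Cod C \<gamma> = Z'"
  shows "ext_arrow C \<alpha> \<gamma> e0 e1"
proof -
  note t = ext_arrow_typing[OF e1 e a1]
  obtain e2 where e2: "e2 \<in> extensions C Z' X" "ext_arrow C (Ident C X) \<phi> e2 e" and
    u: "\<And>Z0 X0 e0 \<alpha> \<gamma>. e0 \<in> extensions C Z0 X0 \<and> \<gamma> \<in> Hom C Z0 Z' \<and> ext_arrow C \<alpha> (\<phi> \<cdot> \<gamma>) e0 e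
      \<Longrightarrow> ext_arrow C \<alpha> \<gamma> e0 e2"
    using ext_pull_universal[OF e t(4-6)] by blast
  have "\<gamma> \<in> Hom C Z0 Z'" using \<gamma> by (auto simp: Hom_iff)
  then have 1: "ext_arrow C \<alpha> \<gamma> e0 e2" using u e0 a0 by blast
  have "ext_arrow C (Ident C X) (Ident C Z') e1 e2"
    using u[of e1 Z' X "Ident C Z'" "Ident C X"] e1 a1 t extensionsE(7)[OF e1]
      Comp_Ident_right[of \<phi> Z' Z] by (simp add: Hom_iff)
  then have "ext_arrow C (Ident C X) (Ident C Z') e2 e1"
    using ext_arrow_Ident_sym e1 e2 by blast
  then show ?thesis using ext_arrow_Ident_comp(2)[OF e0 e2(1) 1 e1] by blast
qed

text \<open>Exchanging the two arrows of an extension gives an extension in the opposite category,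
  where push-outs become pull-backs.\<close>

lemma ext_push_exists:
  assumes e: "e \<in> extensions C Z X" and \<alpha>: "\<alpha> \<in> Arr C" "Dom C \<alpha> = X" "Cod C \<alpha> = X'"
  obtains e' where "e' \<in> extensions C Z X'" "ext_arrow C \<alpha> (Ident C Z) e e'"
proof -
  obtain d where d: "d \<in> extensions (dual C) X' Z"
    "ext_arrow (dual C) (Ident C Z) \<alpha> d (prod.swap e)"
    using abelian_category.ext_pull_exists[OF abelian_category_dual, of "prod.swap e" X Z \<alpha> X'] e \<alpha>
    by auto
  have "prod.swap d \<in> extensions C Z X'" using extensions_dual[of "prod.swap d" C X' Z] d by simp
  moreover have "ext_arrow C \<alpha> (Ident C Z) e (prod.swap d)"
    using ext_arrow_dual[OF e calculation, of "Ident C Z" \<alpha>] d by simp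
  ultimately show ?thesis using that by blast
qed

lemma ext_push_factor:
  assumes e: "e \<in> extensions C Z X" and e1: "e1 \<in> extensions C Z X'"
    and a1: "ext_arrow C \<alpha> (Ident C Z) e e1"
    and e0: "e0 \<in> extensions C Z0 X0" and a0: "ext_arrow C (\<alpha>' \<cdot> \<alpha>) \<gamma> e e0"
    and \<alpha>': "\<alpha>' \<in> Arr C" "Dom C \<alpha>' = X'" "Cod C \<alpha>' = X0"
  shows "ext_arrow C \<alpha>' \<gamma> e1 e0"
proof -
  have "ext_arrow (dual C) \<gamma> \<alpha>' (prod.swap e0) (prod.swap e1)"
    by (rule abelian_category.ext_pull_factor[OF abelian_category_dual,
          of "prod.swap e" X Z "prod.swap e1" X' \<alpha>])
      (use assms ext_arrow_dual[OF e e1] ext_arrow_dual[OF e e0] in auto)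
  then show ?thesis using ext_arrow_dual[OF e1 e0] by simp
qed

end

section \<open>Direct sums of extensions\<close>

context preadditive_category
begin

lemma biproduct_sum_kernel:
  assumes XX: "is_biproduct C X1 X2 XX i1 i2 r1 r2" and YY: "is_biproduct C Y1 Y2 YY m1 m2 n1 n2"
    and ZZ: "is_biproduct C Z1 Z2 ZZ j1 j2 t1 t2"
    and k1: "is_kernel C k1 p1" "Dom C k1 = X1" "Dom C p1 = Y1" "Cod C p1 = Z1"
    and k2: "is_kernel C k2 p2" "Dom C k2 = X2" "Dom C p2 = Y2" "Cod C p2 = Z2"
  shows "is_kernel C (Add C (m1 \<cdot> (k1 \<cdot> r1)) (m2 \<cdot> (k2 \<cdot> r2)))
    (Add C (j1 \<cdot> (p1 \<cdot> n1)) (j2 \<cdot> (p2 \<cdot> n2)))" (is "is_kernel C ?k ?p")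
proof -
  note bs = biproduct_simps[OF XX] biproduct_simps[OF YY] biproduct_simps[OF ZZ]
  note K = is_kernelE[OF k1(1)] k1(2-) is_kernelE[OF k2(1)] k2(2-)
  note z1 = Comp_eqD[OF is_kernelE(4)[OF k1(1)]]
  note z2 = Comp_eqD[OF is_kernelE(4)[OF k2(1)]]
  show ?thesis
  proof (rule is_kernelI)
    show "?p \<in> Arr C" "Cod C ?k = Dom C ?p" using bs K by simp_all
    show "?p \<cdot> ?k = Zer C (Dom C ?k) (Cod C ?p)"
      using bs K z1[of r1] z2[of r2] by simp
    show "is_mono C ?k"
    proof (rule is_monoI)
      fix g assume g: "g \<in> Arr C" "Cod C g = Dom C ?k" "?k \<cdot> g = Zer C (Dom C g) (Cod C ?k)"
      have [simp]: "Cod C g = XX" using g bs K by simp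
      have "n1 \<cdot> (?k \<cdot> g) = Zer C (Dom C g) Y1" unfolding g(3) using bs K g(1) by simp
      then have "k1 \<cdot> (r1 \<cdot> g) = Zer C (Dom C g) Y1" using bs K g(1) by simp
      then have 1: "r1 \<cdot> g = Zer C (Dom C g) X1"
        using is_mono_Zer[OF is_kernel_mono[OF k1(1)], of "r1 \<cdot> g"] bs K g(1) by simp
      have "n2 \<cdot> (?k \<cdot> g) = Zer C (Dom C g) Y2" unfolding g(3) using bs K g(1) by simp
      then have "k2 \<cdot> (r2 \<cdot> g) = Zer C (Dom C g) Y2" using bs K g(1) by simp
      then have 2: "r2 \<cdot> g = Zer C (Dom C g) X2"
        using is_mono_Zer[OF is_kernel_mono[OF k2(1)], of "r2 \<cdot> g"] bs K g(1) by simp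
      have "g = Zer C (Dom C g) XX"
        by (rule biproduct_eqI[OF XX]) (use 1 2 bs g(1) in simp_all)
      then show "g = Zer C (Dom C g) (Dom C ?k)" using bs K by simp
    qed (use bs K in simp)
    fix h assume h: "h \<in> Arr C" "Cod C h = Dom C ?p" "?p \<cdot> h = Zer C (Dom C h) (Cod C ?p)"
    have [simp]: "Cod C h = YY" using h bs K by simp
    have "t1 \<cdot> (?p \<cdot> h) = Zer C (Dom C h) Z1" unfolding h(3) using bs K h(1) by simp
    then have "p1 \<cdot> (n1 \<cdot> h) = Zer C (Dom C h) Z1" using bs K h(1) by simp
    then obtain u1 where u1: "u1 \<in> Arr C" "Dom C u1 = Dom C h" "Cod C u1 = X1" "k1 \<cdot> u1 = n1 \<cdot> h"
      using is_kernel_lift[OF k1(1), of "n1 \<cdot> h"] bs K h(1) by auto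
    have "t2 \<cdot> (?p \<cdot> h) = Zer C (Dom C h) Z2" unfolding h(3) using bs K h(1) by simp
    then have "p2 \<cdot> (n2 \<cdot> h) = Zer C (Dom C h) Z2" using bs K h(1) by simp
    then obtain u2 where u2: "u2 \<in> Arr C" "Dom C u2 = Dom C h" "Cod C u2 = X2" "k2 \<cdot> u2 = n2 \<cdot> h"
      using is_kernel_lift[OF k2(1), of "n2 \<cdot> h"] bs K h(1) by auto
    have "?k \<cdot> Add C (i1 \<cdot> u1) (i2 \<cdot> u2) = h"
      by (rule biproduct_eqI[OF YY]) (use u1 u2 bs K h(1) in simp_all)
    then show "\<exists>u\<in>Arr C. Dom C u = Dom C h \<and> Cod C u = Dom C ?k \<and> ?k \<cdot> u = h"
      using u1 u2 bs K by (intro bexI[of _ "Add C (i1 \<cdot> u1) (i2 \<cdot> u2)"]) simp_all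
  qed
qed

text \<open>Literally the pair \<open>d\<close> of \<open>is_baer_sum\<close>, brackets included, so
  that unfolding the two definitions makes them coincide.\<close>

definition ext_sum :: "'m \<times> 'm \<Rightarrow> 'm \<times> 'm \<Rightarrow> 'm \<Rightarrow> 'm \<Rightarrow> 'm \<Rightarrow> 'm \<Rightarrow> 'm \<Rightarrow> 'm \<Rightarrow> 'm \<Rightarrow> 'm \<Rightarrow> 'm \<times> 'm" where
  "ext_sum e e' r1 r2 m1 m2 n1 n2 j1 j2 =
    (Add C (Comp C (Comp C m1 (fst e)) r1) (Comp C (Comp C m2 (fst e')) r2),
     Add C (Comp C (Comp C j1 (snd e)) n1) (Comp C (Comp C j2 (snd e')) n2))"

context
  fixes X1 X2 XX i1 i2 r1 r2 Y1 Y2 YY m1 m2 n1 n2 Z1 Z2 ZZ j1 j2 t1 t2 e1 e2 d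
  assumes XX: "is_biproduct C X1 X2 XX i1 i2 r1 r2"
    and YY: "is_biproduct C (Cod C (fst e1)) (Cod C (fst e2)) YY m1 m2 n1 n2"
    and ZZ: "is_biproduct C Z1 Z2 ZZ j1 j2 t1 t2"
    and e1: "e1 \<in> extensions C Z1 X1" and e2: "e2 \<in> extensions C Z2 X2"
    and d: "d = ext_sum e1 e2 r1 r2 m1 m2 n1 n2 j1 j2"
begin

lemma ext_sum_in_extensions: "d \<in> extensions C ZZ XX"
proof -
  note bs = biproduct_simps[OF XX] biproduct_simps[OF YY] biproduct_simps[OF ZZ]
  note E = extensionsE[OF e1] extensionsE[OF e2]
  have ds: "d = (Add C (m1 \<cdot> (fst e1 \<cdot> r1)) (m2 \<cdot> (fst e2 \<cdot> r2)),
      Add C (j1 \<cdot> (snd e1 \<cdot> n1)) (j2 \<cdot> (snd e2 \<cdot> n2)))"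
    unfolding d ext_sum_def using bs E by simp
  have "is_kernel C (fst d) (snd d)"
    unfolding ds fst_conv snd_conv
    by (rule biproduct_sum_kernel[OF XX YY ZZ]) (use E in auto)
  \<comment> \<open>The cokernel half is the kernel half in the opposite category, with injections
    and projections of all three biproducts exchanged.\<close>
  moreover have "is_kernel (dual C)
     (Add (dual C) (n1 \<cdot>\<^bsub>dual C\<^esub> (snd e1 \<cdot>\<^bsub>dual C\<^esub> j1)) (n2 \<cdot>\<^bsub>dual C\<^esub> (snd e2 \<cdot>\<^bsub>dual C\<^esub> j2)))
     (Add (dual C) (r1 \<cdot>\<^bsub>dual C\<^esub> (fst e1 \<cdot>\<^bsub>dual C\<^esub> m1)) (r2 \<cdot>\<^bsub>dual C\<^esub> (fst e2 \<cdot>\<^bsub>dual C\<^esub> m2)))"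
    by (rule preadditive_category.biproduct_sum_kernel[OF op_preadditive, of Z1 Z2 ZZ t1 t2 j1 j2
          "Cod C (fst e1)" "Cod C (fst e2)" YY n1 n2 m1 m2 X1 X2 XX r1 r2 i1 i2])
       (use XX YY ZZ E in auto)
  then have "is_cokernel C (snd d) (fst d)"
    unfolding ds fst_conv snd_conv using bs E by simp
  ultimately show ?thesis
    using bs E by (simp add: extensions_def short_exact_def ds)
qed

lemma ext_sum_proj: "ext_arrow C r1 t1 d e1" "ext_arrow C r2 t2 d e2"
proof -
  note bs = biproduct_simps[OF XX] biproduct_simps[OF YY] biproduct_simps[OF ZZ]
  note E = extensionsE[OF e1] extensionsE[OF e2]
  note D = ext_sum_in_extensions
  show "ext_arrow C r1 t1 d e1"
    by (rule ext_arrowI[OF D e1, where \<beta> = n1]) (use bs E in \<open>simp_all add: d ext_sum_def\<close>)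
  show "ext_arrow C r2 t2 d e2"
    by (rule ext_arrowI[OF D e2, where \<beta> = n2]) (use bs E in \<open>simp_all add: d ext_sum_def\<close>)
qed

text \<open>With \<open>ext_sum_proj\<close> as projections, this is the existence half of the
  statement that the direct sum is a product of \<open>e1\<close> and \<open>e2\<close> among
  extensions.\<close>

lemma ext_sum_lift:
  assumes e: "e \<in> extensions C Z X"
    and 1: "ext_arrow C \<alpha>1 \<gamma>1 e e1" and 2: "ext_arrow C \<alpha>2 \<gamma>2 e e2"
  shows "ext_arrow C (Add C (i1 \<cdot> \<alpha>1) (i2 \<cdot> \<alpha>2)) (Add C (j1 \<cdot> \<gamma>1) (j2 \<cdot> \<gamma>2)) e d"
proof -
  note bs = biproduct_simps[OF XX] biproduct_simps[OF YY] biproduct_simps[OF ZZ]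
  note E = extensionsE[OF e1] extensionsE[OF e2] extensionsE[OF e]
  obtain \<beta>1 where b1: "\<alpha>1 \<in> Arr C" "Dom C \<alpha>1 = X" "Cod C \<alpha>1 = X1"
    "\<gamma>1 \<in> Arr C" "Dom C \<gamma>1 = Z" "Cod C \<gamma>1 = Z1"
    "\<beta>1 \<in> Arr C" "Dom C \<beta>1 = Dom C (snd e)" "Cod C \<beta>1 = Dom C (snd e1)"
    "\<beta>1 \<cdot> fst e = fst e1 \<cdot> \<alpha>1" "snd e1 \<cdot> \<beta>1 = \<gamma>1 \<cdot> snd e"
    using ext_arrowE[OF e e1 1] by metis
  obtain \<beta>2 where b2: "\<alpha>2 \<in> Arr C" "Dom C \<alpha>2 = X" "Cod C \<alpha>2 = X2"
    "\<gamma>2 \<in> Arr C" "Dom C \<gamma>2 = Z" "Cod C \<gamma>2 = Z2"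
    "\<beta>2 \<in> Arr C" "Dom C \<beta>2 = Dom C (snd e)" "Cod C \<beta>2 = Dom C (snd e2)"
    "\<beta>2 \<cdot> fst e = fst e2 \<cdot> \<alpha>2" "snd e2 \<cdot> \<beta>2 = \<gamma>2 \<cdot> snd e"
    using ext_arrowE[OF e e2 2] by metis
  show ?thesis
    by (rule ext_arrowI[OF e ext_sum_in_extensions, where \<beta> = "Add C (m1 \<cdot> \<beta>1) (m2 \<cdot> \<beta>2)"])
      (use bs E b1 b2 in \<open>simp_all add: d ext_sum_def\<close>)
qed

end

end

section \<open>The Baer sum\<close>

context abelian_category
begin

lemma ext_sum_exists:
  assumes e1: "e1 \<in> extensions C Z X1" and e2: "e2 \<in> extensions C Z X2"
  obtains YY m1 m2 n1 n2 ZZ j1 j2 t1 t2 where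
    "is_biproduct C (Cod C (fst e1)) (Cod C (fst e2)) YY m1 m2 n1 n2"
    "is_biproduct C Z Z ZZ j1 j2 t1 t2"
proof -
  have "Cod C (fst e1) \<in> Obj C" "Cod C (fst e2) \<in> Obj C" "Z \<in> Obj C"
    using extensionsE[OF e1] extensionsE[OF e2] by simp_all
  then show ?thesis using that biproducts by metis
qed

text \<open>Pulling the direct sum back along the diagonal of \<open>Z\<close> gives the element of
  Ext^1 of \<open>Z\<close> by \<open>X1 \<oplus> X2\<close> with components \<open>e1\<close> and
  \<open>e2\<close>.\<close>

lemma ext_pair_exists:
  assumes XX: "is_biproduct C X1 X2 XX i1 i2 r1 r2"
    and e1: "e1 \<in> extensions C Z X1" and e2: "e2 \<in> extensions C Z X2"
  obtains d where "d \<in> extensions C Z XX"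
    "ext_arrow C r1 (Ident C Z) d e1" "ext_arrow C r2 (Ident C Z) d e2"
proof -
  note [simp] = extensionsE(6,7)[OF e1] extensionsE(6,7)[OF e2]
  obtain YY m1 m2 n1 n2 ZZ j1 j2 t1 t2
    where YY: "is_biproduct C (Cod C (fst e1)) (Cod C (fst e2)) YY m1 m2 n1 n2"
      and ZZ: "is_biproduct C Z Z ZZ j1 j2 t1 t2"
    using ext_sum_exists[OF e1 e2] by blast
  let ?s = "ext_sum e1 e2 r1 r2 m1 m2 n1 n2 j1 j2"
  note s = ext_sum_in_extensions[OF XX YY ZZ e1 e2 refl]
  note p = ext_sum_proj[OF XX YY ZZ e1 e2 refl]
  note bs = biproduct_simps[OF ZZ] biproduct_simps[OF XX]
  obtain d where d: "d \<in> extensions C Z XX" "ext_arrow C (Ident C XX) (Add C j1 j2) d ?s"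
    using ext_pull_exists[OF s, of "Add C j1 j2" Z] bs by auto
  have "ext_arrow C r1 (Ident C Z) d e1" "ext_arrow C r2 (Ident C Z) d e2"
    using ext_arrow_comp[OF d(1) s e1 d(2) p(1)] ext_arrow_comp[OF d(1) s e2 d(2) p(2)] bs
    by simp_all
  then show ?thesis using d(1) that by blast
qed

text \<open>The morphism from \<open>e\<close> to the direct sum has
  \<open>(j1 + j2) \<gamma>\<close> at its right end, and \<open>d\<close> is the pull-back of the
  direct sum along \<open>j1 + j2\<close>.\<close>

lemma ext_pair_lift:
  assumes XX: "is_biproduct C X1 X2 XX i1 i2 r1 r2"
    and e1: "e1 \<in> extensions C Z X1" and e2: "e2 \<in> extensions C Z X2"
    and d: "d \<in> extensions C Z XX" "ext_arrow C r1 (Ident C Z) d e1" "ext_arrow C r2 (Ident C Z) d e2"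
    and e: "e \<in> extensions C Z0 W" "ext_arrow C \<alpha> \<gamma> e e1" "ext_arrow C \<beta> \<gamma> e e2"
  shows "ext_arrow C (Add C (i1 \<cdot> \<alpha>) (i2 \<cdot> \<beta>)) \<gamma> e d"
proof -
  note [simp] = extensionsE(6,7)[OF e1] extensionsE(6,7)[OF e2]
  obtain YY m1 m2 n1 n2 ZZ j1 j2 t1 t2
    where YY: "is_biproduct C (Cod C (fst e1)) (Cod C (fst e2)) YY m1 m2 n1 n2"
      and ZZ: "is_biproduct C Z Z ZZ j1 j2 t1 t2"
    using ext_sum_exists[OF e1 e2] by blast
  let ?s = "ext_sum e1 e2 r1 r2 m1 m2 n1 n2 j1 j2"
  note s = ext_sum_in_extensions[OF XX YY ZZ e1 e2 refl]
  note p = ext_sum_lift[OF XX YY ZZ e1 e2 refl]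
  note bs = biproduct_simps[OF ZZ] biproduct_simps[OF XX]
  note t = ext_arrow_typing[OF e(1) e1 e(2)] ext_arrow_typing[OF e(1) e2 e(3)]
  have "ext_arrow C (Ident C XX) (Add C j1 j2) d ?s"
    using p[OF d] bs XX by (simp add: is_biproduct_def)
  moreover have "ext_arrow C (Add C (i1 \<cdot> \<alpha>) (i2 \<cdot> \<beta>)) (Add C j1 j2 \<cdot> \<gamma>) e ?s"
    using p[OF e] bs t by simp
  ultimately show ?thesis
    using ext_pull_factor[OF s d(1) _ e(1)] t by blast
qed

text \<open>The pull-back of the direct sum along the diagonal is the same thing as an extension
  with components \<open>e1\<close> and \<open>e2\<close>; the biproducts of the middle terms and of
  \<open>Z\<close> thereby disappear from view.\<close>

lemma is_baer_sum_iff: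
  assumes e1: "e1 \<in> extensions C Z X" and e2: "e2 \<in> extensions C Z X"
  shows "is_baer_sum C Z X e1 e2 s \<longleftrightarrow> (\<exists>XX i1 i2 r1 r2 d. is_biproduct C X X XX i1 i2 r1 r2 \<and>
    d \<in> extensions C Z XX \<and> ext_arrow C r1 (Ident C Z) d e1 \<and> ext_arrow C r2 (Ident C Z) d e2 \<and>
    s \<in> extensions C Z X \<and> ext_arrow C (Add C r1 r2) (Ident C Z) d s)" (is "?L \<longleftrightarrow> ?R")
proof
  note [simp] = extensionsE(6,7)[OF e1] extensionsE(6,7)[OF e2]
  { assume ?L
    then obtain XX i1 i2 r1 r2 YY m1 m2 n1 n2 ZZ j1 j2 t1 t2 d
      where XX: "is_biproduct C X X XX i1 i2 r1 r2"
      and YY: "is_biproduct C (Cod C (fst e1)) (Cod C (fst e2)) YY m1 m2 n1 n2"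
      and ZZ: "is_biproduct C Z Z ZZ j1 j2 t1 t2"
      and pull: "is_ext_pullback C (Add C j1 j2) (ext_sum e1 e2 r1 r2 m1 m2 n1 n2 j1 j2) d"
      and push: "is_ext_pushout C (Add C r1 r2) d s"
      unfolding is_baer_sum_def ext_sum_def by blast
    let ?s = "ext_sum e1 e2 r1 r2 m1 m2 n1 n2 j1 j2"
    note s = ext_sum_in_extensions[OF XX YY ZZ e1 e2 refl]
    note p = ext_sum_proj[OF XX YY ZZ e1 e2 refl]
    note bs = biproduct_simps[OF ZZ] biproduct_simps[OF XX]
    note S = extensionsE[OF s]
    have d: "d \<in> extensions C Z XX" "ext_arrow C (Ident C XX) (Add C j1 j2) d ?s"
      using pull bs S by (auto simp: is_ext_pullback_def ext_arrow_def)
    note D = extensionsE[OF d(1)]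
    have "ext_arrow C r1 (Ident C Z) d e1" "ext_arrow C r2 (Ident C Z) d e2"
      using ext_arrow_comp[OF d(1) s e1 d(2) p(1)] ext_arrow_comp[OF d(1) s e2 d(2) p(2)] bs
      by simp_all
    moreover have "s \<in> extensions C Z X \<and> ext_arrow C (Add C r1 r2) (Ident C Z) d s"
      using push bs D by (auto simp: is_ext_pushout_def ext_arrow_def)
    ultimately show ?R using XX d(1) by blast }
  { assume ?R
    then obtain XX i1 i2 r1 r2 d where XX: "is_biproduct C X X XX i1 i2 r1 r2"
      and d: "d \<in> extensions C Z XX" "ext_arrow C r1 (Ident C Z) d e1" "ext_arrow C r2 (Ident C Z) d e2"
      and s: "s \<in> extensions C Z X" "ext_arrow C (Add C r1 r2) (Ident C Z) d s"
      by blast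
    obtain YY m1 m2 n1 n2 ZZ j1 j2 t1 t2
      where YY: "is_biproduct C (Cod C (fst e1)) (Cod C (fst e2)) YY m1 m2 n1 n2"
        and ZZ: "is_biproduct C Z Z ZZ j1 j2 t1 t2"
      using ext_sum_exists[OF e1 e2] by blast
    let ?s = "ext_sum e1 e2 r1 r2 m1 m2 n1 n2 j1 j2"
    note ss = ext_sum_in_extensions[OF XX YY ZZ e1 e2 refl]
    note bs = biproduct_simps[OF ZZ] biproduct_simps[OF XX]
    note S = extensionsE[OF ss] extensionsE[OF d(1)]
    have "ext_arrow C (Ident C XX) (Add C j1 j2) d ?s"
      using ext_sum_lift[OF XX YY ZZ e1 e2 refl d] bs XX by (simp add: is_biproduct_def)
    then have "is_ext_pullback C (Add C j1 j2) ?s d"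
      using d(1) bs S by (simp add: is_ext_pullback_def ext_arrow_def)
    moreover have "is_ext_pushout C (Add C r1 r2) d s"
      using s bs S by (simp add: is_ext_pushout_def ext_arrow_def)
    ultimately show ?L
      using XX YY ZZ unfolding is_baer_sum_def ext_sum_def by blast }
qed

text \<open>Equivalently, \<open>Ext\<^sup>1(Z, -)\<close> preserves products, and hence abelian group objects.\<close>

lemma is_baer_sum_push:
  assumes d: "d \<in> extensions C Z W" and e1: "e1 \<in> extensions C Z X" and e2: "e2 \<in> extensions C Z X"
    and s: "s \<in> extensions C Z X"
    and a: "ext_arrow C \<alpha> (Ident C Z) d e1" "ext_arrow C \<beta> (Ident C Z) d e2"
  shows "is_baer_sum C Z X e1 e2 s \<longleftrightarrow> ext_arrow C (Add C \<alpha> \<beta>) (Ident C Z) d s" (is "?L \<longleftrightarrow> ?R")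
proof -
  note [simp] = extensionsE(6,7)[OF e1]
  note t = ext_arrow_typing[OF d e1 a(1)] ext_arrow_typing[OF d e2 a(2)]
  show ?thesis
  proof
    assume ?L
    then obtain XX i1 i2 r1 r2 d' where XX: "is_biproduct C X X XX i1 i2 r1 r2"
      and d': "d' \<in> extensions C Z XX" "ext_arrow C r1 (Ident C Z) d' e1" "ext_arrow C r2 (Ident C Z) d' e2"
      and s': "ext_arrow C (Add C r1 r2) (Ident C Z) d' s"
      using is_baer_sum_iff[OF e1 e2] by blast
    have "ext_arrow C (Add C (i1 \<cdot> \<alpha>) (i2 \<cdot> \<beta>)) (Ident C Z) d d'"
      using ext_pair_lift[OF XX e1 e2 d' d a] .
    from ext_arrow_comp[OF d d'(1) s this s'] show ?R
      using biproduct_simps[OF XX] t by simp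
  next
    assume R: ?R
    obtain XX i1 i2 r1 r2 where XX: "is_biproduct C X X XX i1 i2 r1 r2"
      using biproducts[of X X] by auto
    note bs = biproduct_simps[OF XX]
    let ?\<theta> = "Add C (i1 \<cdot> \<alpha>) (i2 \<cdot> \<beta>)"
    have r: "r1 \<cdot> ?\<theta> = \<alpha>" "r2 \<cdot> ?\<theta> = \<beta>" "Add C r1 r2 \<cdot> ?\<theta> = Add C \<alpha> \<beta>"
      using bs t by simp_all
    obtain d' where d': "d' \<in> extensions C Z XX" "ext_arrow C ?\<theta> (Ident C Z) d d'"
      using ext_push_exists[OF d, of ?\<theta> XX] bs t by auto
    have "ext_arrow C r1 (Ident C Z) d' e1" "ext_arrow C r2 (Ident C Z) d' e2"
      "ext_arrow C (Add C r1 r2) (Ident C Z) d' s"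
      using ext_push_factor[OF d d' e1, of r1] ext_push_factor[OF d d' e2, of r2]
        ext_push_factor[OF d d' s, of "Add C r1 r2"] a R r bs by simp_all
    then show ?L using is_baer_sum_iff[OF e1 e2] XX d'(1) s by blast
  qed
qed

text \<open>Pair the first two extensions and pair the result with the third, over
  \<open>(X \<oplus> X) \<oplus> X\<close>. Associativity calls for three; where only two are in
  play, one of them is repeated.\<close>

lemma ext_triple:
  assumes e: "e1 \<in> extensions C Z X" "e2 \<in> extensions C Z X" "e3 \<in> extensions C Z X"
  obtains W d \<alpha>1 \<alpha>2 \<alpha>3 where "d \<in> extensions C Z W" "ext_arrow C \<alpha>1 (Ident C Z) d e1"
    "ext_arrow C \<alpha>2 (Ident C Z) d e2" "ext_arrow C \<alpha>3 (Ident C Z) d e3"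
proof -
  note [simp] = extensionsE(6,7)[OF e(1)]
  obtain XX i1 i2 r1 r2 where XX: "is_biproduct C X X XX i1 i2 r1 r2"
    using biproducts[of X X] by auto
  obtain d where d: "d \<in> extensions C Z XX"
    "ext_arrow C r1 (Ident C Z) d e1" "ext_arrow C r2 (Ident C Z) d e2"
    using ext_pair_exists[OF XX e(1,2)] by blast
  obtain W k1 k2 s1 s2 where W: "is_biproduct C XX X W k1 k2 s1 s2"
    using biproducts[of XX X] biproduct_simps[OF XX] by auto
  obtain d' where d': "d' \<in> extensions C Z W"
    "ext_arrow C s1 (Ident C Z) d' d" "ext_arrow C s2 (Ident C Z) d' e3"
    using ext_pair_exists[OF W d(1) e(3)] by blast
  show ?thesis
    using that[OF d'(1) _ _ d'(3)] ext_arrow_comp[OF d'(1) d(1) e(1) d'(2) d(2)]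
      ext_arrow_comp[OF d'(1) d(1) e(2) d'(2) d(3)] by simp
qed

end

section \<open>The Yoneda Ext group\<close>

context abelian_category
begin

lemma ext_equiv_equiv: "equiv (extensions C Z X) (ext_equiv C Z X)"
proof (rule equivI)
  show "ext_equiv C Z X \<subseteq> extensions C Z X \<times> extensions C Z X"
    by (auto simp: ext_equiv_def)
  show "refl_on (extensions C Z X) (ext_equiv C Z X)"
    using ext_arrow_refl ext_equiv_iff by (auto simp: refl_on_def)
  show "sym (ext_equiv C Z X)"
  proof (rule symI)
    fix e e' assume *: "(e, e') \<in> ext_equiv C Z X"
    then have "e \<in> extensions C Z X" "e' \<in> extensions C Z X" by (auto simp: ext_equiv_def)
    then show "(e', e) \<in> ext_equiv C Z X" 
      using * ext_arrow_Ident_sym[of e Z X e'] ext_equiv_iff[of e Z X e'] ext_equiv_iff[of e' Z X e]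
      by blast
  qed
  show "trans (ext_equiv C Z X)"
  proof (rule transI)
    fix e e' e'' assume *: "(e, e') \<in> ext_equiv C Z X" "(e', e'') \<in> ext_equiv C Z X"
    then have "e \<in> extensions C Z X" "e' \<in> extensions C Z X" "e'' \<in> extensions C Z X"
      by (auto simp: ext_equiv_def)
    then show "(e, e'') \<in> ext_equiv C Z X"
      using * ext_equiv_iff[of e Z X e'] ext_equiv_iff[of e' Z X e''] ext_equiv_iff[of e Z X e'']
        ext_arrow_Ident_comp(2)[of e Z X e' Z X "Ident C X" "Ident C Z" e''] by blast
  qed
qed

abbreviation ext_class :: "'o \<Rightarrow> 'o \<Rightarrow> 'm \<times> 'm \<Rightarrow> ('m \<times> 'm) set" where
  "ext_class Z X e \<equiv> ext_equiv C Z X `` {e}"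

lemma ext_class_mem:
  assumes "e \<in> extensions C Z X"
  shows "t \<in> ext_class Z X e \<longleftrightarrow> t \<in> extensions C Z X \<and> ext_arrow C (Ident C X) (Ident C Z) e t"
  using ext_equiv_iff[OF assms, of t] by (auto simp: ext_equiv_def)

lemma ext_class_eq:
  assumes "e \<in> extensions C Z X" "e' \<in> extensions C Z X"
  shows "ext_class Z X e = ext_class Z X e' \<longleftrightarrow> ext_arrow C (Ident C X) (Ident C Z) e e'"
  using eq_equiv_class_iff[OF ext_equiv_equiv assms] ext_equiv_iff[OF assms] by simp

lemma Ext1_carrierI: "e \<in> extensions C Z X \<Longrightarrow> ext_class Z X e \<in> carrier (Ext1 C Z X)"
  by (simp add: Ext1_def quotientI)

lemma Ext1_carrierE:
  assumes "c \<in> carrier (Ext1 C Z X)"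
  obtains e where "e \<in> extensions C Z X" "c = ext_class Z X e"
  using assms by (auto simp: Ext1_def elim!: quotientE)

lemma ext_push_unique:
  assumes "d \<in> extensions C Z W" "e \<in> extensions C Z X" "t \<in> extensions C Z X"
    "ext_arrow C \<alpha> (Ident C Z) d e"
  shows "ext_arrow C (Ident C X) (Ident C Z) e t \<longleftrightarrow> ext_arrow C \<alpha> (Ident C Z) d t"
proof
  assume "ext_arrow C (Ident C X) (Ident C Z) e t"
  then show "ext_arrow C \<alpha> (Ident C Z) d t"
    using ext_arrow_Ident_comp(2)[OF assms(1,2,4,3)] by blast
next
  assume *: "ext_arrow C \<alpha> (Ident C Z) d t"
  note t = ext_arrow_typing[OF assms(1,3) *]
  show "ext_arrow C (Ident C X) (Ident C Z) e t"
    by (rule ext_push_factor[OF assms(1,2,4,3)]) (use t * extensionsE[OF assms(2)] in auto)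
qed

text \<open>Every representative of the class of \<open>\<alpha> d\<close> is itself a push-out of
  \<open>d\<close> along \<alpha>, and likewise for \<beta>. By \<open>is_baer_sum_push\<close> all
  choices of representatives yield the same sums, namely the class of
  \<open>(\<alpha> + \<beta>) d\<close>.\<close>

lemma Ext1_mult:
  assumes d: "d \<in> extensions C Z W" and e1: "e1 \<in> extensions C Z X" and e2: "e2 \<in> extensions C Z X"
    and s: "s \<in> extensions C Z X"
    and a: "ext_arrow C \<alpha> (Ident C Z) d e1" "ext_arrow C \<beta> (Ident C Z) d e2"
      "ext_arrow C (Add C \<alpha> \<beta>) (Ident C Z) d s"
  shows "ext_class Z X e1 \<otimes>\<^bsub>Ext1 C Z X\<^esub> ext_class Z X e2 = ext_class Z X s"
proof -
  have "is_baer_sum C Z X e e' t \<longleftrightarrow> t \<in> ext_class Z X s"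
    if "e \<in> ext_class Z X e1" "e' \<in> ext_class Z X e2" for e e' t
  proof -
    have e: "e \<in> extensions C Z X" "ext_arrow C (Ident C X) (Ident C Z) e1 e"
      "e' \<in> extensions C Z X" "ext_arrow C (Ident C X) (Ident C Z) e2 e'"
      using that ext_class_mem[OF e1] ext_class_mem[OF e2] by auto
    have "ext_arrow C \<alpha> (Ident C Z) d e" "ext_arrow C \<beta> (Ident C Z) d e'"
      using e ext_push_unique[OF d e1 e(1) a(1)] ext_push_unique[OF d e2 e(3) a(2)] by auto
    then have "t \<in> extensions C Z X \<Longrightarrow> ?thesis"
      using is_baer_sum_push[OF d e(1,3)] ext_class_mem[OF s] ext_push_unique[OF d s _ a(3)] by blast
    moreover have "t \<notin> extensions C Z X \<Longrightarrow> ?thesis"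
      using is_baer_sum_iff[OF e(1,3)] ext_class_mem[OF s] by blast
    ultimately show ?thesis by blast
  qed
  moreover have "e1 \<in> ext_class Z X e1" "e2 \<in> ext_class Z X e2"
    using e1 e2 ext_arrow_refl ext_class_mem by auto
  ultimately have "{t. \<exists>e\<in>ext_class Z X e1. \<exists>e'\<in>ext_class Z X e2. is_baer_sum C Z X e e' t} = ext_class Z X s"
    by blast
  then show ?thesis by (simp add: Ext1_def)
qed

text \<open>The middle arrow kills \<open>fst d\<close>, hence descends along the cokernel
  \<open>snd d\<close> to a section. Conversely, a section composed with \<open>snd d\<close> is a
  middle arrow.\<close>

lemma ext_arrow_Zer_iff_split:
  assumes d: "d \<in> extensions C Z W" and s: "s \<in> extensions C Z X"
  shows "ext_arrow C (Zer C W X) (Ident C Z) d s \<longleftrightarrow>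
    (\<exists>\<sigma>\<in>Hom C Z (Dom C (snd s)). snd s \<cdot> \<sigma> = Ident C Z)" (is "?L \<longleftrightarrow> ?R")
proof
  note E = extensionsE[OF d] extensionsE[OF s]
  { assume ?L
    then obtain \<beta> where b: "\<beta> \<in> Arr C" "Dom C \<beta> = Dom C (snd d)" "Cod C \<beta> = Dom C (snd s)"
      "\<beta> \<cdot> fst d = fst s \<cdot> Zer C W X" "snd s \<cdot> \<beta> = Ident C Z \<cdot> snd d"
      using ext_arrowE[OF d s] by metis
    then have "\<beta> \<cdot> fst d = Zer C W (Dom C (snd s))" using E by simp
    then obtain \<sigma> where g: "\<sigma> \<in> Arr C" "Dom C \<sigma> = Z" "Cod C \<sigma> = Dom C (snd s)" "\<sigma> \<cdot> snd d = \<beta>"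
      using is_cokernel_lift[OF E(12), of \<beta>] b E by auto
    have "snd s \<cdot> \<sigma> = Ident C Z"
      by (rule is_epi_cancel[OF E(10)]) (use g b E in auto)
    then show ?R using g E by (intro bexI[of _ \<sigma>]) (auto simp: Hom_iff) }
  { assume ?R
    then obtain \<sigma> where g: "\<sigma> \<in> Arr C" "Dom C \<sigma> = Z" "Cod C \<sigma> = Dom C (snd s)"
      "snd s \<cdot> \<sigma> = Ident C Z" by (auto simp: Hom_iff)
    show ?L
      by (rule ext_arrowI[OF d s, where \<beta> = "\<sigma> \<cdot> snd d"])
        (use g E Comp_eqD[OF g(4), of "snd d"] in auto) }
qed

lemma Ext1_one:
  assumes d: "d \<in> extensions C Z W" and s: "s \<in> extensions C Z X"
    and a: "ext_arrow C (Zer C W X) (Ident C Z) d s"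
  shows "\<one>\<^bsub>Ext1 C Z X\<^esub> = ext_class Z X s"
proof -
  have "t \<in> \<one>\<^bsub>Ext1 C Z X\<^esub> \<longleftrightarrow> t \<in> ext_class Z X s" for t
  proof (cases "t \<in> extensions C Z X")
    case True
    then show ?thesis
      using ext_class_mem[OF s] ext_push_unique[OF d s True a] ext_arrow_Zer_iff_split[OF d True]
      by (auto simp: Ext1_def split_beta)
  next
    case False
    then show ?thesis using ext_class_mem[OF s] by (auto simp: Ext1_def)
  qed
  then show ?thesis by blast
qed

lemma Ext1_one_iff_split:
  assumes e: "e \<in> extensions C Z X"
  shows "ext_class Z X e = \<one>\<^bsub>Ext1 C Z X\<^esub> \<longleftrightarrow>
    (\<exists>\<sigma>\<in>Hom C Z (Dom C (snd e)). snd e \<cdot> \<sigma> = Ident C Z)"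
proof
  have "e \<in> ext_class Z X e" using e ext_arrow_refl ext_class_mem by auto
  then show "ext_class Z X e = \<one>\<^bsub>Ext1 C Z X\<^esub> \<Longrightarrow>
      \<exists>\<sigma>\<in>Hom C Z (Dom C (snd e)). snd e \<cdot> \<sigma> = Ident C Z"
    by (auto simp: Ext1_def)
  show "\<exists>\<sigma>\<in>Hom C Z (Dom C (snd e)). snd e \<cdot> \<sigma> = Ident C Z \<Longrightarrow> ext_class Z X e = \<one>\<^bsub>Ext1 C Z X\<^esub>"
    using ext_arrow_Zer_iff_split[OF e e] Ext1_one[OF e e] by auto
qed

lemma comm_group_Ext1:
  assumes [simp]: "Z \<in> Obj C" "X \<in> Obj C"
  shows "comm_group (Ext1 C Z X)"
proof (rule comm_groupI)
  fix x y assume "x \<in> carrier (Ext1 C Z X)" "y \<in> carrier (Ext1 C Z X)"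
  then obtain e1 e2 where e: "e1 \<in> extensions C Z X" "e2 \<in> extensions C Z X"
    and x: "x = ext_class Z X e1" "y = ext_class Z X e2" using Ext1_carrierE by metis
  obtain W d \<alpha>1 \<alpha>2 where d: "d \<in> extensions C Z W" and a: "ext_arrow C \<alpha>1 (Ident C Z) d e1"
    "ext_arrow C \<alpha>2 (Ident C Z) d e2"
    using ext_triple[OF e e(2)] by metis
  note t = ext_arrow_typing[OF d e(1) a(1)] ext_arrow_typing[OF d e(2) a(2)]
  obtain s where s: "s \<in> extensions C Z X" "ext_arrow C (Add C \<alpha>1 \<alpha>2) (Ident C Z) d s"
    using ext_push_exists[OF d, of "Add C \<alpha>1 \<alpha>2" X] t by auto
  note m = Ext1_mult[OF d e s(1) a s(2)]
  have "Add C \<alpha>1 \<alpha>2 = Add C \<alpha>2 \<alpha>1" using Add_commute t by auto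
  then have m': "y \<otimes>\<^bsub>Ext1 C Z X\<^esub> x = ext_class Z X s"
    using Ext1_mult[OF d e(2,1) s(1) a(2,1)] s(2) x by simp
  show "x \<otimes>\<^bsub>Ext1 C Z X\<^esub> y \<in> carrier (Ext1 C Z X)" using m x Ext1_carrierI s by simp
  show "x \<otimes>\<^bsub>Ext1 C Z X\<^esub> y = y \<otimes>\<^bsub>Ext1 C Z X\<^esub> x" using m m' x by simp
next
  obtain P i1 i2 p1 p2 where P: "is_biproduct C X Z P i1 i2 p1 p2" using biproducts[of X Z] by auto
  note bs = biproduct_simps[OF P]
  have e: "(i1, p2) \<in> extensions C Z X"
    using biproduct_short_exact[OF P] bs by (simp add: extensions_def)
  have "ext_class Z X (i1, p2) = \<one>\<^bsub>Ext1 C Z X\<^esub>"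
    unfolding Ext1_one_iff_split[OF e] using bs by (intro bexI[of _ i2]) (auto simp: Hom_iff)
  then show "\<one>\<^bsub>Ext1 C Z X\<^esub> \<in> carrier (Ext1 C Z X)" using Ext1_carrierI[OF e] by simp
next
  fix x y z assume "x \<in> carrier (Ext1 C Z X)" "y \<in> carrier (Ext1 C Z X)" "z \<in> carrier (Ext1 C Z X)"
  then obtain e1 e2 e3 where
    e: "e1 \<in> extensions C Z X" "e2 \<in> extensions C Z X" "e3 \<in> extensions C Z X"
    and x: "x = ext_class Z X e1" "y = ext_class Z X e2" "z = ext_class Z X e3"
    using Ext1_carrierE by metis
  obtain W d \<alpha>1 \<alpha>2 \<alpha>3 where d: "d \<in> extensions C Z W" and a: "ext_arrow C \<alpha>1 (Ident C Z) d e1"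
    "ext_arrow C \<alpha>2 (Ident C Z) d e2" "ext_arrow C \<alpha>3 (Ident C Z) d e3"
    using ext_triple[OF e] by metis
  note t = ext_arrow_typing[OF d e(1) a(1)] ext_arrow_typing[OF d e(2) a(2)]
     ext_arrow_typing[OF d e(3) a(3)]
  obtain s12 where s12: "s12 \<in> extensions C Z X" "ext_arrow C (Add C \<alpha>1 \<alpha>2) (Ident C Z) d s12"
    using ext_push_exists[OF d, of "Add C \<alpha>1 \<alpha>2" X] t by auto
  obtain s23 where s23: "s23 \<in> extensions C Z X" "ext_arrow C (Add C \<alpha>2 \<alpha>3) (Ident C Z) d s23"
    using ext_push_exists[OF d, of "Add C \<alpha>2 \<alpha>3" X] t by auto
  obtain s where s: "s \<in> extensions C Z X"
    "ext_arrow C (Add C \<alpha>1 (Add C \<alpha>2 \<alpha>3)) (Ident C Z) d s"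
    using ext_push_exists[OF d, of "Add C \<alpha>1 (Add C \<alpha>2 \<alpha>3)" X] t by auto
  have as: "Add C (Add C \<alpha>1 \<alpha>2) \<alpha>3 = Add C \<alpha>1 (Add C \<alpha>2 \<alpha>3)" using Add_assoc t by auto
  show "x \<otimes>\<^bsub>Ext1 C Z X\<^esub> y \<otimes>\<^bsub>Ext1 C Z X\<^esub> z = x \<otimes>\<^bsub>Ext1 C Z X\<^esub> (y \<otimes>\<^bsub>Ext1 C Z X\<^esub> z)"
    unfolding x Ext1_mult[OF d e(1,2) s12(1) a(1,2) s12(2)] Ext1_mult[OF d e(2,3) s23(1) a(2,3) s23(2)]
     Ext1_mult[OF d e(1) s23(1) s(1) a(1) s23(2) s(2)]
     Ext1_mult[OF d s12(1) e(3) s(1) s12(2) a(3), unfolded as, OF s(2)] ..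
next
  fix x assume "x \<in> carrier (Ext1 C Z X)"
  then obtain e where e: "e \<in> extensions C Z X" and x: "x = ext_class Z X e"
    using Ext1_carrierE by metis
  have 1: "ext_arrow C (Ident C X) (Ident C Z) e e" using ext_arrow_refl[OF e] .
  \<comment> \<open>The neutral element is \<open>0 e\<close> and the inverse of \<open>e\<close> is
    \<open>(-1) e\<close>, because \<open>0 + 1 = 1\<close> and \<open>-1 + 1 = 0\<close> in the Hom
    group.\<close>
  obtain s where s: "s \<in> extensions C Z X" "ext_arrow C (Zer C X X) (Ident C Z) e s"
    using ext_push_exists[OF e, of "Zer C X X" X] by auto
  obtain n where n: "n \<in> extensions C Z X" "ext_arrow C (Neg C (Ident C X)) (Ident C Z) e n"
    using ext_push_exists[OF e, of "Neg C (Ident C X)" X] by auto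
  note one = Ext1_one[OF e s]
  show "\<one>\<^bsub>Ext1 C Z X\<^esub> \<otimes>\<^bsub>Ext1 C Z X\<^esub> x = x"
    unfolding one x by (rule Ext1_mult[OF e s(1) e e s(2) 1]) (use 1 in simp)
  have "ext_class Z X n \<otimes>\<^bsub>Ext1 C Z X\<^esub> x = \<one>\<^bsub>Ext1 C Z X\<^esub>"
    unfolding one x by (rule Ext1_mult[OF e n(1) e s(1) n(2) 1]) (use s in simp)
  then show "\<exists>y\<in>carrier (Ext1 C Z X). y \<otimes>\<^bsub>Ext1 C Z X\<^esub> x = \<one>\<^bsub>Ext1 C Z X\<^esub>"
    using Ext1_carrierI[OF n(1)] by blast
qed

text \<open>\<open>Ext1_pull\<close> collects all pull-backs of all representatives; by the
  universal property these form a single class.\<close>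

lemma Ext1_pull_class:
  assumes e: "e \<in> extensions C Z X" and e': "e' \<in> extensions C Z' X"
    and a: "ext_arrow C (Ident C X) \<phi> e' e"
  shows "Ext1_pull C \<phi> (ext_class Z X e) = ext_class Z' X e'"
proof -
  note t = ext_arrow_typing[OF e' e a]
  have "(\<exists>d\<in>ext_class Z X e. is_ext_pullback C \<phi> d u) \<longleftrightarrow> u \<in> ext_class Z' X e'" (is "?L \<longleftrightarrow> ?R") for u
  proof
    assume ?L
    then obtain d where d: "d \<in> extensions C Z X" "ext_arrow C (Ident C X) (Ident C Z) e d"
      and p: "is_ext_pullback C \<phi> d u" using ext_class_mem[OF e] by blast
    have u: "u \<in> extensions C Z' X" "ext_arrow C (Ident C X) \<phi> u d"
      using p t extensionsE[OF d(1)] by (auto simp: is_ext_pullback_def ext_arrow_def)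
    have "ext_arrow C (Ident C X) \<phi> u e"
      using ext_arrow_Ident_comp(2)[OF u(1) d(1) u(2) e] ext_arrow_Ident_sym[OF e d] by blast
    then have "ext_arrow C (Ident C X) (Ident C Z') u e'"
      using t ext_pull_factor[OF e e' a u(1), of "Ident C X" "Ident C Z'"] extensionsE[OF e'] by simp
    then show ?R using ext_class_mem[OF e'] ext_arrow_Ident_sym[OF u(1) e'] u(1) by blast
  next
    assume ?R
    then have u: "u \<in> extensions C Z' X" "ext_arrow C (Ident C X) (Ident C Z') e' u"
      using ext_class_mem[OF e'] by auto
    have "ext_arrow C (Ident C X) \<phi> u e"
      using ext_arrow_Ident_comp(1)[OF e' e a u(1)] ext_arrow_Ident_sym[OF e' u] by blast
    then have "is_ext_pullback C \<phi> e u"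
      using u t extensionsE[OF e] by (auto simp: is_ext_pullback_def ext_arrow_def)
    moreover have "e \<in> ext_class Z X e" using ext_class_mem[OF e] ext_arrow_refl[OF e] e by auto
    ultimately show ?L by blast
  qed
  then show ?thesis by (auto simp: Ext1_pull_def)
qed

text \<open>In formulas, \<open>(\<alpha> d) \<phi> = \<alpha> (d \<phi>)\<close>: the composite of
  \<open>d'\<close> to \<open>d\<close> to \<open>e\<close> has ends \<alpha> and \<phi>, and
  factoring it through the pull-back \<open>e'\<close> leaves an identity at the right end.\<close>

lemma ext_pull_push:
  assumes d: "d \<in> extensions C Z W" and d': "d' \<in> extensions C Z' W" "ext_arrow C (Ident C W) \<phi> d' d"
    and e: "e \<in> extensions C Z X" "ext_arrow C \<alpha> (Ident C Z) d e"
    and e': "e' \<in> extensions C Z' X" "ext_arrow C (Ident C X) \<phi> e' e"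
  shows "ext_arrow C \<alpha> (Ident C Z') d' e'"
proof -
  note t = ext_arrow_typing[OF d'(1) d d'(2)] ext_arrow_typing[OF d e]
  have "ext_arrow C \<alpha> \<phi> d' e" using ext_arrow_comp[OF d'(1) d e(1) d'(2) e(2)] t by simp
  then show ?thesis
    using ext_pull_factor[OF e(1) e' d'(1), of \<alpha> "Ident C Z'"] t extensionsE[OF e'(1)] by simp
qed

lemma Ext1_pull_hom:
  assumes \<phi>: "\<phi> \<in> Hom C Z' Z"
  shows "Ext1_pull C \<phi> \<in> hom (Ext1 C Z X) (Ext1 C Z' X)"
proof -
  have p: "\<phi> \<in> Arr C" "Dom C \<phi> = Z'" "Cod C \<phi> = Z" using \<phi> by (auto simp: Hom_iff)
  show ?thesis
  proof (rule homI)
    fix x assume "x \<in> carrier (Ext1 C Z X)"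
    then obtain e where e: "e \<in> extensions C Z X" "x = ext_class Z X e" by (rule Ext1_carrierE)
    obtain e' where e': "e' \<in> extensions C Z' X" "ext_arrow C (Ident C X) \<phi> e' e"
      using ext_pull_exists[OF e(1) p] by blast
    show "Ext1_pull C \<phi> x \<in> carrier (Ext1 C Z' X)"
      using Ext1_pull_class[OF e(1) e'] Ext1_carrierI[OF e'(1)] e by simp
  next
    fix x y assume "x \<in> carrier (Ext1 C Z X)" "y \<in> carrier (Ext1 C Z X)"
    then obtain e1 e2 where e: "e1 \<in> extensions C Z X" "e2 \<in> extensions C Z X"
      and x: "x = ext_class Z X e1" "y = ext_class Z X e2" using Ext1_carrierE by metis
    obtain W d \<alpha>1 \<alpha>2 where d: "d \<in> extensions C Z W" and a: "ext_arrow C \<alpha>1 (Ident C Z) d e1"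
      "ext_arrow C \<alpha>2 (Ident C Z) d e2"
      using ext_triple[OF e e(2)] by metis
    note t = ext_arrow_typing[OF d e(1) a(1)] ext_arrow_typing[OF d e(2) a(2)]
    obtain s where s: "s \<in> extensions C Z X" "ext_arrow C (Add C \<alpha>1 \<alpha>2) (Ident C Z) d s"
      using ext_push_exists[OF d, of "Add C \<alpha>1 \<alpha>2" X] t by auto
    obtain d' where d': "d' \<in> extensions C Z' W" "ext_arrow C (Ident C W) \<phi> d' d"
      using ext_pull_exists[OF d p] by blast
    obtain e1' where e1': "e1' \<in> extensions C Z' X" "ext_arrow C (Ident C X) \<phi> e1' e1"
      using ext_pull_exists[OF e(1) p] by blast
    obtain e2' where e2': "e2' \<in> extensions C Z' X" "ext_arrow C (Ident C X) \<phi> e2' e2"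
      using ext_pull_exists[OF e(2) p] by blast
    obtain s' where s': "s' \<in> extensions C Z' X" "ext_arrow C (Ident C X) \<phi> s' s"
      using ext_pull_exists[OF s(1) p] by blast
    show "Ext1_pull C \<phi> (x \<otimes>\<^bsub>Ext1 C Z X\<^esub> y) = Ext1_pull C \<phi> x \<otimes>\<^bsub>Ext1 C Z' X\<^esub> Ext1_pull C \<phi> y"
      unfolding x Ext1_mult[OF d e s(1) a s(2)] Ext1_pull_class[OF e(1) e1'] Ext1_pull_class[OF e(2) e2']
        Ext1_pull_class[OF s(1) s']
      by (rule Ext1_mult[symmetric, OF d'(1) e1'(1) e2'(1) s'(1) ext_pull_push[OF d d' e(1) a(1) e1']
            ext_pull_push[OF d d' e(2) a(2) e2'] ext_pull_push[OF d d' s s']])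
  qed
qed

lemma Ext1_pull_Ident:
  assumes "x \<in> carrier (Ext1 C Z X)"
  shows "Ext1_pull C (Ident C Z) x = x"
proof -
  obtain e where e: "e \<in> extensions C Z X" "x = ext_class Z X e" using assms by (rule Ext1_carrierE)
  then show ?thesis using Ext1_pull_class[OF e(1) e(1)] ext_arrow_refl by simp
qed

lemma Ext1_pull_comp:
  assumes \<phi>: "\<phi> \<in> Hom C Z' Z" and \<psi>: "\<psi> \<in> Hom C Z'' Z'" and x: "x \<in> carrier (Ext1 C Z X)"
  shows "Ext1_pull C (\<phi> \<cdot> \<psi>) x = Ext1_pull C \<psi> (Ext1_pull C \<phi> x)"
proof -
  obtain e where e: "e \<in> extensions C Z X" and x: "x = ext_class Z X e" using x by (rule Ext1_carrierE)
  obtain e' where e': "e' \<in> extensions C Z' X" "ext_arrow C (Ident C X) \<phi> e' e"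
    using ext_pull_exists[OF e, of \<phi> Z'] \<phi> by (auto simp: Hom_iff)
  obtain e'' where e'': "e'' \<in> extensions C Z'' X" "ext_arrow C (Ident C X) \<psi> e'' e'"
    using ext_pull_exists[OF e'(1), of \<psi> Z''] \<psi> by (auto simp: Hom_iff)
  have "ext_arrow C (Ident C X) (\<phi> \<cdot> \<psi>) e'' e"
    using ext_arrow_comp[OF e''(1) e'(1) e e''(2) e'(2)] extensionsE[OF e] by simp
  then show ?thesis
    using Ext1_pull_class[OF e e'] Ext1_pull_class[OF e'(1) e''] Ext1_pull_class[OF e e''(1)] x by simp
qed

end

section \<open>Serre subcategories\<close>

locale serre_category = abelian_category C
  for C :: "('o, 'm, 'x) preadd_cat_scheme" (structure) +
  fixes B :: "'o set"
  assumes serre: "serre_subcategory C B"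

lemma serre_isos_dual [simp]: "serre_isos (dual C) B = serre_isos C B"
  by (auto simp: serre_isos_def)

text \<open>The arrows that become zero in the quotient, described without preferring left or right fractions.\<close>

definition negligible :: "('o, 'm, 'x) preadd_cat_scheme \<Rightarrow> 'o set \<Rightarrow> 'm \<Rightarrow> bool" where
  "negligible C B f \<longleftrightarrow> (\<exists>g\<in>Arr C. \<exists>h\<in>Arr C. Dom C g = Cod C h \<and> Cod C h \<in> B \<and> f = Comp C g h)"

lemma negligible_dual [simp]: "negligible (dual C) B f = negligible C B f"
  by (auto simp: negligible_def) metis+

context serre_category
begin

lemma serre_category_dual: "serre_category (dual C) B"
proof (intro serre_category.intro abelian_category_dual serre_category_axioms.intro)
  have "Dom C k \<in> B \<longleftrightarrow> Cod C k \<in> B \<and> Dom C p \<in> B" if "short_exact C p k" for k p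
  proof -
    have "Cod C p = Dom C k" using short_exactE[OF that] by simp
    moreover have "Cod C p \<in> B \<longleftrightarrow> Dom C p \<in> B \<and> Cod C k \<in> B"
      using serre that by (auto simp: serre_subcategory_def)
    ultimately show ?thesis by auto
  qed
  then show "serre_subcategory (dual C) B"
    using serre by (auto simp: serre_subcategory_def)
qed

lemma B_Obj: "T \<in> B \<Longrightarrow> T \<in> Obj C"
  using serre by (auto simp: serre_subcategory_def)

lemma B_short_exact: "short_exact C k p \<Longrightarrow> Cod C k \<in> B \<longleftrightarrow> Dom C k \<in> B \<and> Cod C p \<in> B"
  using serre by (auto simp: serre_subcategory_def)

lemma B_sub:
  assumes "is_mono C m" "Cod C m \<in> B"
  shows "Dom C m \<in> B"
proof -
  have "m \<in> Arr C" using assms by (simp add: is_mono_def)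
  then obtain c where "is_cokernel C c m" using cokernels by blast
  then have "short_exact C m c"
    using mono_is_kernel_cokernel assms by (simp add: short_exact_def)
  then show ?thesis using B_short_exact assms by blast
qed

text \<open>\<open>B\<close> is nonempty, and a zero object embeds in any of its members.\<close>

lemma B_zero:
  assumes "X \<in> Obj C" "Ident C X = Zer C X X"
  shows "X \<in> B"
proof -
  obtain T where T: "T \<in> B" using serre by (auto simp: serre_subcategory_def)
  have [simp]: "T \<in> Obj C" using T by (rule B_Obj)
  have "is_mono C (Zer C X T)"
  proof (rule is_monoI)
    fix g assume g: "g \<in> Arr C" "Cod C g = Dom C (Zer C X T)"
    then have "g = Zer C X X \<cdot> g" using assms by (simp flip: assms(2))
    then show "g = Zer C (Dom C g) (Dom C (Zer C X T))" using g assms by simp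
  qed (use assms in simp)
  then show ?thesis using B_sub T assms by fastforce
qed

text \<open>The source of \<open>u\<close> is an extension of the image, a subobject of an object of
  \<open>B\<close>, by the kernel.\<close>

lemma B_extension:
  assumes "u \<in> Arr C" "Cod C u \<in> B" "is_kernel C n u" "Dom C n \<in> B"
  shows "Dom C u \<in> B"
proof -
  obtain m e where me: "is_mono C m" "is_epi C e" "m \<in> Arr C" "e \<in> Arr C" "Cod C e = Dom C m"
    "Dom C e = Dom C u" "Cod C m = Cod C u" "m \<cdot> e = u"
    using assms(1) by (rule image_factorization)
  have "is_kernel C n e" using is_kernel_comp_mono[OF me(1,4,5), of n] me(8) assms by simp
  then have "short_exact C n e" using epi_is_cokernel_kernel[OF me(2)] by (simp add: short_exact_def)
  then show ?thesis using B_short_exact[of n e] B_sub[OF me(1)] me assms short_exactE(3)[of n e] by simp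
qed

text \<open>\<open>serre_isos\<close> asks for some kernel in \<open>B\<close>. Kernels are
  isomorphic and \<open>B\<close> is closed under isomorphisms, so the condition holds for every
  kernel.\<close>

lemma kernel_B_unique:
  assumes "is_kernel C k f" "is_kernel C l f" "Dom C k \<in> B"
  shows "Dom C l \<in> B"
proof -
  obtain u where "is_iso C u" "Dom C u = Dom C l" "Cod C u = Dom C k"
    using is_kernel_iso_unique[OF assms(1,2)] by metis
  then show ?thesis using B_sub[OF is_iso_mono] assms by metis
qed

lemmas cokernel_B_unique =
  serre_category.kernel_B_unique[OF serre_category_dual, unfolded unfold_dual]

lemma mono_kernel_B:
  assumes "is_mono C f" "is_kernel C k f"
  shows "Dom C k \<in> B"
proof -
  note k = is_kernelE[OF assms(2)]
  have z: "k = Zer C (Dom C k) (Dom C f)"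
    using is_mono_Zer[OF assms(1), of k] k by simp
  have "Ident C (Dom C k) = Zer C (Dom C k) (Dom C k)"
    by (rule is_mono_cancel[OF is_kernel_mono[OF assms(2)]])
     (use k z in \<open>simp_all\<close>)
  then show ?thesis using B_zero k by simp
qed

lemmas epi_cokernel_B = serre_category.mono_kernel_B[OF serre_category_dual, unfolded unfold_dual]

section \<open>Arrows with kernel and cokernel in the Serre subcategory; Ore conditions\<close>

abbreviation S :: "'m set" where "S \<equiv> serre_isos C B"

lemma S_Arr: "s \<in> S \<Longrightarrow> s \<in> Arr C"
  by (simp add: serre_isos_def)

lemma S_kernel: "s \<in> S \<Longrightarrow> is_kernel C k s \<Longrightarrow> Dom C k \<in> B"
  using kernel_B_unique by (auto simp: serre_isos_def)

lemma S_cokernel: "s \<in> S \<Longrightarrow> is_cokernel C c s \<Longrightarrow> Cod C c \<in> B"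
  using cokernel_B_unique by (auto simp: serre_isos_def)

lemma S_I:
  assumes "s \<in> Arr C" "\<And>k. is_kernel C k s \<Longrightarrow> Dom C k \<in> B" "\<And>c. is_cokernel C c s \<Longrightarrow> Cod C c \<in> B"
  shows "s \<in> S"
  using assms kernels[OF assms(1)] cokernels[OF assms(1)] by (auto simp: serre_isos_def)

lemma S_mono: "is_mono C s \<Longrightarrow> (\<And>c. is_cokernel C c s \<Longrightarrow> Cod C c \<in> B) \<Longrightarrow> s \<in> S"
  using S_I mono_kernel_B by (auto simp: is_mono_def)

lemma S_epi: "is_epi C s \<Longrightarrow> (\<And>k. is_kernel C k s \<Longrightarrow> Dom C k \<in> B) \<Longrightarrow> s \<in> S"
  using S_I epi_cokernel_B by (auto simp: is_epi_def)

lemma S_iso: "is_iso C s \<Longrightarrow> s \<in> S"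
  using S_epi is_iso_epi is_iso_mono mono_kernel_B by blast

lemma S_Ident: "X \<in> Obj C \<Longrightarrow> Ident C X \<in> S"
  by (rule S_iso, rule is_isoI[of _ "Ident C X"]) auto

text \<open>The kernel of \<open>g f\<close> maps to the kernel of \<open>g\<close> by an arrow
  \<open>u\<close>, and the kernel of \<open>u\<close> embeds in the kernel of \<open>f\<close>; now
  \<open>B_extension\<close> applies to \<open>u\<close>.\<close>

lemma kernel_comp_B:
  assumes "is_kernel C k (g \<cdot> f)" "is_kernel C kf f" "is_kernel C kg g" "Cod C f = Dom C g"
    "Dom C kf \<in> B" "Dom C kg \<in> B"
  shows "Dom C k \<in> B"
proof -
  note K = is_kernelE[OF assms(1)] is_kernelE[OF assms(2)] is_kernelE[OF assms(3)]
  have [simp]: "Cod C k = Dom C f" using K assms by simp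
  have "g \<cdot> (f \<cdot> k) = Zer C (Dom C k) (Cod C g)" using K assms by simp
  then obtain u where u: "u \<in> Arr C" "Dom C u = Dom C k" "Cod C u = Dom C kg" "kg \<cdot> u = f \<cdot> k"
    using is_kernel_lift[OF assms(3), of "f \<cdot> k"] K assms(4) by auto
  obtain n where n: "is_kernel C n u" using kernels u by blast
  note N = is_kernelE[OF n]
  have "f \<cdot> (k \<cdot> n) = Zer C (Dom C n) (Cod C f)"
    using Comp_eq_Comp[OF u(4), of n] u N K assms(4) by simp
  then obtain v where v: "v \<in> Arr C" "Dom C v = Dom C n" "Cod C v = Dom C kf" "kf \<cdot> v = k \<cdot> n"
    using is_kernel_lift[OF assms(2), of "k \<cdot> n"] K N u by auto
  have "is_mono C (kf \<cdot> v)"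
    unfolding v(4) by (rule is_mono_comp) (use is_kernel_mono assms n N u in auto)
  then have "is_mono C v" by (rule is_mono_factor) (use v K in auto)
  then have "Dom C n \<in> B" using B_sub[of v] v assms by simp
  then show ?thesis using B_extension[OF u(1) _ n] u assms by simp
qed

lemmas cokernel_comp_B = serre_category.kernel_comp_B[OF serre_category_dual, unfolded unfold_dual]

lemma S_comp:
  assumes "s \<in> S" "t \<in> S" "Cod C s = Dom C t"
  shows "t \<cdot> s \<in> S"
proof -
  have [simp]: "s \<in> Arr C" "t \<in> Arr C" using assms S_Arr by auto
  obtain ks kt cs ct where k: "is_kernel C ks s" "is_kernel C kt t" "is_cokernel C cs s" "is_cokernel C ct t"
    using kernels[of s] kernels[of t] cokernels[of s] cokernels[of t] by auto
  show ?thesis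
  proof (rule S_I)
    show "Dom C k \<in> B" if "is_kernel C k (t \<cdot> s)" for k
      using kernel_comp_B[OF that k(1,2)] assms k S_kernel by metis
    show "Cod C c \<in> B" if "is_cokernel C c (t \<cdot> s)" for c
      using cokernel_comp_B[OF that k(4,3)] assms k S_cokernel by metis
  qed (use assms in simp)
qed

text \<open>Kernel and cokernel of the base change \<open>q\<close> embed in the kernel and the
  cokernel of \<open>s\<close>.\<close>

lemma S_pullback:
  assumes pb: "pullback s \<phi> \<beta> q" and s: "s \<in> S"
  shows "q \<in> S"
proof (rule S_I)
  note P = pullbackE[OF pb]
  show "q \<in> Arr C" by (fact P(4))
  obtain ks cs where ks: "is_kernel C ks s" and cs: "is_cokernel C cs s"
    using kernels cokernels P(1) by metis
  note K = is_kernelE[OF ks] and CS = is_cokernelE[OF cs]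
  fix k assume k: "is_kernel C k q"
  note k' = is_kernelE[OF k]
  have [simp]: "Cod C s \<in> Obj C" "Dom C k \<in> Obj C" "Dom C s \<in> Obj C" using P k' by auto
  have "s \<cdot> (\<beta> \<cdot> k) = Zer C (Dom C k) (Cod C s)"
    using Comp_eq_Comp[OF P(9), of k] P k' by simp
  then obtain u where u: "u \<in> Arr C" "Dom C u = Dom C k" "Cod C u = Dom C ks" "ks \<cdot> u = \<beta> \<cdot> k"
    using is_kernel_lift[OF ks, of "\<beta> \<cdot> k"] P k' K by auto
  have "is_mono C u"
  proof (rule is_monoI[OF u(1)])
    fix w assume w: "w \<in> Arr C" "Cod C w = Dom C u" "u \<cdot> w = Zer C (Dom C w) (Cod C u)"
    have "\<beta> \<cdot> (k \<cdot> w) = Zer C (Dom C w) (Dom C s)"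
      using Comp_eq_Comp[OF u(4), of w] u w K P k' by simp
    moreover have "q \<cdot> (k \<cdot> w) = Zer C (Dom C w) (Cod C q)"
      using Comp_eqD[OF k'(4), of w] w u k' P by simp
    ultimately have "k \<cdot> w = Zer C (Dom C w) (Dom C q)"
      using w u k' P by (rule_tac pullback_eqI[OF pb]) simp_all
    then show "w = Zer C (Dom C w) (Dom C u)"
      using is_mono_Zer[OF is_kernel_mono[OF k], of w] w u k' by simp
  qed
  then show "Dom C k \<in> B" using B_sub[of u] u S_kernel[OF s ks] by simp
next
  note P = pullbackE[OF pb]
  obtain cs where cs: "is_cokernel C cs s" using cokernels P(1) by metis
  note CS = is_cokernelE[OF cs]
  fix c assume c: "is_cokernel C c q"
  note c' = is_cokernelE[OF c]
  have [simp]: "Cod C \<phi> \<in> Obj C" "Cod C cs \<in> Obj C" using P CS by auto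
  have "cs \<cdot> \<phi> \<cdot> q = Zer C (Dom C q) (Cod C cs)"
    using Comp_eqD[OF CS(4), of \<beta>] P CS c' by simp
  then obtain v where v: "v \<in> Arr C" "Dom C v = Cod C c" "Cod C v = Cod C cs" "v \<cdot> c = cs \<cdot> \<phi>"
    using is_cokernel_lift[OF c, of "cs \<cdot> \<phi>"] P CS c' by auto
  have "is_mono C v"
  proof (rule is_monoI[OF v(1)])
    \<comment> \<open>A chase, with the epis \<epsilon> and \<epsilon>' covering the source of
      \<open>w\<close>: an element of the cokernel of \<open>q\<close> killed by \<open>v\<close> is
      represented by \<open>w'\<close>; its image under \<phi> comes from \<open>s\<close>, so
      \<open>w'\<close> comes from the pull-back by way of \<open>q\<close> and is killed by
      \<open>c\<close>.\<close>
    fix w assume w: "w \<in> Arr C" "Cod C w = Dom C v" "v \<cdot> w = Zer C (Dom C w) (Cod C v)"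
    obtain w' \<epsilon> where pb': "pullback c w w' \<epsilon>" and e: "is_epi C \<epsilon>"
      using pullback_exists[of c w] c'(1) w(1,2) v(2) is_cokernel_epi[OF c] by auto
    note P' = pullbackE(1-4,6-9)[OF pb']
    have "cs \<cdot> (\<phi> \<cdot> w') = v \<cdot> (w \<cdot> \<epsilon>)"
      using Comp_eq_Comp[OF v(4), of w'] P P' CS c' v w by simp
    also have "\<dots> = Zer C (Dom C \<epsilon>) (Cod C cs)"
      using Comp_eqD[OF w(3), of \<epsilon>] P' w v by simp
    finally obtain \<epsilon>' x where x: "is_epi C \<epsilon>'" "\<epsilon>' \<in> Arr C" "x \<in> Arr C" "Cod C \<epsilon>' = Dom C (\<phi> \<cdot> w')"
      "Dom C x = Dom C \<epsilon>'" "Cod C x = Dom C s" "\<phi> \<cdot> w' \<cdot> \<epsilon>' = s \<cdot> x"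
      using cokernel_zero_lift[OF cs, of "\<phi> \<cdot> w'"] P P' CS c' by auto
    have D: "Dom C (\<phi> \<cdot> w') = Dom C \<epsilon>" using P P' c' by simp
    obtain y where y: "y \<in> Arr C" "Dom C y = Dom C \<epsilon>'" "Cod C y = Dom C q" "\<beta> \<cdot> y = x" "q \<cdot> y = w' \<cdot> \<epsilon>'"
      using pullback_lift[OF pb, of x "w' \<cdot> \<epsilon>'"] x D P P' c' by auto
    have "w \<cdot> (\<epsilon> \<cdot> \<epsilon>') = c \<cdot> (w' \<cdot> \<epsilon>')"
      using Comp_eq_Comp[OF P'(8), of \<epsilon>'] P' x D by simp
    also have "\<dots> = Zer C (Dom C \<epsilon>') (Cod C c)"
      using Comp_eqD[OF c'(4), of y] y c' P by simp
    finally have "w \<cdot> (\<epsilon> \<cdot> \<epsilon>') = Zer C (Dom C (\<epsilon> \<cdot> \<epsilon>')) (Cod C w)" using x D P' w v by simp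
    moreover have "is_epi C (\<epsilon> \<cdot> \<epsilon>')" using is_epi_comp e x D by simp
    ultimately have "w = Zer C (Cod C (\<epsilon> \<cdot> \<epsilon>')) (Cod C w)"
      by (rule_tac is_epi_Zer) (use w P' x D in auto)
    then show "w = Zer C (Dom C w) (Dom C v)" using w P' x D by simp
  qed
  then show "Cod C c \<in> B" using B_sub[of v] v S_cokernel[OF s cs] by simp
qed

lemma S_ore:
  assumes "t \<in> S" "f \<in> Arr C" "Cod C t = Cod C f"
  obtains u v where "u \<in> S" "u \<in> Arr C" "v \<in> Arr C" "Dom C v = Dom C u" "Cod C u = Dom C f"
    "Cod C v = Dom C t" "f \<cdot> u = t \<cdot> v"
proof -
  obtain \<beta> q where pb: "pullback t f \<beta> q" using pullback_exists[of t f] assms S_Arr by blast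
  then show ?thesis
    using that[of q \<beta>] S_pullback[OF pb assms(1)] pullbackE[OF pb] by simp
qed

lemmas S_co_ore = serre_category.S_ore[OF serre_category_dual, unfolded unfold_dual serre_isos_dual]

text \<open>The cokernel of \<open>s\<close> is the image of \<open>u\<close>, a subobject of an
  object of \<open>B\<close>.\<close>

lemma kernel_S:
  assumes "is_kernel C s u" "Cod C u \<in> B"
  shows "s \<in> S"
proof (rule S_mono[OF is_kernel_mono[OF assms(1)]])
  note k = is_kernelE[OF assms(1)]
  obtain m e where me: "is_mono C m" "is_epi C e" "m \<in> Arr C" "e \<in> Arr C" "Cod C e = Dom C m"
    "Dom C e = Dom C u" "Cod C m = Cod C u" "m \<cdot> e = u"
    using k(2) by (rule image_factorization)
  have "is_kernel C s e" using is_kernel_comp_mono[OF me(1,4,5), of s] me(8) assms by simp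
  then have e: "is_cokernel C e s" using epi_is_cokernel_kernel[OF me(2)] by simp
  moreover have "Cod C e \<in> B" using B_sub[OF me(1)] me assms by simp
  ultimately show "Cod C c \<in> B" if "is_cokernel C c s" for c using that cokernel_B_unique by blast
qed

text \<open>Given a factorization through \<open>B\<close>, take for \<open>s\<close> the kernel of
  the first factor; given \<open>s\<close>, factor \<open>f\<close> through its cokernel. As
  \<open>negligible\<close> is self-dual, the dual lemma describes the same arrows as those killed
  on the left by \<open>S\<close>, and so the two sides can be exchanged.\<close>

lemma negligible_iff:
  assumes "f \<in> Arr C"
  shows "negligible C B f \<longleftrightarrow> (\<exists>s\<in>S. Cod C s = Dom C f \<and> f \<cdot> s = Zer C (Dom C s) (Cod C f))"
proof
  assume "negligible C B f"
  then obtain g h where gh: "g \<in> Arr C" "h \<in> Arr C" "Dom C g = Cod C h" "Cod C h \<in> B" "f = g \<cdot> h"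
    by (auto simp: negligible_def)
  obtain s where s: "is_kernel C s h" using kernels gh by blast
  note k = is_kernelE[OF s]
  show "\<exists>s\<in>S. Cod C s = Dom C f \<and> f \<cdot> s = Zer C (Dom C s) (Cod C f)"
    using kernel_S[OF s] gh k by (intro bexI[of _ s]) auto
next
  assume "\<exists>s\<in>S. Cod C s = Dom C f \<and> f \<cdot> s = Zer C (Dom C s) (Cod C f)"
  then obtain s where s: "s \<in> S" "Cod C s = Dom C f" "f \<cdot> s = Zer C (Dom C s) (Cod C f)" by blast
  obtain c where c: "is_cokernel C c s" using cokernels S_Arr s by blast
  note k = is_cokernelE[OF c]
  obtain g where "g \<in> Arr C" "Dom C g = Cod C c" "Cod C g = Cod C f" "g \<cdot> c = f"
    using is_cokernel_lift[OF c, of f] assms s by auto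
  then show "negligible C B f"
    using k S_cokernel[OF s(1) c] by (auto simp: negligible_def)
qed

lemmas negligible_co_iff =
  serre_category.negligible_iff[OF serre_category_dual, unfolded unfold_dual serre_isos_dual negligible_dual]

lemma negligible_mono:
  assumes "negligible C B m" "is_mono C m"
  shows "Dom C m \<in> B"
proof -
  obtain g h where gh: "g \<in> Arr C" "h \<in> Arr C" "Dom C g = Cod C h" "Cod C h \<in> B" "m = g \<cdot> h"
    using assms by (auto simp: negligible_def)
  then have "is_mono C h" using is_mono_factor assms by metis
  then show ?thesis using B_sub gh by fastforce
qed

lemmas negligible_epi =
  serre_category.negligible_mono[OF serre_category_dual, unfolded unfold_dual negligible_dual]

text \<open>The difference of \<open>f\<close> and \<open>g\<close> is negligible because
  \<open>t\<close> kills it on the left; hence some \<open>s\<close> kills it on the right.\<close>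

lemma S_cancel:
  assumes t: "t \<in> S" and f: "f \<in> Arr C" "g \<in> Arr C" "Dom C f = Dom C g" "Cod C f = Dom C t" "Cod C g = Dom C t"
    and eq: "t \<cdot> f = t \<cdot> g"
  obtains s where "s \<in> S" "Cod C s = Dom C f" "f \<cdot> s = g \<cdot> s"
proof -
  have [simp]: "t \<in> Arr C" using t by (rule S_Arr)
  let ?d = "Add C f (Neg C g)"
  have "t \<cdot> ?d = Zer C (Dom C g) (Cod C t)" using f eq by simp
  then have "negligible C B ?d"
    using negligible_co_iff[of ?d] f t by (auto intro!: bexI[of _ t])
  then obtain s where s: "s \<in> S" "Cod C s = Dom C f" "?d \<cdot> s = Zer C (Dom C s) (Dom C t)"
    using negligible_iff[of ?d] f by auto
  have "f \<cdot> s = g \<cdot> s"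
    by (rule Add_eq_Zer) (use s f S_Arr[OF s(1)] in auto)
  then show ?thesis using that s by blast
qed

end

section \<open>The quotient category\<close>

context serre_category
begin

section \<open>Equivalence and composition of roofs\<close>

lemma roofs_iff: "(s, f) \<in> roofs C B \<longleftrightarrow> s \<in> S \<and> f \<in> Arr C \<and> Dom C f = Dom C s"
  by (simp add: roofs_def)

lemma roof_relI:
  assumes "(s, f) \<in> roofs C B" "(t, g) \<in> roofs C B" "Cod C s = Cod C t" "Cod C f = Cod C g"
    "u \<in> Arr C" "v \<in> Arr C" "Dom C u = Dom C v" "Cod C u = Dom C s" "Cod C v = Dom C t"
    "s \<cdot> u = t \<cdot> v" "s \<cdot> u \<in> S" "f \<cdot> u = g \<cdot> v"
  shows "((s, f), (t, g)) \<in> roof_rel C B"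
proof -
  have "u \<in> Hom C (Dom C v) (Dom C s)" "v \<in> Hom C (Dom C v) (Dom C t)"
    using assms by (auto simp: Hom_def)
  then show ?thesis unfolding roof_rel_def using assms by blast
qed

lemma roof_relE:
  assumes "((s, f), (t, g)) \<in> roof_rel C B"
  obtains u v where "(s, f) \<in> roofs C B" "(t, g) \<in> roofs C B" "Cod C s = Cod C t" "Cod C f = Cod C g"
    "u \<in> Arr C" "v \<in> Arr C" "Dom C u = Dom C v" "Cod C u = Dom C s" "Cod C v = Dom C t"
    "s \<cdot> u = t \<cdot> v" "s \<cdot> u \<in> S" "f \<cdot> u = g \<cdot> v"
proof -
  from assms obtain W u v where *: "(s, f) \<in> roofs C B" "(t, g) \<in> roofs C B" "Cod C s = Cod C t" "Cod C f = Cod C g"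
    "u \<in> Hom C W (Dom C s)" "v \<in> Hom C W (Dom C t)"
    "s \<cdot> u = t \<cdot> v" "s \<cdot> u \<in> S" "f \<cdot> u = g \<cdot> v"
    unfolding roof_rel_def by blast
  show ?thesis by (rule that[of u v]) (use * in \<open>auto simp: Hom_def\<close>)
qed

lemma common_denominator:
  assumes "a \<in> S" "b \<in> S" "Cod C a = Cod C b"
  obtains x y where "x \<in> S" "x \<in> Arr C" "y \<in> Arr C" "Dom C x = Dom C y" "Cod C x = Dom C a"
    "Cod C y = Dom C b" "a \<cdot> x = b \<cdot> y" "a \<cdot> x \<in> S"
  using S_ore[OF assms(2) S_Arr[OF assms(1)]] assms S_comp by metis

text \<open>Only the composites \<open>s a\<close> and \<open>s b\<close> are known to be in
  \<open>S\<close>, not \<open>a\<close> and \<open>b\<close>. The composites have a common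
  denominator, after which the two arrows agree under \<open>s\<close>, and \<open>S_cancel\<close>
  removes \<open>s\<close>.\<close>

lemma complete_equal:
  assumes s: "s \<in> S" and a: "a \<in> Arr C" "Cod C a = Dom C s" "s \<cdot> a \<in> S"
    and b: "b \<in> Arr C" "Cod C b = Dom C s" "s \<cdot> b \<in> S"
  obtains x y where "x \<in> S" "x \<in> Arr C" "y \<in> Arr C" "Dom C x = Dom C y" "Cod C x = Dom C a"
    "Cod C y = Dom C b" "a \<cdot> x = b \<cdot> y"
proof -
  have [simp]: "s \<in> Arr C" using s by (rule S_Arr)
  obtain x y where xy: "x \<in> S" "x \<in> Arr C" "y \<in> Arr C" "Dom C x = Dom C y" "Cod C x = Dom C a"
    "Cod C y = Dom C b" "s \<cdot> a \<cdot> x = s \<cdot> b \<cdot> y"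
    by (rule common_denominator[OF a(3) b(3)]) (use a b in auto)
  obtain z where z: "z \<in> S" "Cod C z = Dom C (a \<cdot> x)" "a \<cdot> x \<cdot> z = b \<cdot> y \<cdot> z"
    using S_cancel[OF s, of "a \<cdot> x" "b \<cdot> y"] xy a b by auto
  show ?thesis
    by (rule that[of "x \<cdot> z" "y \<cdot> z"]) (use z xy a b S_Arr[OF z(1)] S_comp[OF z(1) xy(1)] in auto)
qed

lemma roof_rel_trans:
  assumes "((s, f), (t, g)) \<in> roof_rel C B" "((t, g), (r, h)) \<in> roof_rel C B"
  shows "((s, f), (r, h)) \<in> roof_rel C B"
proof -
  obtain u v where 1: "(s, f) \<in> roofs C B" "(t, g) \<in> roofs C B" "Cod C s = Cod C t" "Cod C f = Cod C g"
    "u \<in> Arr C" "v \<in> Arr C" "Dom C u = Dom C v" "Cod C u = Dom C s" "Cod C v = Dom C t"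
    "s \<cdot> u = t \<cdot> v" "s \<cdot> u \<in> S" "f \<cdot> u = g \<cdot> v"
    using assms(1) by (rule roof_relE)
  obtain u' v' where 2: "(r, h) \<in> roofs C B" "Cod C t = Cod C r" "Cod C g = Cod C h"
    "u' \<in> Arr C" "v' \<in> Arr C" "Dom C u' = Dom C v'" "Cod C u' = Dom C t" "Cod C v' = Dom C r"
    "t \<cdot> u' = r \<cdot> v'" "t \<cdot> u' \<in> S" "g \<cdot> u' = h \<cdot> v'"
    using assms(2) by (rule roof_relE)
  have m: "s \<in> S" "t \<in> S" "r \<in> S" "f \<in> Arr C" "g \<in> Arr C" "h \<in> Arr C" "Dom C f = Dom C s"
    "Dom C g = Dom C t" "Dom C h = Dom C r"
    using 1 2 by (auto simp: roofs_iff)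
  note [simp] = m(4-6) S_Arr[OF m(1)] S_Arr[OF m(2)] S_Arr[OF m(3)]
  \<comment> \<open>\<open>v\<close> and \<open>u'\<close> both run into the apex of the middle
    roof; equalising them glues the two refinements.\<close>
  obtain x y where xy: "x \<in> S" "x \<in> Arr C" "y \<in> Arr C" "Dom C x = Dom C y" "Cod C x = Dom C v"
    "Cod C y = Dom C u'" "v \<cdot> x = u' \<cdot> y"
    using complete_equal[OF m(2), of v u'] 1 2 by metis
  show ?thesis
  proof (rule roof_relI[of _ _ _ _ "u \<cdot> x" "v' \<cdot> y"])
    have a: "s \<cdot> (u \<cdot> x) = t \<cdot> (v \<cdot> x)" using Comp_eq_Comp[OF 1(10), of x] 1 xy by simp
    also have "\<dots> = r \<cdot> (v' \<cdot> y)" using Comp_eq_Comp[OF 2(9), of y] 2 xy by simp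
    finally show "s \<cdot> (u \<cdot> x) = r \<cdot> (v' \<cdot> y)" .
    have "f \<cdot> (u \<cdot> x) = g \<cdot> (v \<cdot> x)" using Comp_eq_Comp[OF 1(12), of x] 1 xy m by simp
    also have "\<dots> = h \<cdot> (v' \<cdot> y)" using Comp_eq_Comp[OF 2(11), of y] 2 xy m by simp
    finally show "f \<cdot> (u \<cdot> x) = h \<cdot> (v' \<cdot> y)" .
    have "s \<cdot> u \<cdot> x \<in> S" by (rule S_comp) (use 1 xy in auto)
    then show "s \<cdot> (u \<cdot> x) \<in> S" using 1(5-9) xy by simp
  qed (use 1 2 xy m in auto)
qed

lemma roof_rel_equiv: "equiv (roofs C B) (roof_rel C B)"
proof (rule equivI)
  show "roof_rel C B \<subseteq> roofs C B \<times> roofs C B" by (auto simp: roof_rel_def)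
  show "refl_on (roofs C B) (roof_rel C B)"
  proof (rule refl_onI)
    fix r assume "r \<in> roofs C B"
    then obtain s f where r: "r = (s, f)" "(s, f) \<in> roofs C B" by (cases r) auto
    then have "s \<in> S" "f \<in> Arr C" "Dom C f = Dom C s" by (auto simp: roofs_iff)
    then show "(r, r) \<in> roof_rel C B"
      unfolding r(1) using r(2) S_Arr[of s]
      by (intro roof_relI[of _ _ _ _ "Ident C (Dom C s)" "Ident C (Dom C s)"]) auto
  qed
  show "sym (roof_rel C B)"
  proof (rule symI, clarify)
    fix s f t g assume "((s, f), (t, g)) \<in> roof_rel C B"
    then obtain u v where "(s, f) \<in> roofs C B" "(t, g) \<in> roofs C B" "Cod C s = Cod C t" "Cod C f = Cod C g"
      "u \<in> Arr C" "v \<in> Arr C" "Dom C u = Dom C v" "Cod C u = Dom C s" "Cod C v = Dom C t"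
      "s \<cdot> u = t \<cdot> v" "s \<cdot> u \<in> S" "f \<cdot> u = g \<cdot> v" by (rule roof_relE)
    then show "((t, g), (s, f)) \<in> roof_rel C B" by (intro roof_relI[of _ _ _ _ v u]) auto
  qed
  show "trans (roof_rel C B)"
    using roof_rel_trans by (auto intro!: transI)
qed

abbreviation roof :: "'m \<Rightarrow> 'm \<Rightarrow> ('m \<times> 'm) set" where
  "roof s f \<equiv> roof_class C B (s, f)"

abbreviation Quot :: "('o, ('m \<times> 'm) set) preadd_cat" where
  "Quot \<equiv> serre_quotient C B"

abbreviation comp_Quot (infixl "\<star>" 70) where
  "\<psi> \<star> \<phi> \<equiv> \<psi> \<cdot>\<^bsub>Quot\<^esub> \<phi>"

lemma roof_mem: "(t, g) \<in> roof s f \<longleftrightarrow> ((s, f), (t, g)) \<in> roof_rel C B"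
  by (simp add: roof_class_def)

lemma roof_eq_iff:
  assumes "(s, f) \<in> roofs C B" "(t, g) \<in> roofs C B"
  shows "roof s f = roof t g \<longleftrightarrow> ((s, f), (t, g)) \<in> roof_rel C B"
  unfolding roof_class_def using eq_equiv_class_iff[OF roof_rel_equiv assms] .

lemma roof_eqI: "((s, f), (t, g)) \<in> roof_rel C B \<Longrightarrow> roof s f = roof t g"
  unfolding roof_class_def by (rule equiv_class_eq[OF roof_rel_equiv])

lemma roof_refine:
  assumes "(s, f) \<in> roofs C B" "u \<in> Arr C" "Cod C u = Dom C s" "s \<cdot> u \<in> S"
  shows "roof (s \<cdot> u) (f \<cdot> u) = roof s f"
proof (rule roof_eqI)
  have "s \<in> S" "f \<in> Arr C" "Dom C f = Dom C s" using assms by (auto simp: roofs_iff)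
  then show "((s \<cdot> u, f \<cdot> u), (s, f)) \<in> roof_rel C B"
    using assms S_Arr[of s] by (intro roof_relI[of _ _ _ _ "Ident C (Dom C u)" u]) (auto simp: roofs_iff)
qed

lemma roof_self: "(s, f) \<in> roofs C B \<Longrightarrow> (s, f) \<in> roof s f"
  unfolding roof_class_def by (rule equiv_class_self[OF roof_rel_equiv])

text \<open>Equivalent roofs have the same ends, so the choice by \<open>SOME\<close> in
  \<open>serre_quotient\<close> is immaterial.\<close>

lemma Quot_Dom_Cod:
  assumes "(s, f) \<in> roofs C B"
  shows "roof s f \<in> Arr Quot" "Dom Quot (roof s f) = Cod C s" "Cod Quot (roof s f) = Cod C f"
proof -
  show "roof s f \<in> Arr Quot"
    using assms by (simp add: serre_quotient_def roof_class_def quotientI)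
  let ?r = "SOME r. r \<in> roof s f"
  have "?r \<in> roof s f" using roof_self[OF assms] by (rule someI)
  then have "((s, f), (fst ?r, snd ?r)) \<in> roof_rel C B" using roof_mem[of "fst ?r" "snd ?r"] by simp
  then have "Cod C (fst ?r) = Cod C s" "Cod C (snd ?r) = Cod C f"
    by (auto simp: roof_rel_def)
  then show "Dom Quot (roof s f) = Cod C s" "Cod Quot (roof s f) = Cod C f"
    by (simp_all add: serre_quotient_def)
qed

lemma Quot_HomE:
  assumes "\<phi> \<in> Hom Quot X Y"
  obtains s f where "\<phi> = roof s f" "(s, f) \<in> roofs C B" "s \<in> S" "s \<in> Arr C" "f \<in> Arr C"
    "Dom C f = Dom C s" "Cod C s = X" "Cod C f = Y"
proof -
  have "\<phi> \<in> roofs C B // roof_rel C B" using assms by (simp add: Hom_def serre_quotient_def)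
  then obtain s f where sf: "(s, f) \<in> roofs C B" "\<phi> = roof s f"
    by (auto simp: roof_class_def elim!: quotientE)
  then show ?thesis using that Quot_Dom_Cod[OF sf(1)] assms S_Arr by (auto simp: Hom_def roofs_iff)
qed

lemma Quot_HomI:
  assumes "s \<in> S" "f \<in> Arr C" "Dom C f = Dom C s" "Cod C s = X" "Cod C f = Y"
  shows "roof s f \<in> Hom Quot X Y"
  using Quot_Dom_Cod[of s f] assms by (simp add: Hom_def roofs_iff)

text \<open>The filling of two composable roofs as in the \<open>Comp\<close> field of
  \<open>serre_quotient\<close>: it is \<open>s u\<close>, rather than \<open>u\<close>, that has to
  be in \<open>S\<close>.\<close>

definition completes :: "'m \<Rightarrow> 'm \<Rightarrow> 'm \<Rightarrow> 'm \<Rightarrow> 'm \<Rightarrow> 'm \<Rightarrow> bool" where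
  "completes s f t g u v \<longleftrightarrow> u \<in> Arr C \<and> v \<in> Arr C \<and> Dom C u = Dom C v \<and> Cod C u = Dom C s \<and>
     Cod C v = Dom C t \<and> s \<cdot> u \<in> S \<and> f \<cdot> u = t \<cdot> v"

text \<open>\<open>complete_equal\<close> equalises \<open>u\<close> and \<open>u'\<close>. The
  arrows \<open>v x\<close> and \<open>v' y\<close> then agree only after composition with
  \<open>t\<close>, and cancelling \<open>t\<close> costs the further refinement
  \<open>z\<close>.\<close>

lemma completes_unique:
  assumes r: "(s, f) \<in> roofs C B" "(t, g) \<in> roofs C B" "Cod C f = Cod C t"
    and 1: "completes s f t g u v" and 2: "completes s f t g u' v'"
  shows "roof (s \<cdot> u) (g \<cdot> v) = roof (s \<cdot> u') (g \<cdot> v')"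
proof -
  have m: "s \<in> S" "t \<in> S" "f \<in> Arr C" "g \<in> Arr C" "Dom C f = Dom C s" "Dom C g = Dom C t"
    using r by (auto simp: roofs_iff)
  note [simp] = m(3,4) S_Arr[OF m(1)] S_Arr[OF m(2)]
  have u: "u \<in> Arr C" "v \<in> Arr C" "Dom C u = Dom C v" "Cod C u = Dom C s"
     "Cod C v = Dom C t" "s \<cdot> u \<in> S" "f \<cdot> u = t \<cdot> v"
    and u': "u' \<in> Arr C" "v' \<in> Arr C" "Dom C u' = Dom C v'" "Cod C u' = Dom C s"
     "Cod C v' = Dom C t" "s \<cdot> u' \<in> S" "f \<cdot> u' = t \<cdot> v'"
    using 1 2 by (auto simp: completes_def)
  obtain x y where xy: "x \<in> S" "x \<in> Arr C" "y \<in> Arr C" "Dom C x = Dom C y" "Cod C x = Dom C u"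
    "Cod C y = Dom C u'" "u \<cdot> x = u' \<cdot> y"
    using complete_equal[OF m(1) u(1,4,6) u'(1,4,6)] by blast
  have "t \<cdot> (v \<cdot> x) = f \<cdot> (u \<cdot> x)" using Comp_eq_Comp[OF u(7), of x] u xy m by simp
  also have "\<dots> = t \<cdot> (v' \<cdot> y)"
    unfolding xy(7) using Comp_eq_Comp[OF u'(7), of y] u' xy m by simp
  finally have "t \<cdot> (v \<cdot> x) = t \<cdot> (v' \<cdot> y)" .
  then obtain z where z: "z \<in> S" "Cod C z = Dom C (v \<cdot> x)" "v \<cdot> x \<cdot> z = v' \<cdot> y \<cdot> z"
    using S_cancel[OF m(2), of "v \<cdot> x" "v' \<cdot> y"] xy u u' by auto
  have [simp]: "z \<in> Arr C" using z S_Arr by simp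
  have eq: "u \<cdot> (x \<cdot> z) = u' \<cdot> (y \<cdot> z)"
    using Comp_eq_Comp[OF xy(7), of z] z u u' xy by simp
  show ?thesis
  proof (rule roof_eqI, rule roof_relI[of _ _ _ _ "x \<cdot> z" "y \<cdot> z"])
    show "s \<cdot> u \<cdot> (x \<cdot> z) = s \<cdot> u' \<cdot> (y \<cdot> z)" using eq z u u' xy by simp
    show "g \<cdot> v \<cdot> (x \<cdot> z) = g \<cdot> v' \<cdot> (y \<cdot> z)" using z u u' xy m by simp
    show "s \<cdot> u \<cdot> (x \<cdot> z) \<in> S"
      by (rule S_comp[OF S_comp[OF z(1) xy(1)] u(6)]) (use z u xy in auto)
  qed (use z u u' xy m in \<open>auto simp: roofs_iff\<close>)
qed

lemma completes_exists:
  assumes "(s, f) \<in> roofs C B" "(t, g) \<in> roofs C B" "Cod C f = Cod C t"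
  obtains u v where "completes s f t g u v" "u \<in> S"
proof -
  have m: "s \<in> S" "t \<in> S" "f \<in> Arr C" "g \<in> Arr C" "Dom C f = Dom C s" "Dom C g = Dom C t"
    using assms by (auto simp: roofs_iff)
  obtain u v where "u \<in> S" "u \<in> Arr C" "v \<in> Arr C" "Dom C v = Dom C u" "Cod C u = Dom C f"
    "Cod C v = Dom C t" "f \<cdot> u = t \<cdot> v"
    using S_ore[OF m(2,3)] assms by metis
  then show ?thesis using that[of u v] m S_comp[of u s] by (simp add: completes_def)
qed

text \<open>One filling serves both roofs: complete the common refinement \<open>(s a, f a)\<close>
  and transport the result along \<open>a\<close> and along \<open>b\<close>.\<close>

lemma completes_roof_left:
  assumes r: "((s, f), (s1, f1)) \<in> roof_rel C B" and t: "(t, g) \<in> roofs C B" "Cod C f = Cod C t"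
    and 1: "completes s f t g u v" and 2: "completes s1 f1 t g u' v'"
  shows "roof (s \<cdot> u) (g \<cdot> v) = roof (s1 \<cdot> u') (g \<cdot> v')"
proof -
  obtain a b where ab: "(s, f) \<in> roofs C B" "(s1, f1) \<in> roofs C B" "Cod C s = Cod C s1" "Cod C f = Cod C f1"
    "a \<in> Arr C" "b \<in> Arr C" "Dom C a = Dom C b" "Cod C a = Dom C s" "Cod C b = Dom C s1"
    "s \<cdot> a = s1 \<cdot> b" "s \<cdot> a \<in> S" "f \<cdot> a = f1 \<cdot> b"
    using r by (rule roof_relE)
  have m: "s \<in> S" "t \<in> S" "s1 \<in> S" "f \<in> Arr C" "f1 \<in> Arr C" "g \<in> Arr C" "Dom C f = Dom C s"
    "Dom C f1 = Dom C s1" "Dom C g = Dom C t"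
    using ab t by (auto simp: roofs_iff)
  note [simp] = m(4-6) S_Arr[OF m(1)] S_Arr[OF m(2)] S_Arr[OF m(3)]
  obtain x y where xy: "x \<in> S" "x \<in> Arr C" "y \<in> Arr C" "Dom C y = Dom C x" "Cod C x = Dom C a"
    "Cod C y = Dom C t" "f \<cdot> a \<cdot> x = t \<cdot> y"
    using S_ore[OF m(2), of "f \<cdot> a"] ab t m by auto
  have "s \<cdot> a \<cdot> x \<in> S" using S_comp[OF xy(1) ab(11)] xy ab by simp
  then have S1: "s \<cdot> (a \<cdot> x) \<in> S" "s1 \<cdot> (b \<cdot> x) \<in> S"
    using ab xy Comp_eq_Comp[OF ab(10), of x] by simp_all
  have f1: "f1 \<cdot> (b \<cdot> x) = t \<cdot> y" "f \<cdot> (a \<cdot> x) = t \<cdot> y"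
    using xy ab m Comp_eq_Comp[OF ab(12), of x] by simp_all
  have c: "completes s f t g (a \<cdot> x) y" "completes s1 f1 t g (b \<cdot> x) y"
    using xy ab S1 f1 m by (simp_all add: completes_def)
  have "s \<cdot> (a \<cdot> x) = s1 \<cdot> (b \<cdot> x)"
    using Comp_eq_Comp[OF ab(10), of x] xy ab by simp
  then show ?thesis
    using completes_unique[OF ab(1) t 1 c(1)] completes_unique[OF ab(2) t(1) _ 2 c(2)] t ab by simp
qed

lemma completes_roof_right:
  assumes s: "(s, f) \<in> roofs C B" "Cod C f = Cod C t" and r: "((t, g), (t1, g1)) \<in> roof_rel C B"
    and 1: "completes s f t g u v" and 2: "completes s f t1 g1 u' v'"
  shows "roof (s \<cdot> u) (g \<cdot> v) = roof (s \<cdot> u') (g1 \<cdot> v')"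
proof -
  obtain a b where ab: "(t, g) \<in> roofs C B" "(t1, g1) \<in> roofs C B" "Cod C t = Cod C t1" "Cod C g = Cod C g1"
    "a \<in> Arr C" "b \<in> Arr C" "Dom C a = Dom C b" "Cod C a = Dom C t" "Cod C b = Dom C t1"
    "t \<cdot> a = t1 \<cdot> b" "t \<cdot> a \<in> S" "g \<cdot> a = g1 \<cdot> b"
    using r by (rule roof_relE)
  have m: "s \<in> S" "t \<in> S" "t1 \<in> S" "g \<in> Arr C" "g1 \<in> Arr C" "f \<in> Arr C" "Dom C g = Dom C t"
    "Dom C g1 = Dom C t1" "Dom C f = Dom C s"
    using ab s by (auto simp: roofs_iff)
  note [simp] = m(4-6) S_Arr[OF m(1)] S_Arr[OF m(2)] S_Arr[OF m(3)]
  obtain x y where xy: "x \<in> S" "x \<in> Arr C" "y \<in> Arr C" "Dom C y = Dom C x" "Cod C x = Dom C f"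
    "Cod C y = Dom C a" "f \<cdot> x = t \<cdot> a \<cdot> y"
    using S_ore[OF ab(11), of f] ab s m by auto
  have S1: "s \<cdot> x \<in> S" using S_comp[OF xy(1) m(1)] xy m by simp
  have f1: "f \<cdot> x = t \<cdot> (a \<cdot> y)" "f \<cdot> x = t1 \<cdot> (b \<cdot> y)"
    using xy ab m Comp_eq_Comp[OF ab(10), of y] by simp_all
  have c: "completes s f t g x (a \<cdot> y)" "completes s f t1 g1 x (b \<cdot> y)"
    using xy ab S1 f1 m by (simp_all add: completes_def)
  have "g \<cdot> (a \<cdot> y) = g1 \<cdot> (b \<cdot> y)"
    using Comp_eq_Comp[OF ab(12), of y] xy ab m by simp
  then show ?thesis
    using completes_unique[OF s(1) ab(1) s(2) 1 c(1)] completes_unique[OF s(1) ab(2) _ 2 c(2)] s ab by simp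
qed

text \<open>All classes in the union coincide, so composites may be computed from any convenient
  filling.\<close>

lemma Quot_Comp:
  assumes r: "(s, f) \<in> roofs C B" "(t, g) \<in> roofs C B" "Cod C f = Cod C t"
    and c: "completes s f t g u v"
  shows "roof t g \<star> roof s f = roof (s \<cdot> u) (g \<cdot> v)"
proof -
  have comp: "roof (s' \<cdot> u') (g' \<cdot> v') = roof (s \<cdot> u) (g \<cdot> v)"
    if "(s', f') \<in> roof s f" "(t', g') \<in> roof t g" "u' \<in> Hom C W (Dom C s')" "v' \<in> Hom C W (Dom C t')"
      "s' \<cdot> u' \<in> S" "f' \<cdot> u' = t' \<cdot> v'" for s' f' t' g' u' v' W
  proof -
    have c': "completes s' f' t' g' u' v'" using that by (auto simp: completes_def Hom_def)
    have r': "((s, f), (s', f')) \<in> roof_rel C B" "((t, g), (t', g')) \<in> roof_rel C B"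
      using that by (simp_all add: roof_mem)
    then have m: "(s', f') \<in> roofs C B" "(t', g') \<in> roofs C B" "Cod C f = Cod C f'" "Cod C t = Cod C t'"
      by (auto simp: roof_rel_def)
    \<comment> \<open>Change one factor at a time, by way of a completion of the mixed pair
      \<open>(s', f')\<close>, \<open>(t, g)\<close>.\<close>
    obtain a b where ab: "completes s' f' t g a b" using completes_exists[OF m(1) r(2)] r(3) m(3) by metis
    show ?thesis
      using completes_roof_left[OF r'(1) r(2,3) c ab] completes_roof_right[OF m(1) _ r'(2) ab c'] r(3) m(3)
      by simp
  qed
  have "roof t g \<star> roof s f = \<Union> {roof (s' \<cdot> u') (g' \<cdot> v') | s' f' t' g' u' v' W.
    (s', f') \<in> roof s f \<and> (t', g') \<in> roof t g \<and> u' \<in> Hom C W (Dom C s') \<and> v' \<in> Hom C W (Dom C t') \<and>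
    s' \<cdot> u' \<in> S \<and> f' \<cdot> u' = t' \<cdot> v'}" (is "_ = \<Union> ?M")
    by (simp add: serre_quotient_def)
  moreover have "?M \<subseteq> {roof (s \<cdot> u) (g \<cdot> v)}" using comp by blast
  moreover have "roof (s \<cdot> u) (g \<cdot> v) \<in> ?M"
  proof -
    have "u \<in> Hom C (Dom C u) (Dom C s)" "v \<in> Hom C (Dom C u) (Dom C t)" "s \<cdot> u \<in> S" "f \<cdot> u = t \<cdot> v"
      using c by (auto simp: completes_def Hom_def)
    then show ?thesis using roof_self[OF r(1)] roof_self[OF r(2)] by blast
  qed
  ultimately show ?thesis by blast
qed

text \<open>Two representatives with common left leg \<open>s'\<close> are compared with
  \<open>(s, f)\<close> and \<open>(s, g)\<close> by separate refinements. These are made into one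
  by \<open>complete_equal\<close> on the side of \<open>s\<close> and by cancelling
  \<open>s'\<close> on the other side.\<close>

lemma Quot_Add:
  assumes r: "(s, f) \<in> roofs C B" "(s, g) \<in> roofs C B" "Cod C f = Cod C g"
  shows "Add Quot (roof s f) (roof s g) = roof s (Add C f g)"
proof -
  have comp: "roof s' (Add C f' g') = roof s (Add C f g)"
    if mem: "(s', f') \<in> roof s f" "(s', g') \<in> roof s g" for s' f' g'
  proof -
    obtain b a where ab: "(s', f') \<in> roofs C B" "Cod C s = Cod C s'" "Cod C f = Cod C f'"
      "b \<in> Arr C" "a \<in> Arr C" "Dom C b = Dom C a" "Cod C b = Dom C s" "Cod C a = Dom C s'"
      "s \<cdot> b = s' \<cdot> a" "s \<cdot> b \<in> S" "f \<cdot> b = f' \<cdot> a"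
      using mem(1) unfolding roof_mem by (blast elim: roof_relE)
    obtain d c where cd: "(s', g') \<in> roofs C B" "Cod C g = Cod C g'"
      "d \<in> Arr C" "c \<in> Arr C" "Dom C d = Dom C c" "Cod C d = Dom C s" "Cod C c = Dom C s'"
      "s \<cdot> d = s' \<cdot> c" "s \<cdot> d \<in> S" "g \<cdot> d = g' \<cdot> c"
      using mem(2) unfolding roof_mem by (blast elim: roof_relE)
    have m: "s \<in> S" "s' \<in> S" "f \<in> Arr C" "g \<in> Arr C" "f' \<in> Arr C" "g' \<in> Arr C"
      "Dom C f = Dom C s" "Dom C g = Dom C s" "Dom C f' = Dom C s'" "Dom C g' = Dom C s'"
      using ab cd r by (auto simp: roofs_iff)
    note [simp] = m(3-6) S_Arr[OF m(1)] S_Arr[OF m(2)]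
    obtain x y where xy: "x \<in> S" "x \<in> Arr C" "y \<in> Arr C" "Dom C x = Dom C y" "Cod C x = Dom C b"
      "Cod C y = Dom C d" "b \<cdot> x = d \<cdot> y"
      using complete_equal[OF m(1) ab(4,7,10) cd(3,6,9)] by blast
    have "s' \<cdot> (a \<cdot> x) = s \<cdot> (b \<cdot> x)" using Comp_eq_Comp[OF ab(9), of x] ab xy by simp
    also have "\<dots> = s' \<cdot> (c \<cdot> y)" unfolding xy(7) using Comp_eq_Comp[OF cd(8), of y] cd xy by simp
    finally have "s' \<cdot> (a \<cdot> x) = s' \<cdot> (c \<cdot> y)" .
    then obtain z where z: "z \<in> S" "Cod C z = Dom C (a \<cdot> x)" "a \<cdot> x \<cdot> z = c \<cdot> y \<cdot> z"
      using S_cancel[OF m(2), of "a \<cdot> x" "c \<cdot> y"] xy ab cd by auto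
    have [simp]: "z \<in> Arr C" using z S_Arr by simp
    have z': "Cod C z = Dom C y" using z ab xy by simp
    have S1: "s \<cdot> b \<cdot> (x \<cdot> z) \<in> S"
      by (rule S_comp[OF S_comp[OF z(1) xy(1)] ab(10)]) (use z ab xy in auto)
    have s: "s \<cdot> (b \<cdot> (x \<cdot> z)) = s' \<cdot> (a \<cdot> (x \<cdot> z))"
      using Comp_eq_Comp[OF ab(9), of "x \<cdot> z"] ab xy z' by simp
    have f: "f \<cdot> (b \<cdot> (x \<cdot> z)) = f' \<cdot> (a \<cdot> (x \<cdot> z))"
      using Comp_eq_Comp[OF ab(11), of "x \<cdot> z"] ab xy z' m by simp
    have "g \<cdot> (b \<cdot> (x \<cdot> z)) = g \<cdot> (d \<cdot> (y \<cdot> z))"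
      using Comp_eq_Comp[OF xy(7), of z] ab cd xy z' m by simp
    also have "\<dots> = g' \<cdot> (c \<cdot> (y \<cdot> z))"
      using Comp_eq_Comp[OF cd(10), of "y \<cdot> z"] cd xy z' m by simp
    also have "\<dots> = g' \<cdot> (a \<cdot> (x \<cdot> z))"
      using z ab cd xy z' m by simp
    finally have g: "g \<cdot> (b \<cdot> (x \<cdot> z)) = g' \<cdot> (a \<cdot> (x \<cdot> z))" .
    show ?thesis
      by (rule roof_eqI[symmetric], rule roof_relI[of _ _ _ _ "b \<cdot> (x \<cdot> z)" "a \<cdot> (x \<cdot> z)"])
        (use s f g S1 r ab cd xy z' m in \<open>auto simp: roofs_iff\<close>)
  qed
  have "Add Quot (roof s f) (roof s g) =
      \<Union> {roof s' (Add C f' g') | s' f' g'. (s', f') \<in> roof s f \<and> (s', g') \<in> roof s g}" (is "_ = \<Union> ?M")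
    by (simp add: serre_quotient_def)
  moreover have "?M \<subseteq> {roof s (Add C f g)}" using comp by blast
  moreover have "roof s (Add C f g) \<in> ?M"
    using roof_self[OF r(1)] roof_self[OF r(2)] by blast
  ultimately show ?thesis by blast
qed

section \<open>The quotient as a preadditive category\<close>

lemma Quot_simps [simp]:
  "Obj Quot = Obj C" "Ident Quot X = roof (Ident C X) (Ident C X)"
  "Zer Quot X Y = roof (Ident C X) (Zer C X Y)"
  by (simp_all add: serre_quotient_def)

lemma Quot_common:
  assumes \<phi>: "\<phi> \<in> Hom Quot X Y" and \<psi>: "\<psi> \<in> Hom Quot X Z"
  obtains s f g where "\<phi> = roof s f" "\<psi> = roof s g" "s \<in> S" "s \<in> Arr C" "f \<in> Arr C" "g \<in> Arr C"
    "Dom C f = Dom C s" "Dom C g = Dom C s" "Cod C s = X" "Cod C f = Y" "Cod C g = Z"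
proof -
  obtain s f where s: "\<phi> = roof s f" "(s, f) \<in> roofs C B" "s \<in> S" "s \<in> Arr C" "f \<in> Arr C"
    "Dom C f = Dom C s" "Cod C s = X" "Cod C f = Y" using Quot_HomE[OF \<phi>] by metis
  obtain t g where t: "\<psi> = roof t g" "(t, g) \<in> roofs C B" "t \<in> S" "t \<in> Arr C" "g \<in> Arr C"
    "Dom C g = Dom C t" "Cod C t = X" "Cod C g = Z" using Quot_HomE[OF \<psi>] by metis
  obtain x y where x: "x \<in> S" "x \<in> Arr C" "y \<in> Arr C" "Dom C x = Dom C y" "Cod C x = Dom C s"
    "Cod C y = Dom C t" "s \<cdot> x = t \<cdot> y" "s \<cdot> x \<in> S"
    using common_denominator[OF s(3) t(3)] s t by metis
  show ?thesis
  proof (rule that[of "s \<cdot> x" "f \<cdot> x" "g \<cdot> y"])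
    show "\<phi> = roof (s \<cdot> x) (f \<cdot> x)" using roof_refine[OF s(2) x(2,5,8)] s by simp
    have "t \<cdot> y \<in> S" using x by simp
    from roof_refine[OF t(2) x(3,6) this] show "\<psi> = roof (s \<cdot> x) (g \<cdot> y)" using x t by simp
  qed (use s t x in auto)
qed

lemma Quot_common3:
  assumes \<phi>: "\<phi> \<in> Hom Quot X Y" and \<psi>: "\<psi> \<in> Hom Quot X Z" and \<chi>: "\<chi> \<in> Hom Quot X W"
  obtains s f g h where "\<phi> = roof s f" "\<psi> = roof s g" "\<chi> = roof s h" "s \<in> S" "s \<in> Arr C" "f \<in> Arr C"
    "g \<in> Arr C" "h \<in> Arr C" "Dom C f = Dom C s" "Dom C g = Dom C s" "Dom C h = Dom C s"
    "Cod C s = X" "Cod C f = Y" "Cod C g = Z" "Cod C h = W"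
proof -
  obtain s f g where s: "\<phi> = roof s f" "\<psi> = roof s g" "s \<in> S" "s \<in> Arr C" "f \<in> Arr C" "g \<in> Arr C"
    "Dom C f = Dom C s" "Dom C g = Dom C s" "Cod C s = X" "Cod C f = Y" "Cod C g = Z"
    using Quot_common[OF \<phi> \<psi>] by metis
  obtain t h where t: "\<chi> = roof t h" "(t, h) \<in> roofs C B" "t \<in> S" "t \<in> Arr C" "h \<in> Arr C"
    "Dom C h = Dom C t" "Cod C t = X" "Cod C h = W" using Quot_HomE[OF \<chi>] by metis
  obtain x y where x: "x \<in> S" "x \<in> Arr C" "y \<in> Arr C" "Dom C x = Dom C y" "Cod C x = Dom C s"
    "Cod C y = Dom C t" "s \<cdot> x = t \<cdot> y" "s \<cdot> x \<in> S"
    using common_denominator[OF s(3) t(3)] s t by metis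
  have r: "(s, f) \<in> roofs C B" "(s, g) \<in> roofs C B" using s by (auto simp: roofs_iff)
  show ?thesis
  proof (rule that[of "s \<cdot> x" "f \<cdot> x" "g \<cdot> x" "h \<cdot> y"])
    show "\<phi> = roof (s \<cdot> x) (f \<cdot> x)" using roof_refine[OF r(1) x(2,5,8)] s by simp
    show "\<psi> = roof (s \<cdot> x) (g \<cdot> x)" using roof_refine[OF r(2) x(2,5,8)] s by simp
    have "t \<cdot> y \<in> S" using x by simp
    from roof_refine[OF t(2) x(3,6) this] show "\<chi> = roof (s \<cdot> x) (h \<cdot> y)" using x t by simp
  qed (use s t x in auto)
qed

lemma Quot_Comp':
  assumes "s \<in> S" "f \<in> Arr C" "Dom C f = Dom C s" "t \<in> S" "g \<in> Arr C" "Dom C g = Dom C t"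
    "Cod C f = Cod C t" "u \<in> Arr C" "v \<in> Arr C" "Dom C u = Dom C v" "Cod C u = Dom C s"
     "Cod C v = Dom C t" "s \<cdot> u \<in> S" "f \<cdot> u = t \<cdot> v"
  shows "roof t g \<star> roof s f = roof (s \<cdot> u) (g \<cdot> v)"
  by (rule Quot_Comp) (use assms in \<open>auto simp: roofs_iff completes_def\<close>)

lemma Quot_Add':
  assumes "s \<in> S" "f \<in> Arr C" "Dom C f = Dom C s" "g \<in> Arr C" "Dom C g = Dom C s" "Cod C f = Cod C g"
  shows "Add Quot (roof s f) (roof s g) = roof s (Add C f g)"
  by (rule Quot_Add) (use assms in \<open>auto simp: roofs_iff\<close>)

lemma Quot_Zer_refine:
  assumes "s \<in> S" "Cod C s = X" "Y \<in> Obj C"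
  shows "roof (Ident C X) (Zer C X Y) = roof s (Zer C (Dom C s) Y)"
proof -
  have [simp]: "s \<in> Arr C" "X \<in> Obj C" using assms S_Arr by auto
  have "(Ident C X, Zer C X Y) \<in> roofs C B" using S_Ident assms by (simp add: roofs_iff)
  from roof_refine[OF this, of s] show ?thesis using assms by simp
qed

lemma Quot_Ident_Hom:
  assumes "X \<in> Obj C" shows "roof (Ident C X) (Ident C X) \<in> Hom Quot X X"
  using Quot_HomI[OF S_Ident] assms by simp

lemma Quot_Comp_Hom:
  assumes \<phi>: "\<phi> \<in> Hom Quot X Y" and \<psi>: "\<psi> \<in> Hom Quot Y Z"
  shows "\<psi> \<star> \<phi> \<in> Hom Quot X Z"
proof -
  obtain s f where s: "\<phi> = roof s f" "s \<in> S" "s \<in> Arr C" "f \<in> Arr C"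
    "Dom C f = Dom C s" "Cod C s = X" "Cod C f = Y" using Quot_HomE[OF \<phi>] by metis
  obtain t g where t: "\<psi> = roof t g" "t \<in> S" "t \<in> Arr C" "g \<in> Arr C"
    "Dom C g = Dom C t" "Cod C t = Y" "Cod C g = Z" using Quot_HomE[OF \<psi>] by metis
  obtain u v where u: "u \<in> S" "u \<in> Arr C" "v \<in> Arr C" "Dom C v = Dom C u" "Cod C u = Dom C f"
    "Cod C v = Dom C t" "f \<cdot> u = t \<cdot> v" using S_ore[OF t(2) s(4)] s t by metis
  have su: "s \<cdot> u \<in> S" using S_comp u s by simp
  have "\<psi> \<star> \<phi> = roof (s \<cdot> u) (g \<cdot> v)"
    unfolding s(1) t(1) by (rule Quot_Comp') (use s t u su in auto)
  also have "\<dots> \<in> Hom Quot X Z" by (rule Quot_HomI[OF su]) (use s t u in auto)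
  finally show ?thesis .
qed

lemma Quot_Comp_Ident:
  assumes \<phi>: "\<phi> \<in> Hom Quot X Y"
  shows "\<phi> \<star> roof (Ident C X) (Ident C X) = \<phi>" "roof (Ident C Y) (Ident C Y) \<star> \<phi> = \<phi>"
proof -
  obtain s f where s: "\<phi> = roof s f" "s \<in> S" "s \<in> Arr C" "f \<in> Arr C"
    "Dom C f = Dom C s" "Cod C s = X" "Cod C f = Y" using Quot_HomE[OF \<phi>] by metis
  have [simp]: "X \<in> Obj C" "Y \<in> Obj C" using s by auto
  have "roof s f \<star> roof (Ident C X) (Ident C X) = roof (Ident C X \<cdot> s) (f \<cdot> Ident C (Dom C s))"
    by (rule Quot_Comp') (use s S_Ident in auto)
  then show "\<phi> \<star> roof (Ident C X) (Ident C X) = \<phi>" using s by simp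
  have "roof (Ident C Y) (Ident C Y) \<star> roof s f = roof (s \<cdot> Ident C (Dom C s)) (Ident C Y \<cdot> f)"
    by (rule Quot_Comp') (use s S_Ident in auto)
  then show "roof (Ident C Y) (Ident C Y) \<star> \<phi> = \<phi>" using s by simp
qed

lemma Quot_assoc:
  assumes \<phi>: "\<phi> \<in> Hom Quot W X" and \<psi>: "\<psi> \<in> Hom Quot X Y" and \<chi>: "\<chi> \<in> Hom Quot Y Z"
  shows "\<chi> \<star> \<psi> \<star> \<phi> = \<chi> \<star> (\<psi> \<star> \<phi>)"
proof -
  obtain s f where s: "\<phi> = roof s f" "s \<in> S" "s \<in> Arr C" "f \<in> Arr C"
    "Dom C f = Dom C s" "Cod C s = W" "Cod C f = X" using Quot_HomE[OF \<phi>] by metis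
  obtain t g where t: "\<psi> = roof t g" "t \<in> S" "t \<in> Arr C" "g \<in> Arr C"
    "Dom C g = Dom C t" "Cod C t = X" "Cod C g = Y" using Quot_HomE[OF \<psi>] by metis
  obtain r h where r: "\<chi> = roof r h" "r \<in> S" "r \<in> Arr C" "h \<in> Arr C"
    "Dom C h = Dom C r" "Cod C r = Y" "Cod C h = Z" using Quot_HomE[OF \<chi>] by metis
  obtain w w' where w: "w \<in> S" "w \<in> Arr C" "w' \<in> Arr C" "Dom C w' = Dom C w" "Cod C w = Dom C g"
    "Cod C w' = Dom C r" "g \<cdot> w = r \<cdot> w'" using S_ore[OF r(2) t(4)] t r by metis
  have tw: "t \<cdot> w \<in> S" using S_comp w t by simp
  obtain x y where x: "x \<in> S" "x \<in> Arr C" "y \<in> Arr C" "Dom C y = Dom C x" "Cod C x = Dom C f"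
    "Cod C y = Dom C (t \<cdot> w)" "f \<cdot> x = t \<cdot> w \<cdot> y"
    using S_ore[OF tw s(4)] s t w by (metis Comp_typing(3))
  have sx: "s \<cdot> x \<in> S" using S_comp x s by simp
  have 1: "roof r h \<star> roof t g = roof (t \<cdot> w) (h \<cdot> w')"
    by (rule Quot_Comp') (use t r w tw in auto)
  have 2: "roof (t \<cdot> w) (h \<cdot> w') \<star> roof s f = roof (s \<cdot> x) (h \<cdot> w' \<cdot> y)"
    by (rule Quot_Comp') (use s t r w tw x sx in auto)
  have 3: "roof t g \<star> roof s f = roof (s \<cdot> x) (g \<cdot> (w \<cdot> y))"
    by (rule Quot_Comp') (use s t r w tw x sx in auto)
  \<comment> \<open>The right leg \<open>g (w y)\<close> already equals \<open>r (w' y)\<close>, so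
    an identity completes the composite with \<open>roof r h\<close>.\<close>
  have 4: "roof r h \<star> roof (s \<cdot> x) (g \<cdot> (w \<cdot> y)) =
      roof (s \<cdot> x \<cdot> Ident C (Dom C x)) (h \<cdot> (w' \<cdot> y))"
    by (rule Quot_Comp') (use s t r w tw x sx Comp_eq_Comp[OF w(7), of y] in auto)
  show ?thesis unfolding s(1) t(1) r(1) 1 2 3 4 using s t r w x by simp
qed

lemma Quot_comm_group:
  assumes [simp]: "X \<in> Obj C" "Y \<in> Obj C"
  shows "comm_group (hom_group Quot X Y)"
proof (rule comm_groupI; simp only: hom_group_def monoid.simps partial_object.simps Quot_simps)
  show "roof (Ident C X) (Zer C X Y) \<in> Hom Quot X Y"
    using Quot_HomI[OF S_Ident] by simp
  fix \<phi> assume \<phi>: "\<phi> \<in> Hom Quot X Y"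
  { obtain s f where s: "\<phi> = roof s f" "s \<in> S" "s \<in> Arr C" "f \<in> Arr C"
      "Dom C f = Dom C s" "Cod C s = X" "Cod C f = Y" using Quot_HomE[OF \<phi>] by metis
    note z = Quot_Zer_refine[OF s(2,6), of Y]
    show "Add Quot (roof (Ident C X) (Zer C X Y)) \<phi> = \<phi>"
      unfolding z[OF assms(2)] s(1) using s by (subst Quot_Add') auto
    have "roof s (Neg C f) \<in> Hom Quot X Y" by (rule Quot_HomI) (use s in auto)
    moreover have "Add Quot (roof s (Neg C f)) \<phi> = roof (Ident C X) (Zer C X Y)"
      unfolding z[OF assms(2)] s(1) using s by (subst Quot_Add') auto
    ultimately show "\<exists>\<psi>\<in>Hom Quot X Y. Add Quot \<psi> \<phi> = roof (Ident C X) (Zer C X Y)" by blast }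
  fix \<psi> assume \<psi>: "\<psi> \<in> Hom Quot X Y"
  { obtain s f g where s: "\<phi> = roof s f" "\<psi> = roof s g" "s \<in> S" "s \<in> Arr C" "f \<in> Arr C" "g \<in> Arr C"
    "Dom C f = Dom C s" "Dom C g = Dom C s" "Cod C s = X" "Cod C f = Y" "Cod C g = Y"
      using Quot_common[OF \<phi> \<psi>] by metis
    have a: "Add Quot \<phi> \<psi> = roof s (Add C f g)" "Add Quot \<psi> \<phi> = roof s (Add C g f)"
      unfolding s(1,2) using s by (subst Quot_Add'; simp)+
    show "Add Quot \<phi> \<psi> \<in> Hom Quot X Y" unfolding a by (rule Quot_HomI) (use s in auto)
    show "Add Quot \<phi> \<psi> = Add Quot \<psi> \<phi>" unfolding a using Add_commute[of f g] s by simp }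
  fix \<chi> assume \<chi>: "\<chi> \<in> Hom Quot X Y"
  obtain s f g h where s: "\<phi> = roof s f" "\<psi> = roof s g" "\<chi> = roof s h" "s \<in> S" "s \<in> Arr C" "f \<in> Arr C"
    "g \<in> Arr C" "h \<in> Arr C" "Dom C f = Dom C s" "Dom C g = Dom C s" "Dom C h = Dom C s"
    "Cod C s = X" "Cod C f = Y" "Cod C g = Y" "Cod C h = Y"
    using Quot_common3[OF \<phi> \<psi> \<chi>] by metis
  have a: "Add Quot \<phi> \<psi> = roof s (Add C f g)" "Add Quot \<psi> \<chi> = roof s (Add C g h)"
    "Add Quot (roof s (Add C f g)) \<chi> = roof s (Add C (Add C f g) h)"
    "Add Quot \<phi> (roof s (Add C g h)) = roof s (Add C f (Add C g h))"
    unfolding s(1-3) using s by (subst Quot_Add'; simp)+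
  show "Add Quot (Add Quot \<phi> \<psi>) \<chi> = Add Quot \<phi> (Add Quot \<psi> \<chi>)"
    unfolding a using Add_assoc[of f g h] s by simp
qed

lemma Quot_Comp_Add_right:
  assumes \<phi>: "\<phi> \<in> Hom Quot X Y" "\<phi>' \<in> Hom Quot X Y" and \<psi>: "\<psi> \<in> Hom Quot Y Z"
  shows "\<psi> \<star> Add Quot \<phi> \<phi>' = Add Quot (\<psi> \<star> \<phi>) (\<psi> \<star> \<phi>')"
proof -
  obtain s f f' where s: "\<phi> = roof s f" "\<phi>' = roof s f'" "s \<in> S" "s \<in> Arr C" "f \<in> Arr C" "f' \<in> Arr C"
    "Dom C f = Dom C s" "Dom C f' = Dom C s" "Cod C s = X" "Cod C f = Y" "Cod C f' = Y"
    using Quot_common[OF \<phi>] by metis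
  obtain t g where t: "\<psi> = roof t g" "t \<in> S" "t \<in> Arr C" "g \<in> Arr C"
    "Dom C g = Dom C t" "Cod C t = Y" "Cod C g = Z" using Quot_HomE[OF \<psi>] by metis
  obtain u v where u: "u \<in> S" "u \<in> Arr C" "v \<in> Arr C" "Dom C v = Dom C u" "Cod C u = Dom C f"
    "Cod C v = Dom C t" "f \<cdot> u = t \<cdot> v" using S_ore[OF t(2) s(5)] s t by metis
  \<comment> \<open>A second completion on top of the first gives both composites the same left leg
    \<open>s (u u')\<close>, so that they can be added.\<close>
  obtain u' v' where u': "u' \<in> S" "u' \<in> Arr C" "v' \<in> Arr C" "Dom C v' = Dom C u'"
    "Cod C u' = Dom C (f' \<cdot> u)" "Cod C v' = Dom C t" "f' \<cdot> u \<cdot> u' = t \<cdot> v'"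
    using S_ore[OF t(2), of "f' \<cdot> u"] s t u by auto
  let ?w = "u \<cdot> u'"
  have Sw: "s \<cdot> ?w \<in> S" using S_comp[OF S_comp[OF u'(1) u(1)] s(3)] s u u' by simp
  have e: "f \<cdot> ?w = t \<cdot> (v \<cdot> u')" "f' \<cdot> ?w = t \<cdot> v'"
    using Comp_eq_Comp[OF u(7), of u'] s t u u' by simp_all
  have 1: "\<psi> \<star> \<phi> = roof (s \<cdot> ?w) (g \<cdot> (v \<cdot> u'))"
    unfolding s(1) t(1) by (rule Quot_Comp') (use s t u u' Sw e in auto)
  have 2: "\<psi> \<star> \<phi>' = roof (s \<cdot> ?w) (g \<cdot> v')"
    unfolding s(2) t(1) by (rule Quot_Comp') (use s t u u' Sw e in auto)
  have 3: "\<psi> \<star> roof s (Add C f f') = roof (s \<cdot> ?w) (g \<cdot> Add C (v \<cdot> u') v')"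
    unfolding t(1) by (rule Quot_Comp') (use s t u u' Sw e in auto)
  have "Add Quot \<phi> \<phi>' = roof s (Add C f f')"
    unfolding s(1,2) by (rule Quot_Add') (use s in auto)
  then show ?thesis
    unfolding 1 2 using 3 Quot_Add'[OF Sw, of "g \<cdot> (v \<cdot> u')" "g \<cdot> v'"] s t u u' by simp
qed

lemma Quot_Comp_Add_left:
  assumes \<phi>: "\<phi> \<in> Hom Quot X Y" and \<psi>: "\<psi> \<in> Hom Quot Y Z" "\<psi>' \<in> Hom Quot Y Z"
  shows "Add Quot \<psi> \<psi>' \<star> \<phi> = Add Quot (\<psi> \<star> \<phi>) (\<psi>' \<star> \<phi>)"
proof -
  obtain t g g' where t: "\<psi> = roof t g" "\<psi>' = roof t g'" "t \<in> S" "t \<in> Arr C" "g \<in> Arr C" "g' \<in> Arr C"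
    "Dom C g = Dom C t" "Dom C g' = Dom C t" "Cod C t = Y" "Cod C g = Z" "Cod C g' = Z"
    using Quot_common[OF \<psi>] by metis
  obtain s f where s: "\<phi> = roof s f" "s \<in> S" "s \<in> Arr C" "f \<in> Arr C"
    "Dom C f = Dom C s" "Cod C s = X" "Cod C f = Y" using Quot_HomE[OF \<phi>] by metis
  obtain u v where u: "u \<in> S" "u \<in> Arr C" "v \<in> Arr C" "Dom C v = Dom C u" "Cod C u = Dom C f"
    "Cod C v = Dom C t" "f \<cdot> u = t \<cdot> v" using S_ore[OF t(3) s(4)] s t by metis
  have Su: "s \<cdot> u \<in> S" using S_comp u s by simp
  have 1: "\<psi> \<star> \<phi> = roof (s \<cdot> u) (g \<cdot> v)"
    unfolding s(1) t(1) by (rule Quot_Comp') (use s t u Su in auto)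
  have 2: "\<psi>' \<star> \<phi> = roof (s \<cdot> u) (g' \<cdot> v)"
    unfolding s(1) t(2) by (rule Quot_Comp') (use s t u Su in auto)
  have 3: "roof t (Add C g g') \<star> \<phi> = roof (s \<cdot> u) (Add C g g' \<cdot> v)"
    unfolding s(1) by (rule Quot_Comp') (use s t u Su in auto)
  have "Add Quot \<psi> \<psi>' = roof t (Add C g g')"
    unfolding t(1,2) by (rule Quot_Add') (use t in auto)
  then show ?thesis
    unfolding 1 2 using 3 Quot_Add'[OF Su, of "g \<cdot> v" "g' \<cdot> v"] s t u by simp
qed

lemma preadditive_Quot: "preadditive_category Quot"
proof (intro preadditive_category.intro category.intro preadditive_category_axioms.intro)
  fix f assume "f \<in> Arr Quot"
  then have "f \<in> Hom Quot (Dom Quot f) (Cod Quot f)" by (simp add: Hom_def)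
  then obtain s g where "s \<in> Arr C" "g \<in> Arr C" "Cod C s = Dom Quot f" "Cod C g = Cod Quot f"
    using Quot_HomE by metis
  then show "Dom Quot f \<in> Obj Quot" "Cod Quot f \<in> Obj Quot"
    using Cod_in_Obj[of s] Cod_in_Obj[of g] by auto
qed (simp_all only: Quot_simps Quot_Ident_Hom Quot_Comp_Hom Quot_Comp_Ident Quot_assoc
      Quot_comm_group Quot_Comp_Add_right Quot_Comp_Add_left)

section \<open>The quotient functor\<close>

abbreviation q :: "'m \<Rightarrow> ('m \<times> 'm) set" where
  "q \<equiv> quot_map C B"

lemma q_Hom:
  assumes "f \<in> Arr C" shows "q f \<in> Hom Quot (Dom C f) (Cod C f)"
  unfolding quot_map_def using Quot_HomI[OF S_Ident] assms by simp

lemma q_Ident: "X \<in> Obj C \<Longrightarrow> q (Ident C X) = Ident Quot X"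
  by (simp add: quot_map_def)

lemma q_Comp:
  assumes "f \<in> Arr C" "g \<in> Arr C" "Cod C f = Dom C g"
  shows "q (g \<cdot> f) = q g \<star> q f"
  unfolding quot_map_def
  by (subst Quot_Comp'[where u = "Ident C (Dom C f)" and v = f]) (use assms S_Ident in auto)

lemma q_Add:
  assumes "f \<in> Arr C" "g \<in> Arr C" "Dom C f = Dom C g" "Cod C f = Cod C g"
  shows "q (Add C f g) = Add Quot (q f) (q g)"
  unfolding quot_map_def using assms S_Ident by (simp add: Quot_Add')

text \<open>The roofs \<open>(1, f)\<close> and \<open>(1, 0)\<close> are equivalent exactly when
  some arrow of \<open>S\<close> kills \<open>f\<close>, which is negligibility.\<close>

lemma q_Zer_iff:
  assumes f: "f \<in> Arr C"
  shows "q f = Zer Quot (Dom C f) (Cod C f) \<longleftrightarrow> negligible C B f" (is "?L \<longleftrightarrow> ?R")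
proof -
  let ?i = "Ident C (Dom C f)" and ?z = "Zer C (Dom C f) (Cod C f)"
  have r: "(?i, f) \<in> roofs C B" "(?i, ?z) \<in> roofs C B" using f S_Ident by (auto simp: roofs_iff)
  have "?L \<longleftrightarrow> ((?i, f), (?i, ?z)) \<in> roof_rel C B"
    using roof_eq_iff[OF r] f by (simp add: quot_map_def)
  also have "\<dots> \<longleftrightarrow> (\<exists>s\<in>S. Cod C s = Dom C f \<and> f \<cdot> s = Zer C (Dom C s) (Cod C f))"
  proof
    assume "((?i, f), (?i, ?z)) \<in> roof_rel C B"
    then obtain u v where "u \<in> Arr C" "v \<in> Arr C" "Dom C u = Dom C v" "Cod C u = Dom C ?i" "Cod C v = Dom C ?i"
      "?i \<cdot> u = ?i \<cdot> v" "?i \<cdot> u \<in> S" "f \<cdot> u = ?z \<cdot> v"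
      by (blast elim: roof_relE)
    then show "\<exists>s\<in>S. Cod C s = Dom C f \<and> f \<cdot> s = Zer C (Dom C s) (Cod C f)"
      using f by (intro bexI[of _ u]) auto
  next
    assume "\<exists>s\<in>S. Cod C s = Dom C f \<and> f \<cdot> s = Zer C (Dom C s) (Cod C f)"
    then obtain s where "s \<in> S" "Cod C s = Dom C f" "f \<cdot> s = Zer C (Dom C s) (Cod C f)" by blast
    then show "((?i, f), (?i, ?z)) \<in> roof_rel C B"
      using r f S_Arr[of s] by (intro roof_relI[of _ _ _ _ s s]) auto
  qed
  also have "\<dots> \<longleftrightarrow> ?R" using negligible_iff[OF f] by simp
  finally show ?thesis .
qed

lemma roof_Comp_q:
  assumes "s \<in> S" "f \<in> Arr C" "Dom C f = Dom C s"
  shows "roof s f \<star> q s = q f"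
  unfolding quot_map_def
  by (subst Quot_Comp'[where u = "Ident C (Dom C s)" and v = "Ident C (Dom C s)"])
    (use assms S_Ident S_Arr[OF assms(1)] in auto)

lemma q_iso:
  assumes s: "s \<in> S"
  shows "is_iso Quot (q s)"
proof -
  interpret Q: preadditive_category Quot by (rule preadditive_Quot)
  have [simp]: "s \<in> Arr C" using s by (rule S_Arr)
  \<comment> \<open>The inverse of \<open>q s\<close> is the roof with left leg \<open>s\<close> and
    the identity as right leg.\<close>
  have h: "roof s (Ident C (Dom C s)) \<in> Hom Quot (Cod C s) (Dom C s)"
    using Quot_HomI[OF s] by simp
  have i: "Ident C X \<in> S" if "X \<in> Obj C" for X using S_Ident that .
  have 1: "roof s (Ident C (Dom C s)) \<star> q s = Ident Quot (Dom C s)"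
    using roof_Comp_q[OF s, of "Ident C (Dom C s)"] by (simp add: quot_map_def)
  have "q s \<star> roof s (Ident C (Dom C s)) = roof (s \<cdot> Ident C (Dom C s)) (s \<cdot> Ident C (Dom C s))"
    unfolding quot_map_def by (rule Quot_Comp') (use s i in auto)
  also have "\<dots> = Ident Quot (Cod C s)"
    using roof_refine[of "Ident C (Cod C s)" "Ident C (Cod C s)" s] i s by (simp add: roofs_iff)
  finally show ?thesis
    using 1 h q_Hom[of s] unfolding is_iso_def Hom_def by (intro conjI bexI[of _ "roof s (Ident C (Dom C s))"]) auto
qed

end

section \<open>Exactness of the quotient functor\<close>

text \<open>
  The axioms are stated for right fractions; left fractions follow from push-outs, so the notion is
  self-dual and every statement about kernels yields one about cokernels.
\<close>

locale serre_localization = A: serre_category A B + Q: preadditive_category Q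
  for A :: "('o, 'm, 'x) preadd_cat_scheme" and B :: "'o set" and Q :: "('o, 'n, 'y) preadd_cat_scheme" +
  fixes q :: "'m \<Rightarrow> 'n"
  assumes Obj_Q: "Obj Q = Obj A"
    and q_Hom: "f \<in> Arr A \<Longrightarrow> q f \<in> Hom Q (Dom A f) (Cod A f)"
    and q_Ident: "X \<in> Obj A \<Longrightarrow> q (Ident A X) = Ident Q X"
    and q_Comp: "\<lbrakk>f \<in> Arr A; g \<in> Arr A; Cod A f = Dom A g\<rbrakk> \<Longrightarrow> q (g \<cdot>\<^bsub>A\<^esub> f) = q g \<cdot>\<^bsub>Q\<^esub> q f"
    and q_Add: "\<lbrakk>f \<in> Arr A; g \<in> Arr A; Dom A f = Dom A g; Cod A f = Cod A g\<rbrakk>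
      \<Longrightarrow> q (Add A f g) = Add Q (q f) (q g)"
    and q_Zer_iff: "f \<in> Arr A \<Longrightarrow> q f = Zer Q (Dom A f) (Cod A f) \<longleftrightarrow> negligible A B f"
    and q_iso: "s \<in> serre_isos A B \<Longrightarrow> is_iso Q (q s)"
    and q_fraction: "\<phi> \<in> Arr Q \<Longrightarrow> \<exists>s\<in>serre_isos A B. \<exists>f\<in>Arr A. Dom A f = Dom A s \<and>
      Cod A s = Dom Q \<phi> \<and> Cod A f = Cod Q \<phi> \<and> \<phi> \<cdot>\<^bsub>Q\<^esub> q s = q f"

lemma (in serre_category) serre_localization_Quot: "serre_localization C B Quot q"
proof (intro serre_localization.intro serre_category_axioms serre_localization_axioms.intro preadditive_Quot)
  interpret Q: preadditive_category Quot by (rule preadditive_Quot)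
  show "\<exists>s\<in>S. \<exists>f\<in>Arr C. Dom C f = Dom C s \<and> Cod C s = Dom Quot \<phi> \<and> Cod C f = Cod Quot \<phi> \<and>
      \<phi> \<star> q s = q f" if "\<phi> \<in> Arr Quot" for \<phi>
  proof -
    have "\<phi> \<in> Hom Quot (Dom Quot \<phi>) (Cod Quot \<phi>)" using that by (simp add: Hom_def)
    then obtain s f where "\<phi> = roof s f" "s \<in> S" "s \<in> Arr C" "f \<in> Arr C"
      "Dom C f = Dom C s" "Cod C s = Dom Quot \<phi>" "Cod C f = Cod Quot \<phi>" using Quot_HomE by metis
    then show ?thesis using roof_Comp_q[of s f] by metis
  qed
qed (use q_Hom q_Ident q_Comp q_Add q_Zer_iff q_iso in auto)

context serre_localization
begin

abbreviation comp_A (infixl "\<bullet>" 70) where "g \<bullet> f \<equiv> g \<cdot>\<^bsub>A\<^esub> f"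
abbreviation comp_Q (infixl "\<odot>" 70) where "\<psi> \<odot> \<phi> \<equiv> \<psi> \<cdot>\<^bsub>Q\<^esub> \<phi>"

lemma q_simps [simp]:
  assumes "f \<in> Arr A"
  shows "q f \<in> Arr Q" "Dom Q (q f) = Dom A f" "Cod Q (q f) = Cod A f"
  using q_Hom[OF assms] by (auto simp: Hom_def)

lemma q_Zer: "X \<in> Obj A \<Longrightarrow> Y \<in> Obj A \<Longrightarrow> q (Zer A X Y) = Zer Q X Y"
  using q_Zer_iff[of "Zer A X Y"] A.negligible_iff[of "Zer A X Y"] A.S_Ident[of X]
  by (auto intro!: bexI[of _ "Ident A X"])

lemma fractionE:
  assumes "\<phi> \<in> Arr Q"
  obtains s f where "s \<in> serre_isos A B" "s \<in> Arr A" "f \<in> Arr A" "Dom A f = Dom A s"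
    "Cod A s = Dom Q \<phi>" "Cod A f = Cod Q \<phi>" "\<phi> \<odot> q s = q f"
  using q_fraction[OF assms] A.S_Arr by blast

lemma co_fraction:
  assumes \<phi>: "\<phi> \<in> Arr Q"
  shows "\<exists>t\<in>serre_isos A B. \<exists>g\<in>Arr A. Cod A g = Cod A t \<and> Dom A t = Cod Q \<phi> \<and> Dom A g = Dom Q \<phi> \<and>
    q t \<odot> \<phi> = q g"
proof -
  obtain s f where s: "s \<in> serre_isos A B" "s \<in> Arr A" "f \<in> Arr A" "Dom A f = Dom A s"
    "Cod A s = Dom Q \<phi>" "Cod A f = Cod Q \<phi>" "\<phi> \<odot> q s = q f" using \<phi> by (rule fractionE)
  obtain t g where t: "t \<in> serre_isos A B" "t \<in> Arr A" "g \<in> Arr A" "Cod A g = Cod A t" "Dom A t = Cod A f"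
    "Dom A g = Cod A s" "t \<bullet> f = g \<bullet> s"
    by (rule A.S_co_ore[OF s(1,3)]) (use s in auto)
  have "(q t \<odot> \<phi>) \<odot> q s = q (t \<bullet> f)" using q_Comp[of f t] s t \<phi> by simp
  also have "\<dots> = q g \<odot> q s" unfolding t(7) using s t by (simp add: q_Comp)
  finally have "q t \<odot> \<phi> = q g"
    using Q.is_epi_cancel[OF Q.is_iso_epi[OF q_iso[OF s(1)]], of "q t \<odot> \<phi>" "q g"] s t \<phi> by simp
  then show ?thesis using s t by metis
qed

lemma serre_localization_dual: "serre_localization (dual A) B (dual Q) q"
proof (intro serre_localization.intro A.serre_category_dual Q.preadditive_category_dual
    serre_localization_axioms.intro)
  show "q (Add (dual A) f g) = Add (dual Q) (q f) (q g)"
    if "f \<in> Arr (dual A)" "g \<in> Arr (dual A)" "Dom (dual A) f = Dom (dual A) g"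
      "Cod (dual A) f = Cod (dual A) g" for f g
    using q_Add that by simp
  show "\<exists>s\<in>serre_isos (dual A) B. \<exists>f\<in>Arr (dual A). Dom (dual A) f = Dom (dual A) s \<and>
       Cod (dual A) s = Dom (dual Q) \<phi> \<and> Cod (dual A) f = Cod (dual Q) \<phi> \<and>
       \<phi> \<cdot>\<^bsub>dual Q\<^esub> q s = q f" if "\<phi> \<in> Arr (dual Q)" for \<phi>
    using co_fraction that by simp
qed (use Obj_Q q_Hom q_Ident q_Comp q_Zer_iff q_iso in simp_all)

text \<open>Write \<phi> as a fraction, \<open>\<phi> q s = q g\<close>. If \<open>q k\<close> or
  \<open>q f\<close> kills \<phi>, then \<open>k g\<close> or \<open>f g\<close> is negligible and
  killed by some \<open>u\<close> in \<open>S\<close>. In the first case \<open>g u = 0\<close>; in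
  the second \<open>g u\<close> lifts through \<open>k\<close> in \<open>A\<close>. Since
  \<open>q (s u)\<close> is invertible, the conclusion carries over to \<phi>.\<close>

lemma q_kernel:
  assumes k: "is_kernel A k f"
  shows "is_kernel Q (q k) (q f)"
proof -
  note K = A.is_kernelE[OF k]
  show ?thesis
  proof (rule Q.is_kernelI)
    show "q f \<odot> q k = Zer Q (Dom Q (q k)) (Cod Q (q f))"
      using K q_Comp[OF K(1,2,3)] q_Zer[of "Dom A k" "Cod A f"] by simp
    show "is_mono Q (q k)"
    proof (rule Q.is_monoI)
      fix \<phi> assume \<phi>: "\<phi> \<in> Arr Q" "Cod Q \<phi> = Dom Q (q k)" "q k \<odot> \<phi> = Zer Q (Dom Q \<phi>) (Cod Q (q k))"
      obtain s g where s: "s \<in> serre_isos A B" "s \<in> Arr A" "g \<in> Arr A" "Dom A g = Dom A s"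
        "Cod A s = Dom Q \<phi>" "Cod A g = Cod Q \<phi>" "\<phi> \<odot> q s = q g" using \<phi>(1) by (rule fractionE)
      have "q (k \<bullet> g) = Zer Q (Dom A g) (Cod A k)"
        using Q.Comp_eqD[OF \<phi>(3), of "q s"] s \<phi> K by (simp add: q_Comp Obj_Q)
      then have "negligible A B (k \<bullet> g)" using q_Zer_iff[of "k \<bullet> g"] s \<phi> K by simp
      then obtain u where u: "u \<in> serre_isos A B" "Cod A u = Dom A g"
        "k \<bullet> g \<bullet> u = Zer A (Dom A u) (Cod A k)"
        using A.negligible_iff[of "k \<bullet> g"] s \<phi> K by auto
      note [simp] = A.S_Arr[OF u(1)]
      have "g \<bullet> u = Zer A (Dom A u) (Dom A k)"
        using A.is_mono_Zer[OF A.is_kernel_mono[OF k], of "g \<bullet> u"] u s \<phi> K by simp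
      then have "q g \<odot> q u = Zer Q (Dom A u) (Dom A k)"
        using q_Comp[of u g] q_Zer[of "Dom A u" "Dom A k"] u s K by simp
      then have "\<phi> \<odot> (q s \<odot> q u) = Zer Q (Dom A u) (Dom A k)"
        using Q.Comp_eqD[OF s(7), of "q u"] u s \<phi> K by simp
      moreover have "is_epi Q (q s \<odot> q u)"
        using Q.is_epi_comp[OF Q.is_iso_epi[OF q_iso[OF s(1)]] Q.is_iso_epi[OF q_iso[OF u(1)]]] u s by simp
      ultimately show "\<phi> = Zer Q (Dom Q \<phi>) (Dom Q (q k))"
        using Q.is_epi_Zer[of "q s \<odot> q u" \<phi>] s u \<phi> K by simp
    qed (use K in simp)
    fix \<phi> assume \<phi>: "\<phi> \<in> Arr Q" "Cod Q \<phi> = Dom Q (q f)" "q f \<odot> \<phi> = Zer Q (Dom Q \<phi>) (Cod Q (q f))"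
    obtain s g where s: "s \<in> serre_isos A B" "s \<in> Arr A" "g \<in> Arr A" "Dom A g = Dom A s"
      "Cod A s = Dom Q \<phi>" "Cod A g = Cod Q \<phi>" "\<phi> \<odot> q s = q g" using \<phi>(1) by (rule fractionE)
    have "q (f \<bullet> g) = Zer Q (Dom A g) (Cod A f)"
      using Q.Comp_eqD[OF \<phi>(3), of "q s"] s \<phi> K by (simp add: q_Comp Obj_Q)
    then have "negligible A B (f \<bullet> g)" using q_Zer_iff[of "f \<bullet> g"] s \<phi> K by simp
    then obtain u where u: "u \<in> serre_isos A B" "Cod A u = Dom A g"
      "f \<bullet> g \<bullet> u = Zer A (Dom A u) (Cod A f)"
      using A.negligible_iff[of "f \<bullet> g"] s \<phi> K by auto
    note [simp] = A.S_Arr[OF u(1)]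
    obtain v where v: "v \<in> Arr A" "Dom A v = Dom A u" "Cod A v = Dom A k" "k \<bullet> v = g \<bullet> u"
      using A.is_kernel_lift[OF k, of "g \<bullet> u"] u s \<phi> K by auto
    have su: "s \<bullet> u \<in> serre_isos A B" using A.S_comp u s by simp
    obtain \<tau> where t: "\<tau> \<in> Arr Q" "Dom Q \<tau> = Cod Q (q (s \<bullet> u))" "Cod Q \<tau> = Dom Q (q (s \<bullet> u))"
      "q (s \<bullet> u) \<odot> \<tau> = Ident Q (Cod Q (q (s \<bullet> u)))"
      using q_iso[OF su] Q.is_isoE by metis
    have "q k \<odot> q v = q g \<odot> q u"
      using q_Comp[of v k] q_Comp[of u g] v u s K by simp
    also have "\<dots> = \<phi> \<odot> q (s \<bullet> u)"
      using Q.Comp_eqD[OF s(7), of "q u"] u s \<phi> by (simp add: q_Comp)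
    finally have kv: "q k \<odot> q v = \<phi> \<odot> q (s \<bullet> u)" .
    have "q k \<odot> (q v \<odot> \<tau>) = \<phi> \<odot> (q (s \<bullet> u) \<odot> \<tau>)"
      by (rule Q.Comp_eq_Comp[OF kv]) (use v u s t \<phi> K in auto)
    also have "\<dots> = \<phi>" unfolding t(4) using s u \<phi> by simp
    finally show "\<exists>u\<in>Arr Q. Dom Q u = Dom Q \<phi> \<and> Cod Q u = Dom Q (q k) \<and> q k \<odot> u = \<phi>"
      using v t s u K by (intro bexI[of _ "q v \<odot> \<tau>"]) auto
  qed (use K in auto)
qed

lemmas q_cokernel = serre_localization.q_kernel[OF serre_localization_dual, unfolded unfold_dual]

lemma Q_kernels:
  assumes \<phi>: "\<phi> \<in> Arr Q" shows "\<exists>k. is_kernel Q k \<phi>"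
proof -
  obtain s f where s: "s \<in> serre_isos A B" "s \<in> Arr A" "f \<in> Arr A" "Dom A f = Dom A s"
    "Cod A s = Dom Q \<phi>" "Cod A f = Cod Q \<phi>" "\<phi> \<odot> q s = q f" using \<phi> by (rule fractionE)
  obtain k where "is_kernel A k f" using A.kernels s by blast
  from q_kernel[OF this] show ?thesis
    using Q.is_kernel_iso_precomp[OF q_iso[OF s(1)], of \<phi> "q k"] s \<phi> by auto
qed

text \<open>Up to an isomorphism of the source, \<phi> is \<open>q f\<close> with
  \<open>f = m e\<close> an image factorization. As \<open>q f\<close> is mono, the kernel of
  \<open>f\<close> is negligible, hence in \<open>B\<close>, so \<open>q e\<close> is invertible and
  \<phi> is isomorphic to \<open>q m\<close>, the image under \<open>q\<close> of a kernel.\<close>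

lemma Q_monos_normal:
  assumes \<phi>: "is_mono Q \<phi>" shows "\<exists>g. is_kernel Q \<phi> g"
proof -
  have p: "\<phi> \<in> Arr Q" using \<phi> by (simp add: is_mono_def)
  then obtain s f where s: "s \<in> serre_isos A B" "s \<in> Arr A" "f \<in> Arr A" "Dom A f = Dom A s"
    "Cod A s = Dom Q \<phi>" "Cod A f = Cod Q \<phi>" "\<phi> \<odot> q s = q f" by (rule fractionE)
  have mf: "is_mono Q (q f)"
    using Q.is_mono_comp[OF Q.is_iso_mono[OF q_iso[OF s(1)]] \<phi>] s by simp
  obtain m e where me: "is_mono A m" "is_epi A e" "m \<in> Arr A" "e \<in> Arr A" "Cod A e = Dom A m"
    "Dom A e = Dom A f" "Cod A m = Cod A f" "m \<bullet> e = f" using s(3) by (rule A.image_factorization)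
  have "e \<in> serre_isos A B"
  proof (rule A.S_epi[OF me(2)])
    fix k assume "is_kernel A k e"
    then have k: "is_kernel A k f" using A.is_kernel_comp_mono[OF me(1,4,5), of k] me(8) by simp
    note K = A.is_kernelE[OF k] and qK = Q.is_kernelE[OF q_kernel[OF k]]
    have "q k = Zer Q (Dom A k) (Cod A k)"
      using Q.is_mono_Zer[OF mf, of "q k"] K qK by simp
    then have "negligible A B k" using q_Zer_iff[of k] K by simp
    then show "Dom A k \<in> B" using A.negligible_mono A.is_kernel_mono[OF k] by blast
  qed
  then have ie: "is_iso Q (q e)" by (rule q_iso)
  obtain c where "is_cokernel A c m" using A.cokernels me by blast
  then have qm: "is_kernel Q (q m) (q c)" using A.mono_is_kernel_cokernel[OF me(1)] q_kernel by blast
  obtain \<tau> where t: "\<tau> \<in> Arr Q" "Dom Q \<tau> = Cod Q (q s)" "Cod Q \<tau> = Dom Q (q s)"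
      "\<tau> \<odot> q s = Ident Q (Dom Q (q s))" "q s \<odot> \<tau> = Ident Q (Cod Q (q s))"
    using q_iso[OF s(1)] Q.is_isoE by metis
  have "is_iso Q \<tau>" by (rule Q.is_isoI[of \<tau> "q s"]) (use t s in auto)
  have "is_kernel Q (q m \<odot> q e) (q c)"
    by (rule Q.is_kernel_comp_iso[OF ie qm]) (use me in simp)
  then have "is_kernel Q (q f) (q c)" using q_Comp[of e m] me by simp
  then have "is_kernel Q (q f \<odot> \<tau>) (q c)"
    by (rule Q.is_kernel_comp_iso[OF \<open>is_iso Q \<tau>\<close>]) (use t s in simp)
  moreover have "q f \<odot> \<tau> = \<phi> \<odot> (q s \<odot> \<tau>)"
    using Q.Comp_eqD[OF s(7), of \<tau>] t s p by simp
  moreover have "\<dots> = \<phi>" unfolding t(5) using s p by simp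
  ultimately show ?thesis by auto
qed

lemma abelian_Q: "abelian_category Q"
proof (intro abelian_category.intro abelian_category_axioms.intro Q.preadditive_category_axioms)
  obtain Z where Z: "is_zero_object A Z" using A.zero_object by blast
  then have [simp]: "Z \<in> Obj A" "Z \<in> Obj Q" by (auto simp: is_zero_object_def Obj_Q)
  have "Ident Q Z = Zer Q Z Z"
    using Z q_Ident[of Z] q_Zer[of Z Z] A.zero_object_iff[of Z] by simp
  then show "\<exists>Z. is_zero_object Q Z" using Q.zero_object_iff[of Z] by auto
  show "\<exists>P i1 i2 p1 p2. is_biproduct Q X Y P i1 i2 p1 p2" if XY: "X \<in> Obj Q" "Y \<in> Obj Q" for X Y
  proof -
    obtain P i1 i2 p1 p2 where P: "is_biproduct A X Y P i1 i2 p1 p2"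
      using A.biproducts[of X Y] XY by (auto simp: Obj_Q)
    note bs = A.biproduct_simps(1-19)[OF P]
    have "Add A (i1 \<bullet> p1) (i2 \<bullet> p2) = Ident A P" using P by (simp add: is_biproduct_def)
    then have "Add Q (q i1 \<odot> q p1) (q i2 \<odot> q p2) = Ident Q P"
      using bs q_Add[of "i1 \<bullet> p1" "i2 \<bullet> p2"] q_Comp[of p1 i1] q_Comp[of p2 i2] q_Ident[of P]
      by simp
    then have "is_biproduct Q X Y P (q i1) (q i2) (q p1) (q p2)"
      using bs q_Comp[of i1 p1] q_Comp[of i2 p2] q_Comp[of i1 p2] q_Comp[of i2 p1]
      by (simp add: is_biproduct_def Hom_def q_Ident q_Zer)
    then show ?thesis by blast
  qed
  show "\<exists>c. is_cokernel Q c f" if "f \<in> Arr Q" for f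
    using serre_localization.Q_kernels[OF serre_localization_dual, unfolded unfold_dual] that .
  show "\<exists>g. is_cokernel Q f g" if "is_epi Q f" for f
    using serre_localization.Q_monos_normal[OF serre_localization_dual, unfolded unfold_dual] that .
qed (use Q_kernels Q_monos_normal in auto)

end

section \<open>Closed objects\<close>

context serre_category
begin

lemma closed_torsion_free:
  assumes "Cod C f \<in> closed_objects C B" "f \<in> Arr C" "Dom C f \<in> B"
  shows "f = Zer C (Dom C f) (Cod C f)"
  using assms by (auto simp: closed_objects_def Hom_def)

text \<open>The arrow factors through \<open>B\<close>, and the factor leaving \<open>B\<close>
  already vanishes.\<close>

lemma closed_negligible:
  assumes "Cod C f \<in> closed_objects C B" "negligible C B f"
  shows "f = Zer C (Dom C f) (Cod C f)"
proof -
  obtain g h where gh: "g \<in> Arr C" "h \<in> Arr C" "Dom C g = Cod C h" "Cod C h \<in> B" "f = g \<cdot> h"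
    using assms by (auto simp: negligible_def)
  have "g = Zer C (Dom C g) (Cod C g)" using closed_torsion_free[of g] gh assms by simp
  then have "f = Zer C (Dom C g) (Cod C g) \<cdot> h" using gh by metis
  then show ?thesis using gh by simp
qed

lemma closed_split:
  assumes "short_exact C k p" "Dom C k \<in> closed_objects C B" "Cod C p \<in> B"
  obtains \<sigma> where "\<sigma> \<in> Arr C" "Dom C \<sigma> = Cod C p" "Cod C \<sigma> = Dom C p" "p \<cdot> \<sigma> = Ident C (Cod C p)"
proof -
  have e: "(k, p) \<in> extensions C (Cod C p) (Dom C k)" using assms by (simp add: extensions_def)
  have "ext_class (Cod C p) (Dom C k) (k, p) = \<one>\<^bsub>Ext1 C (Cod C p) (Dom C k)\<^esub>"
    using Ext1_carrierI[OF e] assms by (auto simp: closed_objects_def)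
  then show ?thesis using Ext1_one_iff_split[OF e] that by (auto simp: Hom_def)
qed

end

context serre_localization
begin

sublocale QA: abelian_category Q by (rule abelian_Q)

lemma q_eqD:
  assumes "q f = q g" "f \<in> Arr A" "g \<in> Arr A" "Dom A f = Dom A g" "Cod A f = Cod A g"
  obtains u where "u \<in> serre_isos A B" "u \<in> Arr A" "Cod A u = Dom A g" "f \<bullet> u = g \<bullet> u"
proof -
  let ?d = "Add A f (Neg A g)"
  have "Add A ?d g = Add A f (Add A (Neg A g) g)"
    by (rule A.Add_assoc) (use assms in auto)
  then have "Add A ?d g = f" using assms by simp
  then have "Add Q (q ?d) (q g) = q g" using q_Add[of ?d g] assms by simp
  then have "q ?d = Zer Q (Dom A ?d) (Cod A ?d)"
    using Q.Add_eq_self[of "q ?d" "q g"] assms by simp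
  then have "negligible A B ?d" using q_Zer_iff[of ?d] assms by simp
  then obtain u where u: "u \<in> serre_isos A B" "Cod A u = Dom A g" "?d \<bullet> u = Zer A (Dom A u) (Cod A g)"
    using A.negligible_iff[of ?d] assms by auto
  note [simp] = A.S_Arr[OF u(1)]
  have "f \<bullet> u = g \<bullet> u"
    by (rule A.Add_eq_Zer) (use u assms in auto)
  then show ?thesis using that u by simp
qed

text \<open>Use a left fraction, \<open>q t \<phi> = q g\<close>, with \<open>t\<close> starting at
  the closed object. The kernel of \<open>t\<close> is in \<open>B\<close>, so \<open>t\<close> is
  mono; its cokernel is in \<open>B\<close>, so \<open>t\<close> has a retraction \<open>r\<close>.
  Then \<phi> is the image of \<open>r g\<close>.\<close>

lemma closed_full:
  assumes \<phi>: "\<phi> \<in> Arr Q" and E: "Cod Q \<phi> \<in> closed_objects A B"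
  obtains f where "f \<in> Arr A" "Dom A f = Dom Q \<phi>" "Cod A f = Cod Q \<phi>" "q f = \<phi>"
proof -
  obtain t g where t: "t \<in> serre_isos A B" "g \<in> Arr A" "Cod A g = Cod A t" "Dom A t = Cod Q \<phi>"
    "Dom A g = Dom Q \<phi>" "q t \<odot> \<phi> = q g" using co_fraction[OF \<phi>] by blast
  note [simp] = A.S_Arr[OF t(1)]
  obtain k where k: "is_kernel A k t" using A.kernels by force
  note K = A.is_kernelE[OF k]
  have "k = Zer A (Dom A k) (Dom A t)"
    using A.closed_torsion_free[of k] A.S_kernel[OF t(1) k] E K t by simp
  then have mono: "is_mono A t" using A.is_kernel_mono_zero[OF k] by simp
  obtain c where c: "is_cokernel A c t" using A.cokernels by force
  have se: "short_exact A t c" using A.mono_is_kernel_cokernel[OF mono c] c by (simp add: short_exact_def)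
  obtain \<sigma> where s: "\<sigma> \<in> Arr A" "Dom A \<sigma> = Cod A c" "Cod A \<sigma> = Dom A c" "c \<bullet> \<sigma> = Ident A (Cod A c)"
    using A.closed_split[OF se] A.S_cokernel[OF t(1) c] E t by auto
  obtain r where r: "r \<in> Arr A" "Dom A r = Dom A c" "Cod A r = Dom A t" "r \<bullet> t = Ident A (Dom A t)"
    using A.short_exact_retraction[OF se s] by blast
  have C: "Dom A c = Cod A t" using A.is_cokernelE[OF c] by simp
  have "q (r \<bullet> g) = q r \<odot> (q t \<odot> \<phi>)" using q_Comp[of g r] t r C by simp
  also have "\<dots> = q (r \<bullet> t) \<odot> \<phi>" using q_Comp[of t r] t r C \<phi> by (simp del: r(4))
  also have "\<dots> = \<phi>" unfolding r(4) using t \<phi> Q.Cod_in_Obj[OF \<phi>] by (simp add: q_Ident Obj_Q)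
  finally show ?thesis using that[of "r \<bullet> g"] t r C by simp
qed

section \<open>Comparison of Ext groups with those of the quotient\<close>

definition ext_quot :: "'m \<Rightarrow> 'm \<times> 'm \<Rightarrow> 'n \<times> 'n" where
  "ext_quot i e = (q (fst e), q i \<odot> q (snd e))"

text \<open>\<open>Ext1_to_quotient\<close> for an arbitrary localization in place of the concrete
  category of roofs.\<close>

definition Ext1_quot :: "'o \<Rightarrow> 'o \<Rightarrow> 'm \<Rightarrow> ('m \<times> 'm) set \<Rightarrow> ('n \<times> 'n) set" where
  "Ext1_quot E Y i c = (\<Union>(k, p) \<in> c. ext_equiv Q E Y `` {(q k, q i \<odot> q p)})"

lemma ext_quot_in_extensions:
  assumes e: "e \<in> extensions A X Y" and i: "i \<in> serre_isos A B" "Dom A i = X" "Cod A i = E"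
  shows "ext_quot i e \<in> extensions Q E Y"
proof -
  note e' = A.extensionsE[OF e]
  note [simp] = A.S_Arr[OF i(1)]
  have iso: "is_iso Q (q i)" by (rule q_iso[OF i(1)])
  have k: "is_kernel Q (q (fst e)) (q i \<odot> q (snd e))"
    using q_kernel[OF e'(11)] Q.is_kernel_comp_mono[OF Q.is_iso_mono[OF iso], of "q (snd e)"] e' i by simp
  moreover have "is_epi Q (q i \<odot> q (snd e))"
    using Q.is_epi_comp[OF Q.is_iso_epi[OF iso] Q.is_cokernel_epi[OF q_cokernel[OF e'(12)]]] e' i by simp
  ultimately show ?thesis
    using QA.epi_is_cokernel_kernel[OF _ k] e' i
    by (simp add: extensions_def short_exact_def ext_quot_def)
qed

text \<open>One statement for two uses: with the identity for \<gamma> it says that \<open>q\<close>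
  respects push-outs, which gives additivity; with the identity for \<alpha> it gives compatibility
  with restriction along arrows of the index category.\<close>

lemma ext_quot_arrow:
  assumes e: "e \<in> extensions A X Y" and i: "i \<in> serre_isos A B" "Dom A i = X" "Cod A i = E"
    and e': "e' \<in> extensions A X' Y'" and i': "i' \<in> serre_isos A B" "Dom A i' = X'" "Cod A i' = E"
    and a: "ext_arrow A \<alpha> \<gamma> e e'" and g: "i' \<bullet> \<gamma> = i"
  shows "ext_arrow Q (q \<alpha>) (Ident Q E) (ext_quot i e) (ext_quot i' e')"
proof -
  note E = A.extensionsE[OF e] A.extensionsE[OF e']
  note [simp] = A.S_Arr[OF i(1)] A.S_Arr[OF i'(1)]
  obtain \<beta> where b: "\<alpha> \<in> Arr A" "Dom A \<alpha> = Y" "Cod A \<alpha> = Y'" "\<gamma> \<in> Arr A" "Dom A \<gamma> = X" "Cod A \<gamma> = X'"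
    "\<beta> \<in> Arr A" "Dom A \<beta> = Dom A (snd e)" "Cod A \<beta> = Dom A (snd e')"
    "\<beta> \<bullet> fst e = fst e' \<bullet> \<alpha>" "snd e' \<bullet> \<beta> = \<gamma> \<bullet> snd e"
    using A.ext_arrowE[OF e e' a] by metis
  have "q \<beta> \<odot> q (fst e) = q (fst e') \<odot> q \<alpha>"
    using q_Comp[of "fst e" \<beta>] q_Comp[of \<alpha> "fst e'"] b E by simp
  moreover have "q i' \<odot> (q (snd e') \<odot> q \<beta>) = q i \<odot> q (snd e)"
  proof -
    have "q (snd e') \<odot> q \<beta> = q \<gamma> \<odot> q (snd e)"
      using q_Comp[of \<beta> "snd e'"] q_Comp[of "snd e" \<gamma>] b E by simp
    moreover have "q i' \<odot> q \<gamma> = q i" using q_Comp[of \<gamma> i'] b i' g by simp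
    from Q.Comp_eqD[OF this, of "q (snd e)"] have "q i' \<odot> (q \<gamma> \<odot> q (snd e)) = q i \<odot> q (snd e)"
      using b i' E by simp
    ultimately show ?thesis by simp
  qed
  ultimately show ?thesis
    using b E i i'
    by (intro Q.ext_arrowI[OF ext_quot_in_extensions[OF e i] ext_quot_in_extensions[OF e' i'],
          where \<beta> = "q \<beta>"]) (auto simp: ext_quot_def Obj_Q)
qed

lemma Ext1_quot_class:
  assumes e: "e \<in> extensions A X Y" and i: "i \<in> serre_isos A B" "Dom A i = X" "Cod A i = E"
  shows "Ext1_quot E Y i (A.ext_class X Y e) = QA.ext_class E Y (ext_quot i e)"
proof -
  note [simp] = A.S_Arr[OF i(1)]
  have "QA.ext_class E Y (ext_quot i t) = QA.ext_class E Y (ext_quot i e)" if "t \<in> A.ext_class X Y e" for t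
  proof -
    have t: "t \<in> extensions A X Y" "ext_arrow A (Ident A Y) (Ident A X) e t"
      using that A.ext_class_mem[OF e] by auto
    have "ext_arrow Q (q (Ident A Y)) (Ident Q E) (ext_quot i e) (ext_quot i t)"
      by (rule ext_quot_arrow[OF e i t(1) i t(2)]) (use i in auto)
    then show ?thesis
      using QA.ext_class_eq[OF ext_quot_in_extensions[OF e i] ext_quot_in_extensions[OF t(1) i]]
        A.extensionsE(6)[OF e] q_Ident by simp
  qed
  moreover have "e \<in> A.ext_class X Y e" using A.ext_class_mem[OF e] A.ext_arrow_refl[OF e] e by simp
  moreover have "Ext1_quot E Y i (A.ext_class X Y e) =
      (\<Union>t\<in>A.ext_class X Y e. QA.ext_class E Y (ext_quot i t))"
    by (simp add: Ext1_quot_def ext_quot_def split_beta)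
  ultimately show ?thesis by blast
qed

lemma Ext1_quot_hom:
  assumes i: "i \<in> serre_isos A B" "Dom A i = X" "Cod A i = E"
  shows "Ext1_quot E Y i \<in> hom (Ext1 A X Y) (Ext1 Q E Y)"
proof (rule homI)
  note [simp] = A.S_Arr[OF i(1)]
  have ii: "i \<bullet> Ident A X = i" using i by simp
  fix x assume "x \<in> carrier (Ext1 A X Y)"
  then obtain e where e: "e \<in> extensions A X Y" "x = A.ext_class X Y e" by (rule A.Ext1_carrierE)
  then show "Ext1_quot E Y i x \<in> carrier (Ext1 Q E Y)"
    using Ext1_quot_class[OF e(1) i] QA.Ext1_carrierI[OF ext_quot_in_extensions[OF e(1) i]] by simp
  fix y assume "y \<in> carrier (Ext1 A X Y)"
  then obtain e' where e': "e' \<in> extensions A X Y" "y = A.ext_class X Y e'" by (rule A.Ext1_carrierE)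
  obtain W d \<alpha>1 \<alpha>2 where d: "d \<in> extensions A X W" and a: "ext_arrow A \<alpha>1 (Ident A X) d e"
    "ext_arrow A \<alpha>2 (Ident A X) d e'"
    using A.ext_triple[OF e(1) e'(1) e'(1)] by metis
  note t = A.ext_arrow_typing[OF d e(1) a(1)] A.ext_arrow_typing[OF d e'(1) a(2)]
  obtain s where s: "s \<in> extensions A X Y" "ext_arrow A (Add A \<alpha>1 \<alpha>2) (Ident A X) d s"
    using A.ext_push_exists[OF d, of "Add A \<alpha>1 \<alpha>2" Y] t by auto
  have q: "q (Add A \<alpha>1 \<alpha>2) = Add Q (q \<alpha>1) (q \<alpha>2)" using q_Add t by simp
  show "Ext1_quot E Y i (x \<otimes>\<^bsub>Ext1 A X Y\<^esub> y) = Ext1_quot E Y i x \<otimes>\<^bsub>Ext1 Q E Y\<^esub> Ext1_quot E Y i y"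
    unfolding e(2) e'(2) A.Ext1_mult[OF d e(1) e'(1) s(1) a s(2)] Ext1_quot_class[OF e(1) i]
      Ext1_quot_class[OF e'(1) i] Ext1_quot_class[OF s(1) i]
    by (rule QA.Ext1_mult[symmetric, OF ext_quot_in_extensions[OF d i] ext_quot_in_extensions[OF e(1) i]
          ext_quot_in_extensions[OF e'(1) i] ext_quot_in_extensions[OF s(1) i]
          ext_quot_arrow[OF d i e(1) i a(1) ii] ext_quot_arrow[OF d i e'(1) i a(2) ii]
          ext_quot_arrow[OF d i s(1) i s(2) ii, unfolded q]])
qed

lemma Ext1_quot_pull:
  assumes i: "i \<in> serre_isos A B" "Dom A i = X" "Cod A i = E"
    and i': "i' \<in> serre_isos A B" "Dom A i' = X'" "Cod A i' = E"
    and \<phi>: "\<phi> \<in> Hom A X X'" "i' \<bullet> \<phi> = i" and x: "x \<in> carrier (Ext1 A X' Y)"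
  shows "Ext1_quot E Y i (Ext1_pull A \<phi> x) = Ext1_quot E Y i' x"
proof -
  obtain e where e: "e \<in> extensions A X' Y" and x: "x = A.ext_class X' Y e"
    using x by (rule A.Ext1_carrierE)
  obtain e' where e': "e' \<in> extensions A X Y" "ext_arrow A (Ident A Y) \<phi> e' e"
    using A.ext_pull_exists[OF e, of \<phi> X] \<phi> by (auto simp: A.Hom_iff)
  have "ext_arrow Q (Ident Q Y) (Ident Q E) (ext_quot i e') (ext_quot i' e)"
    using ext_quot_arrow[OF e'(1) i e i' e'(2) \<phi>(2)] A.extensionsE(6)[OF e] q_Ident by simp
  then show ?thesis
    using QA.ext_class_eq[OF ext_quot_in_extensions[OF e'(1) i] ext_quot_in_extensions[OF e i']]
    unfolding x A.Ext1_pull_class[OF e e'] Ext1_quot_class[OF e'(1) i] Ext1_quot_class[OF e i'] by simp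
qed

lemma Ext1_quot_kernel:
  assumes i: "i \<in> serre_isos A B" "Dom A i = X" "Cod A i = E"
    and Y: "Y \<in> closed_objects A B"
    and x: "x \<in> carrier (Ext1 A X Y)" and one: "Ext1_quot E Y i x = \<one>\<^bsub>Ext1 Q E Y\<^esub>"
  obtains m where "m \<in> serre_isos A B" "is_mono A m" "Cod A m = X"
    "Ext1_pull A m x = \<one>\<^bsub>Ext1 A (Dom A m) Y\<^esub>"
proof -
  note [simp] = A.S_Arr[OF i(1)]
  obtain e where e: "e \<in> extensions A X Y" and x: "x = A.ext_class X Y e"
    using x by (rule A.Ext1_carrierE)
  note E = A.extensionsE[OF e]
  let ?k = "fst e" and ?p = "snd e"
  have "\<exists>\<sigma>\<in>Hom Q E (Dom Q (snd (ext_quot i e))). snd (ext_quot i e) \<odot> \<sigma> = Ident Q E"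
    using one QA.Ext1_one_iff_split[OF ext_quot_in_extensions[OF e i]] Ext1_quot_class[OF e i] x by simp
  then obtain \<sigma> where s: "\<sigma> \<in> Arr Q" "Dom Q \<sigma> = E" "Cod Q \<sigma> = Dom A ?p"
    "q i \<odot> (q ?p \<odot> \<sigma>) = Ident Q E"
    using E i by (auto simp: ext_quot_def Q.Hom_iff)
  \<comment> \<open>Cancelling the isomorphism \<open>q i\<close> turns the section over
    \<open>E\<close> into a section of \<open>q ?p\<close> over \<open>X\<close>.\<close>
  have "q i \<odot> (q ?p \<odot> \<sigma> \<odot> q i) = q i \<odot> Ident Q X"
    using Q.Comp_eqD[OF s(4), of "q i"] s i E by simp
  then have \<sigma>: "q ?p \<odot> (\<sigma> \<odot> q i) = Ident Q X"
    using Q.is_mono_cancel[OF Q.is_iso_mono[OF q_iso[OF i(1)]],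
        of "q ?p \<odot> \<sigma> \<odot> q i" "Ident Q X"] s i E by (simp add: Obj_Q)
  obtain s0 f0 where f0: "s0 \<in> serre_isos A B" "s0 \<in> Arr A" "f0 \<in> Arr A" "Dom A f0 = Dom A s0"
    "Cod A s0 = X" "Cod A f0 = Dom A ?p" "\<sigma> \<odot> q i \<odot> q s0 = q f0"
    using fractionE[of "\<sigma> \<odot> q i"] s i E by (metis Q.Comp_typing \<open>i \<in> Arr A\<close> q_simps)
  \<comment> \<open>The fraction gives an equality only after \<open>q\<close>; a further refinement
    \<open>u\<close> makes it hold in \<open>A\<close>, with \<open>t = s0 u\<close> as the new
    denominator.\<close>
  have "q (?p \<bullet> f0) = q ?p \<odot> (\<sigma> \<odot> q i \<odot> q s0)"
    unfolding f0(7) using q_Comp f0 E by simp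
  also have "\<dots> = q s0"
    using Q.Comp_eqD[OF \<sigma>, of "q s0"] s i f0 E by simp
  finally obtain u where u: "u \<in> serre_isos A B" "u \<in> Arr A" "Cod A u = Dom A s0"
    "?p \<bullet> f0 \<bullet> u = s0 \<bullet> u"
    by (rule q_eqD) (use f0 E in auto)
  define t f where "t = s0 \<bullet> u" and "f = f0 \<bullet> u"
  have t: "t \<in> serre_isos A B" "t \<in> Arr A" "f \<in> Arr A" "Dom A f = Dom A t" "Cod A t = X" "Cod A f = Dom A ?p"
    "?p \<bullet> f = t"
    using u f0 E A.S_comp[OF u(1) f0(1)] by (auto simp: t_def f_def)
  obtain m h where me: "is_mono A m" "is_epi A h" "m \<in> Arr A" "h \<in> Arr A" "Cod A h = Dom A m"
    "Dom A h = Dom A t" "Cod A m = Cod A t" "m \<bullet> h = t" using t(2) by (rule A.image_factorization)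
  obtain n where n: "is_kernel A n h" using A.kernels me by blast
  note N = A.is_kernelE[OF n]
  have nt: "is_kernel A n t" using A.is_kernel_comp_mono[OF me(1,4,5), of n] n me(8) by simp
  have "?p \<bullet> (f \<bullet> n) = Zer A (Dom A n) X"
    using A.Comp_eqD[OF t(7), of n] A.is_kernelE[OF nt] t E by simp
  then obtain v where v: "v \<in> Arr A" "Dom A v = Dom A n" "Cod A v = Y" "?k \<bullet> v = f \<bullet> n"
    using A.is_kernel_lift[OF E(11), of "f \<bullet> n"] t N me E by auto
  \<comment> \<open>The kernel of \<open>t\<close> lies in \<open>B\<close>, so its arrow to the
    closed object \<open>Y\<close> vanishes; this lets \<open>f\<close> descend along
    \<open>h\<close> to the image of \<open>t\<close>.\<close>
  have "v = Zer A (Dom A n) Y"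
    using A.closed_torsion_free[of v] A.S_kernel[OF t(1) nt] v Y by simp
  then have "f \<bullet> n = Zer A (Dom A n) (Dom A ?p)" using v(4) E N by simp
  then obtain g where g: "g \<in> Arr A" "Dom A g = Dom A m" "Cod A g = Dom A ?p" "g \<bullet> h = f"
    using A.is_cokernel_lift[OF A.epi_is_cokernel_kernel[OF me(2) n], of f] t N me by auto
  have "?p \<bullet> g = m"
    by (rule A.is_epi_cancel[OF me(2)]) (use g me t E in auto)
  have m: "m \<in> serre_isos A B"
  proof (rule A.S_mono[OF me(1)])
    fix c assume "is_cokernel A c m"
    then have "is_cokernel A c t" using A.is_cokernel_comp_epi[OF me(2,3), of c] me by simp
    then show "Cod A c \<in> B" using A.S_cokernel[OF t(1)] by blast
  qed
  obtain P i1 i2 p1 p2 where P: "is_biproduct A Y (Dom A m) P i1 i2 p1 p2"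
    using A.biproducts[of Y "Dom A m"] E me by auto
  note bs = A.biproduct_simps[OF P]
  have sp: "(i1, p2) \<in> extensions A (Dom A m) Y"
    using A.biproduct_short_exact[OF P] bs by (simp add: extensions_def)
  \<comment> \<open>A section \<open>g\<close> of \<open>?p\<close> over \<open>m\<close> exhibits
    the split extension as the pull-back of \<open>e\<close> along \<open>m\<close>: the middle
    arrow is \<open>?k\<close> on \<open>Y\<close> and \<open>g\<close> on the source of
    \<open>m\<close>.\<close>
  have "ext_arrow A (Ident A Y) m (i1, p2) e"
    by (rule A.ext_arrowI[OF sp e, where \<beta> = "Add A (?k \<bullet> p1) (g \<bullet> p2)"])
      (use bs E g me t \<open>?p \<bullet> g = m\<close> A.Comp_eqD[OF E(8), of p1] A.Comp_eqD[OF \<open>?p \<bullet> g = m\<close>, of p2] in simp_all)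
  then have "Ext1_pull A m x = A.ext_class (Dom A m) Y (i1, p2)"
    unfolding x by (rule A.Ext1_pull_class[OF e sp])
  also have "\<dots> = \<one>\<^bsub>Ext1 A (Dom A m) Y\<^esub>"
    unfolding A.Ext1_one_iff_split[OF sp] using bs by (intro bexI[of _ i2]) (auto simp: A.Hom_iff)
  finally show ?thesis using that[of m] m me t by simp
qed

lemma Ext1_quot_surj:
  assumes G: "G \<subseteq> closed_objects A B" "extension_closed Q G" "E \<in> G" "Y \<in> G"
    and y: "y \<in> carrier (Ext1 Q E Y)"
  obtains i x where "i \<in> serre_isos A B" "is_mono A i" "Cod A i = E" "x \<in> carrier (Ext1 A (Dom A i) Y)"
    "Ext1_quot E Y i x = y"
proof -
  obtain e where e: "e \<in> extensions Q E Y" and y: "y = QA.ext_class E Y e"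
    using y by (rule QA.Ext1_carrierE)
  note E = Q.extensionsE[OF e]
  have "short_exact Q (fst e) (snd e)" using E by (simp add: short_exact_def)
  then obtain H where H: "H \<in> G" "isomorphic Q (Cod Q (fst e)) H"
    using G E by (auto simp: extension_closed_def)
  obtain \<theta> where th: "\<theta> \<in> Hom Q (Cod Q (fst e)) H" "is_iso Q \<theta>"
    using H by (auto simp: isomorphic_def)
  obtain \<tau> where t: "\<theta> \<in> Arr Q" "\<tau> \<in> Arr Q" "Dom Q \<tau> = Cod Q \<theta>" "Cod Q \<tau> = Dom Q \<theta>"
    "\<tau> \<odot> \<theta> = Ident Q (Dom Q \<theta>)" "\<theta> \<odot> \<tau> = Ident Q (Cod Q \<theta>)" using th(2) by (rule Q.is_isoE)
  have t': "Dom Q \<theta> = Dom Q (snd e)" "Cod Q \<theta> = H" using th(1) E by (auto simp: Hom_def)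
  have cl: "E \<in> closed_objects A B" "Y \<in> closed_objects A B" "H \<in> closed_objects A B" using G H by auto
  then have [simp]: "E \<in> Obj A" "Y \<in> Obj A" "H \<in> Obj A" by (auto simp: closed_objects_def)
  \<comment> \<open>\<theta> replaces the middle term by the closed object \<open>H\<close>, so both
    arrows of the extension have closed targets and come from \<open>A\<close>.\<close>
  obtain k where k: "k \<in> Arr A" "Dom A k = Y" "Cod A k = H" "q k = \<theta> \<odot> fst e"
    using closed_full[of "\<theta> \<odot> fst e"] t t' E cl by auto
  obtain p where p: "p \<in> Arr A" "Dom A p = H" "Cod A p = E" "q p = snd e \<odot> \<tau>"
    using closed_full[of "snd e \<odot> \<tau>"] t t' E cl by auto
  have "is_iso Q \<tau>" by (rule Q.is_isoI[of \<tau> \<theta>]) (use t in auto)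
  have qk: "is_kernel Q (q k) (q p)"
    unfolding k(4)
  proof (rule Q.is_kernel_iso_precomp[OF th(2)])
    have "q p \<odot> \<theta> = snd e"
      unfolding p(4) using t t' E by simp
    then show "is_kernel Q (fst e) (q p \<odot> \<theta>)" using E by simp
  qed (use p t t' E in auto)
  have qp_epi: "is_epi Q (q p)"
    unfolding p(4) by (rule Q.is_epi_comp) (use E t t' Q.is_iso_epi \<open>is_iso Q \<tau>\<close> in auto)
  note kq = k(4) and pq = p(4)
  note k = k(1-3) and p = p(1-3)
  \<comment> \<open>The composite vanishes in the quotient, hence is negligible, and a negligible
    arrow into the closed object \<open>E\<close> is zero.\<close>
  have pk: "p \<bullet> k = Zer A Y E"
  proof -
    have "q (p \<bullet> k) = Zer Q Y E" using q_Comp[of k p] Q.is_kernelE(4)[OF qk] k p by simp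
    then show ?thesis using q_Zer_iff[of "p \<bullet> k"] A.closed_negligible[of "p \<bullet> k"] k p cl by simp
  qed
  obtain m h where me: "is_mono A m" "is_epi A h" "m \<in> Arr A" "h \<in> Arr A" "Cod A h = Dom A m"
    "Dom A h = Dom A p" "Cod A m = Cod A p" "m \<bullet> h = p" using p(1) by (rule A.image_factorization)
  \<comment> \<open>\<open>q p\<close> is epi, so the cokernel of \<open>p\<close>, which is also
    that of \<open>m\<close>, becomes zero in the quotient and its target lies in
    \<open>B\<close>.\<close>
  have mS: "m \<in> serre_isos A B"
  proof (rule A.S_mono[OF me(1)])
    fix c assume "is_cokernel A c m"
    then have c: "is_cokernel A c p" using A.is_cokernel_comp_epi[OF me(2,3), of c] me by simp
    note CC = A.is_cokernelE[OF c]
    have "q c \<odot> q p = Zer Q H (Cod A c)"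
      using q_Comp[of p c] CC p q_Zer[of H "Cod A c"] by simp
    then have "q c = Zer Q (Dom A c) (Cod A c)"
      using Q.is_epi_Zer[OF qp_epi, of "q c"] CC p by simp
    then show "Cod A c \<in> B"
      using q_Zer_iff[of c] CC A.negligible_epi A.is_cokernel_epi[OF c] by blast
  qed
  obtain n where n: "is_kernel A n h" using A.kernels me by blast
  have np: "is_kernel A n p" using A.is_kernel_comp_mono[OF me(1,4,5), of n] n me(8) by simp
  note N = A.is_kernelE[OF np]
  \<comment> \<open>\<open>v\<close> compares \<open>k\<close> with the true kernel \<open>n\<close>
    of \<open>p\<close> in \<open>A\<close>. It becomes an isomorphism in the quotient, so its
    cokernel is in \<open>B\<close>; closedness of \<open>Y\<close> and \<open>H\<close> will make
    it an isomorphism in \<open>A\<close>.\<close>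
  obtain v where v: "v \<in> Arr A" "Dom A v = Y" "Cod A v = Dom A n" "n \<bullet> v = k"
    using A.is_kernel_lift[OF np, of k] k p pk by auto
  have k_mono: "is_mono A k"
  proof -
    obtain j where j: "is_kernel A j k" using A.kernels k by blast
    note J = A.is_kernelE[OF j]
    have "q k \<odot> q j = Zer Q (Dom A j) H"
      using q_Comp[of j k] J k q_Zer[of "Dom A j" H] by simp
    then have "q j = Zer Q (Dom A j) Y"
      using Q.is_mono_Zer[OF Q.is_kernel_mono[OF qk], of "q j"] J k by simp
    then have "j = Zer A (Dom A j) Y"
      using q_Zer_iff[of j] A.closed_negligible[of j] J k cl by simp
    then show ?thesis using A.is_kernel_mono_zero[OF j] k by simp
  qed
  then have v_mono: "is_mono A v" using A.is_mono_factor[of n v] v N by simp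
  obtain w where w: "is_cokernel A w v" using A.cokernels v by blast
  note W = A.is_cokernelE[OF w]
  have vw: "short_exact A v w"
    using A.mono_is_kernel_cokernel[OF v_mono w] w by (simp add: short_exact_def)
  have WB: "Cod A w \<in> B"
  proof -
    obtain \<rho> where r: "is_iso Q \<rho>" "Dom Q \<rho> = Dom Q (q k)" "Cod Q \<rho> = Dom Q (q n)" "q n \<odot> \<rho> = q k"
      using Q.is_kernel_iso_unique[OF q_kernel[OF np] qk] by blast
    have [simp]: "\<rho> \<in> Arr Q" using r by (simp add: is_iso_def)
    have "q v = \<rho>"
      by (rule Q.is_mono_cancel[OF Q.is_kernel_mono[OF q_kernel[OF np]]])
        (use r v N k q_Comp[of v n] in auto)
    have "q w \<odot> q v = Zer Q Y (Cod A w)"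
      using q_Comp[of v w] W v q_Zer[of Y "Cod A w"] by simp
    then have "q w = Zer Q (Dom A w) (Cod A w)"
      using Q.is_epi_Zer[OF Q.is_iso_epi[OF r(1)], of "q w"] \<open>q v = \<rho>\<close> W v r N k by simp
    then show ?thesis
      using q_Zer_iff[of w] W A.negligible_epi A.is_cokernel_epi[OF w] by blast
  qed
  \<comment> \<open>The sequence of \<open>v\<close> and its cokernel splits because
    \<open>Y\<close> is closed. The section followed by \<open>n\<close> is an arrow from
    \<open>B\<close> to the closed object \<open>H\<close>, hence zero, so the cokernel vanishes and
    \<open>v\<close> is epi.\<close>
  have "is_iso A v"
  proof (rule A.mono_epi_is_iso[OF v_mono])
    obtain \<sigma> where s: "\<sigma> \<in> Arr A" "Dom A \<sigma> = Cod A w" "Cod A \<sigma> = Dom A w" "w \<bullet> \<sigma> = Ident A (Cod A w)"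
      using A.closed_split[OF vw] WB v cl by auto
    have Cn: "Cod A n = H" "Dom A w = Dom A n" using N p W v by simp_all
    have "n \<bullet> \<sigma> = Zer A (Cod A w) H"
      using A.closed_torsion_free[of "n \<bullet> \<sigma>"] s Cn WB N cl by simp
    then have "\<sigma> = Zer A (Cod A w) (Dom A n)"
      using A.is_mono_Zer[OF A.is_kernel_mono[OF n], of \<sigma>] s Cn N by simp
    then have "Ident A (Cod A w) = Zer A (Cod A w) (Cod A w)"
      using s W Cn N by simp
    then have "Ident A (Cod A w) \<bullet> w = Zer A (Cod A w) (Cod A w) \<bullet> w" by simp
    then have "w = Zer A (Cod A v) (Cod A w)" using W by simp
    then show "is_epi A v" using A.is_cokernel_epi_zero[OF w] by simp
  qed
  then have kh: "is_kernel A k h"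
    using A.is_kernel_comp_iso[OF _ n, of v] v by simp
  have ext: "(k, h) \<in> extensions A (Dom A m) Y"
    using kh A.epi_is_cokernel_kernel[OF me(2) kh] k me by (simp add: extensions_def short_exact_def)
  have eq: "ext_quot m (k, h) = (q k, q p)"
    using q_Comp[of h m] me by (simp add: ext_quot_def)
  have ex: "(q k, q p) \<in> extensions Q E Y"
    using ext_quot_in_extensions[OF ext mS, of E] eq me p by simp
  have "ext_arrow Q (Ident Q Y) (Ident Q E) e (q k, q p)"
    by (rule Q.ext_arrowI[OF e ex, where \<beta> = \<theta>]) (use E t t' k p kq pq in auto)
  then have "QA.ext_class E Y (q k, q p) = y"
    using QA.ext_class_eq[OF e ex] y by simp
  then show ?thesis
    using that[of m "A.ext_class (Dom A m) Y (k, h)"] mS me A.Ext1_carrierI[OF ext] p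
      Ext1_quot_class[OF ext mS, of E] eq by simp
qed

end

section \<open>Directed colimits of abelian groups\<close>

lemma ab_functorD:
  assumes "ab_functor J F m"
  shows "j \<in> Obj J \<Longrightarrow> comm_group (F j)"
    "u \<in> Arr J \<Longrightarrow> m u \<in> hom (F (Dom J u)) (F (Cod J u))"
    "u \<in> Arr J \<Longrightarrow> Dom J u \<in> Obj J" "u \<in> Arr J \<Longrightarrow> Cod J u \<in> Obj J"
  using assms category.Dom_in_Obj[of J] category.Cod_in_Obj[of J] unfolding ab_functor_def by blast+

lemma ab_coconeD:
  assumes "ab_cocone J F m L \<iota>"
  shows "comm_group L" "j \<in> Obj J \<Longrightarrow> \<iota> j \<in> hom (F j) L"
    "u \<in> Arr J \<Longrightarrow> x \<in> carrier (F (Dom J u)) \<Longrightarrow> \<iota> (Cod J u) (m u x) = \<iota> (Dom J u) x"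
  using assms unfolding ab_cocone_def by blast+

text \<open>Apply \<open>ker\<close> to the difference of \<open>x\<close> and \<open>y\<close>: it
  dies at a further index, and \<tau> is compatible with passing to that index.\<close>

lemma directed_cocone_cong:
  assumes F: "ab_functor J F m" and L: "ab_cocone J F m L \<iota>" and T: "ab_cocone J F m T \<tau>"
    and ker: "\<And>j x. \<lbrakk>j \<in> Obj J; x \<in> carrier (F j); \<iota> j x = \<one>\<^bsub>L\<^esub>\<rbrakk>
        \<Longrightarrow> \<exists>u\<in>Arr J. Dom J u = j \<and> m u x = \<one>\<^bsub>F (Cod J u)\<^esub>"
    and j: "j \<in> Obj J" and x: "x \<in> carrier (F j)" "y \<in> carrier (F j)" and eq: "\<iota> j x = \<iota> j y"
  shows "\<tau> j x = \<tau> j y"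
proof -
  interpret Fj: comm_group "F j" using ab_functorD(1)[OF F j] .
  interpret L: comm_group L using ab_coconeD(1)[OF L] .
  interpret T: comm_group T using ab_coconeD(1)[OF T] .
  interpret \<iota>: group_hom "F j" L "\<iota> j"
    using ab_coconeD(2)[OF L j] by unfold_locales
  interpret \<tau>: group_hom "F j" T "\<tau> j"
    using ab_coconeD(2)[OF T j] by unfold_locales
  let ?z = "x \<otimes>\<^bsub>F j\<^esub> inv\<^bsub>F j\<^esub> y"
  have "\<iota> j ?z = \<one>\<^bsub>L\<^esub>" using x eq by simp
  then obtain u where u: "u \<in> Arr J" "Dom J u = j" "m u ?z = \<one>\<^bsub>F (Cod J u)\<^esub>"
    using ker[OF j, of ?z] x by auto
  interpret Fk: comm_group "F (Cod J u)" using ab_functorD(1,4)[OF F] u by blast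
  interpret \<tau>k: group_hom "F (Cod J u)" T "\<tau> (Cod J u)"
    using ab_coconeD(2)[OF T] ab_functorD(4)[OF F] u by unfold_locales blast
  have "\<tau> j ?z = \<tau> (Cod J u) (m u ?z)" using ab_coconeD(3)[OF T u(1), of ?z] x u by simp
  also have "\<dots> = \<one>\<^bsub>T\<^esub>" using u by simp
  finally have "\<tau> j x \<otimes>\<^bsub>T\<^esub> inv\<^bsub>T\<^esub> \<tau> j y = \<one>\<^bsub>T\<^esub>" using x by simp
  then show ?thesis using x T.inv_equality[of "\<tau> j x" "inv\<^bsub>T\<^esub> \<tau> j y"] by simp
qed

text \<open>Surjectivity determines the induced map. Directedness brings any two elements to one
  index, where \<open>directed_cocone_cong\<close> gives well-definedness and the maps of the cocone
  give additivity.\<close>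

lemma directed_is_ab_colimit:
  assumes F: "ab_functor J F m" and L: "ab_cocone J F m L \<iota>"
    and dir: "\<And>j k. \<lbrakk>j \<in> Obj J; k \<in> Obj J\<rbrakk>
        \<Longrightarrow> \<exists>u\<in>Arr J. \<exists>v\<in>Arr J. Dom J u = j \<and> Dom J v = k \<and> Cod J u = Cod J v"
    and surj: "\<And>y. y \<in> carrier L \<Longrightarrow> \<exists>j\<in>Obj J. \<exists>x\<in>carrier (F j). \<iota> j x = y"
    and ker: "\<And>j x. \<lbrakk>j \<in> Obj J; x \<in> carrier (F j); \<iota> j x = \<one>\<^bsub>L\<^esub>\<rbrakk>
        \<Longrightarrow> \<exists>u\<in>Arr J. Dom J u = j \<and> m u x = \<one>\<^bsub>F (Cod J u)\<^esub>"
  shows "is_ab_colimit TYPE('t) J F m L \<iota>"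
  unfolding is_ab_colimit_def
proof (intro conjI F L allI impI)
  fix T :: "'t monoid" and \<tau> assume T: "ab_cocone J F m T \<tau>"
  interpret T: comm_group T using ab_coconeD(1)[OF T] .
  have common: "\<exists>l\<in>Obj J. \<exists>a\<in>carrier (F l). \<exists>b\<in>carrier (F l). \<iota> l a = \<iota> j x \<and> \<tau> l a = \<tau> j x \<and>
      \<iota> l b = \<iota> k y \<and> \<tau> l b = \<tau> k y"
    if j: "j \<in> Obj J" "x \<in> carrier (F j)" and k: "k \<in> Obj J" "y \<in> carrier (F k)" for j x k y
  proof -
    obtain u v where u: "u \<in> Arr J" "v \<in> Arr J" "Dom J u = j" "Dom J v = k" "Cod J u = Cod J v"
      using dir j k by blast
    have "m u x \<in> carrier (F (Cod J v))" "m v y \<in> carrier (F (Cod J v))"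
      using ab_functorD(2)[OF F u(1)] ab_functorD(2)[OF F u(2)] u j k by (auto simp: hom_def)
    then show ?thesis
      using ab_coconeD(3)[OF L u(1), of x] ab_coconeD(3)[OF L u(2), of y]
        ab_coconeD(3)[OF T u(1), of x] ab_coconeD(3)[OF T u(2), of y] ab_functorD(4)[OF F u(2)] u j k
      by (intro bexI[of _ "Cod J v"] bexI[of _ "m u x"] bexI[of _ "m v y"]) simp_all
  qed
  have cong: "\<tau> j x = \<tau> k y"
    if j: "j \<in> Obj J" "x \<in> carrier (F j)" and k: "k \<in> Obj J" "y \<in> carrier (F k)" and eq: "\<iota> j x = \<iota> k y"
    for j x k y
    using common[OF j k] directed_cocone_cong[OF F L T ker] eq by metis
  \<comment> \<open>\<open>cong\<close> makes the choice of representative immaterial, and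
    \<open>surj\<close> supplies one for every element of the carrier.\<close>
  define h where "h y = (SOME t. \<exists>j\<in>Obj J. \<exists>x\<in>carrier (F j). \<iota> j x = y \<and> t = \<tau> j x)" for y
  have h: "h (\<iota> j x) = \<tau> j x" if j: "j \<in> Obj J" "x \<in> carrier (F j)" for j x
  proof -
    have "\<exists>k\<in>Obj J. \<exists>y\<in>carrier (F k). \<iota> k y = \<iota> j x \<and> h (\<iota> j x) = \<tau> k y"
      unfolding h_def by (rule someI[of _ "\<tau> j x"]) (use j in blast)
    then show ?thesis using cong j by metis
  qed
  show "\<exists>h\<in>hom L T. (\<forall>j\<in>Obj J. \<forall>x\<in>carrier (F j). h (\<iota> j x) = \<tau> j x) \<and>
      (\<forall>h'\<in>hom L T. (\<forall>j\<in>Obj J. \<forall>x\<in>carrier (F j). h' (\<iota> j x) = \<tau> j x) \<longrightarrow> (\<forall>y\<in>carrier L. h' y = h y))"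
  proof (rule bexI[of _ h], intro conjI ballI impI)
    show "h (\<iota> j x) = \<tau> j x" if "j \<in> Obj J" "x \<in> carrier (F j)" for j x using h that .
    show "h' y = h y" if "\<forall>j\<in>Obj J. \<forall>x\<in>carrier (F j). h' (\<iota> j x) = \<tau> j x" "y \<in> carrier L" for h' y
      using surj[OF that(2)] that(1) h by metis
    show "h \<in> hom L T"
    proof (rule homI)
      fix y assume y: "y \<in> carrier L"
      then obtain j x where j: "j \<in> Obj J" "x \<in> carrier (F j)" "y = \<iota> j x" using surj by metis
      then show "h y \<in> carrier T" using h[OF j(1,2)] ab_coconeD(2)[OF T j(1)] by (auto simp: hom_def)
      fix z assume z: "z \<in> carrier L"
      then obtain k w where k: "k \<in> Obj J" "w \<in> carrier (F k)" "z = \<iota> k w" using surj by metis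
      obtain l a b where l: "l \<in> Obj J" "a \<in> carrier (F l)" "b \<in> carrier (F l)" "y = \<iota> l a" "z = \<iota> l b"
        using common[OF j(1,2) k(1,2)] j k by metis
      interpret Fl: comm_group "F l" using ab_functorD(1)[OF F l(1)] .
      have "y \<otimes>\<^bsub>L\<^esub> z = \<iota> l (a \<otimes>\<^bsub>F l\<^esub> b)" using ab_coconeD(2)[OF L l(1)] l by (simp add: hom_mult)
      then show "h (y \<otimes>\<^bsub>L\<^esub> z) = h y \<otimes>\<^bsub>T\<^esub> h z"
        using h[OF l(1)] l ab_coconeD(2)[OF T l(1)] by (simp add: hom_mult)
    qed
  qed
qed

section \<open>The category of subobjects with cokernel in the Serre subcategory\<close>

context serre_category
begin

abbreviation Subs :: "'o \<Rightarrow> ('o \<times> 'm, ('o \<times> 'm) \<times> 'm \<times> ('o \<times> 'm)) cat" where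
  "Subs E \<equiv> op_cat (sub_cat C B E)"

text \<open>A mono has zero kernel, which lies in \<open>B\<close>, so for monos the condition on
  the cokernel amounts to membership in \<open>S\<close>, a form stable under composition and
  pull-back.\<close>

lemma Subs_Obj: "a \<in> Obj (Subs E) \<longleftrightarrow>
    snd a \<in> S \<and> is_mono C (snd a) \<and> Dom C (snd a) = fst a \<and> Cod C (snd a) = E"
proof -
  have "(\<exists>c. is_cokernel C c i \<and> Cod C c \<in> B) \<longleftrightarrow> i \<in> S" if i: "is_mono C i" for i
  proof -
    obtain c where "is_cokernel C c i" using i cokernels[of i] by (auto simp: is_mono_def)
    then show ?thesis using i S_mono S_cokernel cokernel_B_unique by blast
  qed
  then show ?thesis
    by (cases a) (auto simp: op_cat_def sub_cat_def Hom_iff is_mono_def)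
qed

lemma Subs_simps [simp]:
  "u \<in> Arr (Subs E) \<longleftrightarrow> fst u \<in> Obj (Subs E) \<and> snd (snd u) \<in> Obj (Subs E) \<and>
     fst (snd u) \<in> Hom C (fst (fst u)) (fst (snd (snd u))) \<and> snd (snd (snd u)) \<cdot> fst (snd u) = snd (fst u)"
  "Dom (Subs E) u = snd (snd u)" "Cod (Subs E) u = fst u"
  "Comp (Subs E) v u = (fst v, fst (snd u) \<cdot> fst (snd v), snd (snd u))"
  "Ident (Subs E) a = (a, Ident C (fst a), a)"
  by (auto simp: op_cat_def sub_cat_def split: prod.splits)

lemma category_Subs: "category (Subs E)"
proof (intro category.intro)
  show "Ident (Subs E) a \<in> Hom (Subs E) a a" if "a \<in> Obj (Subs E)" for a
    using that S_Arr[of "snd a"] Dom_in_Obj[of "snd a"] by (auto simp: Hom_def Subs_Obj)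
  show "g \<cdot>\<^bsub>Subs E\<^esub> f \<in> Hom (Subs E) X Z" if f: "f \<in> Hom (Subs E) X Y" and g: "g \<in> Hom (Subs E) Y Z"
    for f X Y g Z
  proof -
    have f': "X \<in> Obj (Subs E)" "fst (snd f) \<in> Arr C" "Dom C (fst (snd f)) = fst Y"
      "Cod C (fst (snd f)) = fst X" "snd X \<cdot> fst (snd f) = snd Y" "snd (snd f) = X"
      using f by (auto simp: Hom_def)
    have g': "Z \<in> Obj (Subs E)" "fst (snd g) \<in> Arr C" "Dom C (fst (snd g)) = fst Z"
      "Cod C (fst (snd g)) = fst Y" "snd Y \<cdot> fst (snd g) = snd Z" "fst g = Z"
      using g by (auto simp: Hom_def)
    have "snd X \<cdot> (fst (snd f) \<cdot> fst (snd g)) = snd Z"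
      using Comp_eqD[OF f'(5), of "fst (snd g)"] f' g' S_Arr[of "snd X"] by (simp add: Subs_Obj)
    then show ?thesis using f' g' by (simp add: Hom_def)
  qed
qed (simp_all add: Hom_def Subs_Obj S_Arr prod_eq_iff)

text \<open>The common index is the intersection of the two subobjects: base change makes
  \<open>y\<close> a mono in \<open>S\<close>, and composing with \<open>snd b\<close> preserves
  this.\<close>

lemma Subs_directed:
  assumes "a \<in> Obj (Subs E)" "b \<in> Obj (Subs E)"
  shows "\<exists>u\<in>Arr (Subs E). \<exists>v\<in>Arr (Subs E).
    Dom (Subs E) u = a \<and> Dom (Subs E) v = b \<and> Cod (Subs E) u = Cod (Subs E) v"
proof -
  let ?i = "snd a" and ?j = "snd b"
  have ij: "?i \<in> S" "is_mono C ?i" "Dom C ?i = fst a" "Cod C ?i = E"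
    "?j \<in> S" "is_mono C ?j" "Dom C ?j = fst b" "Cod C ?j = E"
    using assms Subs_Obj by auto
  note [simp] = S_Arr[OF ij(1)] S_Arr[OF ij(5)]
  obtain x y where pb: "pullback ?i ?j x y" 
    by (rule pullback_exists[of ?i ?j]) (use ij in auto)
  note P = pullbackE[OF pb]
  have y: "y \<in> S" by (rule S_pullback[OF pb ij(1)])
  have "is_mono C y"
  proof (rule is_monoI[OF P(4)])
    fix w assume w: "w \<in> Arr C" "Cod C w = Dom C y" "y \<cdot> w = Zer C (Dom C w) (Cod C y)"
    have "?i \<cdot> (x \<cdot> w) = Zer C (Dom C w) E"
      using Comp_eq_Comp[OF P(9), of w] P w ij by simp
    then have "x \<cdot> w = Zer C (Dom C w) (Dom C ?i)"
      using is_mono_Zer[OF ij(2), of "x \<cdot> w"] P w ij by simp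
    then show "w = Zer C (Dom C w) (Dom C y)"
      by (rule_tac pullback_eqI[OF pb]) (use w P ij in auto)
  qed
  then have "is_mono C (?j \<cdot> y)" "?j \<cdot> y \<in> S"
    using is_mono_comp ij S_comp[OF y ij(5)] P by auto
  then have c: "(Dom C y, ?j \<cdot> y) \<in> Obj (Subs E)"
    using ij P by (simp add: Subs_Obj)
  show ?thesis
    by (rule bexI[of _ "((Dom C y, ?j \<cdot> y), x, a)"], rule bexI[of _ "((Dom C y, ?j \<cdot> y), y, b)"])
      (use assms c P ij in \<open>auto simp: Hom_def\<close>)
qed

lemma ab_functor_Ext1:
  assumes Y: "Y \<in> Obj C"
  shows "ab_functor (Subs E) (\<lambda>(X, i). Ext1 C X Y) (\<lambda>(a', \<phi>, a). Ext1_pull C \<phi>)"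
  unfolding ab_functor_def
proof (intro conjI category_Subs ballI impI)
  show "comm_group (case a of (X, i) \<Rightarrow> Ext1 C X Y)" if "a \<in> Obj (Subs E)" for a
    using that comm_group_Ext1[of "fst a" Y] Y S_Arr[of "snd a"] Dom_in_Obj[of "snd a"]
    by (auto simp: Subs_Obj split_beta)
  show "(case u of (a', \<phi>, a) \<Rightarrow> Ext1_pull C \<phi>) \<in>
      hom (case Dom (Subs E) u of (X, i) \<Rightarrow> Ext1 C X Y) (case Cod (Subs E) u of (X, i) \<Rightarrow> Ext1 C X Y)"
    if "u \<in> Arr (Subs E)" for u
    using that Ext1_pull_hom by (simp add: split_beta)
  show "(case Ident (Subs E) a of (a', \<phi>, a) \<Rightarrow> Ext1_pull C \<phi>) x = x"
    if "a \<in> Obj (Subs E)" "x \<in> carrier (case a of (X, i) \<Rightarrow> Ext1 C X Y)" for a x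
    using that Ext1_pull_Ident by (simp add: split_beta)
  show "(case Comp (Subs E) v u of (a', \<phi>, a) \<Rightarrow> Ext1_pull C \<phi>) x =
      (case v of (a', \<phi>, a) \<Rightarrow> Ext1_pull C \<phi>) ((case u of (a', \<phi>, a) \<Rightarrow> Ext1_pull C \<phi>) x)"
    if "u \<in> Arr (Subs E)" "v \<in> Arr (Subs E)" "Cod (Subs E) u = Dom (Subs E) v"
      "x \<in> carrier (case Dom (Subs E) u of (X, i) \<Rightarrow> Ext1 C X Y)" for u v x
    using that Ext1_pull_comp[of "fst (snd u)" "fst (snd (snd v))" "fst (snd (snd u))"
        "fst (snd v)" "fst (fst v)" x Y] by (simp add: split_beta)
qed

end

section \<open>Ext in the quotient as a directed colimit\<close>

theorem proposition3p13:
  fixes A :: "('o, 'm) preadd_cat" and B G :: "'o set" and G1 G2 :: 'o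
  assumes "abelian_category A"
    and "serre_subcategory A B"
    and "G \<subseteq> closed_objects A B"
    and "extension_closed (serre_quotient A B) G"
    and "G1 \<in> G" and "G2 \<in> G"
  shows "is_ab_colimit TYPE('t) (op_cat (sub_cat A B G1))
           (\<lambda>(X, i). Ext1 A X G2) (\<lambda>(a', \<phi>, a). Ext1_pull A \<phi>)
           (Ext1 (serre_quotient A B) G1 G2)
           (\<lambda>(X, i). Ext1_to_quotient A B G1 G2 i)"
proof -
  interpret S: serre_category A B
    using assms by (simp add: serre_category_def serre_category_axioms_def)
  interpret L: serre_localization A B "serre_quotient A B" "quot_map A B"
    by (rule S.serre_localization_Quot)
  have [simp]: "Ext1_to_quotient A B G1 G2 = L.Ext1_quot G1 G2"
    by (intro ext) (simp add: Ext1_to_quotient_def L.Ext1_quot_def)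
  have G: "G1 \<in> Obj A" "G2 \<in> Obj A" "G2 \<in> closed_objects A B"
    using assms by (auto simp: closed_objects_def)
  note F = S.ab_functor_Ext1[OF G(2), of G1]
  show ?thesis
  proof (rule directed_is_ab_colimit[OF F])
    show "ab_cocone (op_cat (sub_cat A B G1)) (\<lambda>(X, i). Ext1 A X G2) (\<lambda>(a', \<phi>, a). Ext1_pull A \<phi>)
           (Ext1 (serre_quotient A B) G1 G2) (\<lambda>(X, i). Ext1_to_quotient A B G1 G2 i)"
      unfolding ab_cocone_def
    proof (intro conjI ballI)
      show "comm_group (Ext1 (serre_quotient A B) G1 G2)"
        using L.QA.comm_group_Ext1 G by (simp add: L.Obj_Q)
      show "(case j of (X, i) \<Rightarrow> Ext1_to_quotient A B G1 G2 i) \<in>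
          hom (case j of (X, i) \<Rightarrow> Ext1 A X G2) (Ext1 (serre_quotient A B) G1 G2)"
        if "j \<in> Obj (S.Subs G1)" for j
        using that L.Ext1_quot_hom[of "snd j"] by (simp add: S.Subs_Obj split_beta)
      show "(case Cod (S.Subs G1) u of (X, i) \<Rightarrow> Ext1_to_quotient A B G1 G2 i)
            ((case u of (a', \<phi>, a) \<Rightarrow> Ext1_pull A \<phi>) x) =
          (case Dom (S.Subs G1) u of (X, i) \<Rightarrow> Ext1_to_quotient A B G1 G2 i) x"
        if "u \<in> Arr (S.Subs G1)" "x \<in> carrier (case Dom (S.Subs G1) u of (X, i) \<Rightarrow> Ext1 A X G2)" for u x
        using that L.Ext1_quot_pull[of "snd (fst u)" "fst (fst u)" G1 "snd (snd (snd u))"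
            "fst (snd (snd u))" "fst (snd u)" x]
        by (simp add: S.Subs_Obj split_beta)
    qed
    show "\<exists>u\<in>Arr (S.Subs G1). \<exists>v\<in>Arr (S.Subs G1).
        Dom (S.Subs G1) u = j \<and> Dom (S.Subs G1) v = k \<and> Cod (S.Subs G1) u = Cod (S.Subs G1) v"
      if "j \<in> Obj (S.Subs G1)" "k \<in> Obj (S.Subs G1)" for j k
      using S.Subs_directed[OF that] .
    show "\<exists>j\<in>Obj (S.Subs G1). \<exists>x\<in>carrier (case j of (X, i) \<Rightarrow> Ext1 A X G2).
        (case j of (X, i) \<Rightarrow> Ext1_to_quotient A B G1 G2 i) x = y"
      if y: "y \<in> carrier (Ext1 (serre_quotient A B) G1 G2)" for y
    proof -
      obtain i x where i: "i \<in> S.S" "is_mono A i" "Cod A i = G1" "x \<in> carrier (Ext1 A (Dom A i) G2)"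
        "L.Ext1_quot G1 G2 i x = y"
        using L.Ext1_quot_surj[OF assms(3-6) y] by blast
      then show ?thesis by (intro bexI[of _ "(Dom A i, i)"] bexI[of _ x]) (auto simp: S.Subs_Obj)
    qed
    show "\<exists>u\<in>Arr (S.Subs G1). Dom (S.Subs G1) u = j \<and> (case u of (a', \<phi>, a) \<Rightarrow> Ext1_pull A \<phi>) x =
        \<one>\<^bsub>case Cod (S.Subs G1) u of (X, i) \<Rightarrow> Ext1 A X G2\<^esub>"
      if j: "j \<in> Obj (S.Subs G1)" and x: "x \<in> carrier (case j of (X, i) \<Rightarrow> Ext1 A X G2)"
        and one: "(case j of (X, i) \<Rightarrow> Ext1_to_quotient A B G1 G2 i) x = \<one>\<^bsub>Ext1 (serre_quotient A B) G1 G2\<^esub>"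
      for j x
    proof -
      obtain X i where ji: "j = (X, i)" by (cases j)
      have i: "i \<in> S.S" "is_mono A i" "Dom A i = X" "Cod A i = G1" using j by (simp_all add: S.Subs_Obj ji)
      note [simp] = S.S_Arr[OF i(1)]
      obtain m where m: "m \<in> S.S" "is_mono A m" "Cod A m = X" "Ext1_pull A m x = \<one>\<^bsub>Ext1 A (Dom A m) G2\<^esub>"
        using L.Ext1_quot_kernel[OF i(1,3,4) G(3), of x] x one ji by auto
      note [simp] = S.S_Arr[OF m(1)]
      \<comment> \<open>Restriction along \<open>m\<close> is an arrow of the index category because
        \<open>i m\<close> is again a mono with cokernel in \<open>B\<close>.\<close>
      have "Comp A i m \<in> S.S" "is_mono A (Comp A i m)"
        using S.S_comp[OF m(1) i(1)] S.is_mono_comp[OF m(2) i(2)] m i by auto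
      then show ?thesis
        using m i j by (intro bexI[of _ "((Dom A m, Comp A i m), m, j)"]) (auto simp: S.Subs_Obj S.Hom_iff ji)
    qed
  qed
qed

end
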